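(* Let $\mathfrak{g}$ be the insertion-elimination algebra and $\mathrm{Aut}_{\mathbb{C}}(\mathfrak{g})$ its group of $\mathbb{C}$-linear Lie algebra automorphisms. Let $\mathcal{A}_{\mathbb{C}^*}=\{\tau_\zeta\mid\zeta\in\mathbb{C}^*\}$ and $\mathcal{A}_0=\{\mathrm{id}_{\mathfrak{g}},\tau_0\}$. Then $$\mathrm{Aut}_{\mathbb{C}}(\mathfrak{g})=\mathcal{A}_{\mathbb{C}^*}\rtimes\mathcal{A}_0,$$ where $\tau_0\circ\tau_\zeta\circ\tau_0=\tau_{\zeta^{-1}}$ for all $\zeta\in\mathbb{C}^*$.
   Context: A rooted tree is a finite connected undirected cycle-free graph $t$ with a distinguished vertex $\mathrm{rt}(t)$, its root. Rooted trees are considered up to (root-preserving graph) isomorphism; equality of rooted trees means isomorphism, and $\mathbb{T}$ is the set of all isomorphism classes of rooted trees. $V(t)$ and $E(t)$ are the sets of vertices and edges of $t$, and $|t|$ is the cardinality of $V(t)$. For $e\in E(t)$, removing $e$ divides $t$ into two rooted subtrees: $R_e(t)$ is the one containing $\mathrm{rt}(t)$, and $P_e(t)$ is the other one; a subtree is rooted at its vertex at minimal distance in $t$ from $\mathrm{rt}(t)$. For $s,t\in\mathbb{T}$ and $v\in V(s)$, $s\cup_v t$ is the rooted tree obtained by joining the root of $t$ to $s$ at $v$ by a single new edge, with root $\mathrm{rt}(s)$. For $t_1,t_2,t_3\in\mathbb{T}$ put $$\alpha(t_1,t_2,t_3)=|\{e\in E(t_2)\mid R_e(t_2)=t_3,\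 P_e(t_2)=t_1\}|,\qquad \beta(t_1,t_2,t_3)=|\{v\in V(t_3)\mid t_1=t_3\cup_v t_2\}|.$$ The insertion-elimination algebra $\mathfrak{g}$ is the Lie algebra over $\mathbb{C}$ with basis $\{d\}\cup\{D_t^{+},D_t^-\mid t\in\mathbb{T}\}$ and relations, for $s,t\in\mathbb{T}$: $[D_s^+,D_t^+]=\sum_{r\in\mathbb{T}}(\beta(r,s,t)-\beta(r,t,s))D_r^+$; $[D_s^-,D_t^-]=\sum_{r\in\mathbb{T}}(\alpha(t,r,s)-\alpha(s,r,t))D_r^-$; $[D_s^-,D_t^+]=\sum_{r\in\mathbb{T}}\alpha(s,t,r)D_r^++\sum_{r\in\mathbb{T}}\beta(s,t,r)D_r^-$ for $s\neq t$; $[D_t^-,D_t^+]=d$; $[d,D_t^-]=-|t|D_t^-$; $[d,D_t^+]=|t|D_t^+$. For $\zeta\in\mathbb{C}^*=\mathbb{C}\setminus\{0\}$, $\tau_\zeta:\mathfrak{g}\to\mathfrak{g}$ is the linear map (an automorphism of $\mathfrak{g}$) with $\tau_\zeta(d)=d$, $\tau_\zeta(D_t^+)=\zeta^{|t|}D_t^+$, $\tau_\zeta(D_t^-)=\zeta^{-|t|}D_t^-$ for $t\in\mathbb{T}$. Let $\xi_t$ be the number of graph automorphisms of $t$ (bijections $V(t)\to V(t)$ fixing the root and preserving adjacency and non-adjacency), let $\sigma:\mathfrak{g}\to\mathfrak{g}$ be the linear map (an anti-involution) with $\sigma(d)=d$, $\sigma(D_t^+)=\xi_tD_t^-$, $\sigma(D_t^-)=\xi_t^{-1}D_t^+$,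 and let $S:\mathfrak{g}\to\mathfrak{g}$, $S(x)=-x$. Then $\tau_0=\sigma\circ S$, an automorphism of $\mathfrak{g}$ (the symbol $\tau_0$ is not an instance of $\tau_\zeta$). *)

theory Defs
  imports
    Complex_Main
    "HOL-Library.FuncSet"
    "HOL-Library.Poly_Mapping"
    "HOL-Algebra.Coset"
begin

section \<open>Rooted trees\<close>

record 'a rgraph =
  verts :: "'a set"
  edges :: "'a set set"
  root :: 'a

definition adj_of :: "'a set set \<Rightarrow> ('a \<times> 'a) set" where
  "adj_of F = {(u, v). {u, v} \<in> F}"

definition is_cycle :: "'a set set \<Rightarrow> 'a list \<Rightarrow> bool" where
  "is_cycle F p \<longleftrightarrow> 3 \<le> length p \<and> distinct p \<and>
     (\<forall>i < length p. {p ! i, p ! (Suc i mod length p)} \<in> F)"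

definition rooted_tree :: "'a rgraph \<Rightarrow> bool" where
  "rooted_tree g \<longleftrightarrow>
     finite (verts g) \<and>
     edges g \<subseteq> {{u, v} | u v. u \<in> verts g \<and> v \<in> verts g \<and> u \<noteq> v} \<and>
     root g \<in> verts g \<and>
     (\<forall>u \<in> verts g. \<forall>v \<in> verts g. (u, v) \<in> (adj_of (edges g))\<^sup>*) \<and>
     (\<nexists>p. is_cycle (edges g) p)"

definition graph_isos :: "'a rgraph \<Rightarrow> 'b rgraph \<Rightarrow> ('a \<Rightarrow> 'b) set" where
  "graph_isos g h = {f \<in> verts g \<rightarrow>\<^sub>E verts h.
     bij_betw f (verts g) (verts h) \<and> f (root g) = root h \<and>
     (\<forall>u \<in> verts g. \<forall>v \<in> verts g. {u, v} \<in> edges g \<longleftrightarrow> {f u, f v} \<in> edges h)}"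

definition isomorphic :: "'a rgraph \<Rightarrow> 'b rgraph \<Rightarrow> bool" where
  "isomorphic g h \<longleftrightarrow> graph_isos g h \<noteq> {}"

definition gdist :: "'a rgraph \<Rightarrow> 'a \<Rightarrow> 'a \<Rightarrow> nat" where
  "gdist g u v = (LEAST n. (u, v) \<in> adj_of (edges g) ^^ n)"

text \<open>
  Removing the edge \<open>e\<close> leaves the component of the root, with vertex set \<open>R_verts g e\<close>, and
  its complement; each is rooted at its vertex closest to the root of \<open>g\<close>. The \<open>arg_min\<close> below is
  determined because this vertex is unique (lemmas \<open>R_root\<close> and \<open>P_root\<close>).
\<close>

definition R_verts :: "'a rgraph \<Rightarrow> 'a set \<Rightarrow> 'a set" where
  "R_verts g e = {v \<in> verts g. (root g, v) \<in> (adj_of (edges g - {e}))\<^sup>*}"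

definition rooted_sub :: "'a rgraph \<Rightarrow> 'a set \<Rightarrow> 'a rgraph" where
  "rooted_sub g W =
     \<lparr>verts = W, edges = {e \<in> edges g. e \<subseteq> W},
      root = arg_min (gdist g (root g)) (\<lambda>v. v \<in> W)\<rparr>"

definition R_part :: "'a rgraph \<Rightarrow> 'a set \<Rightarrow> 'a rgraph" where
  "R_part g e = rooted_sub g (R_verts g e)"

definition P_part :: "'a rgraph \<Rightarrow> 'a set \<Rightarrow> 'a rgraph" where
  "P_part g e = rooted_sub g (verts g - R_verts g e)"

definition graft :: "'a rgraph \<Rightarrow> 'a \<Rightarrow> 'b rgraph \<Rightarrow> ('a + 'b) rgraph" where
  "graft s v t =
     \<lparr>verts = verts s <+> verts t,
      edges = image Inl ` edges s \<union> image Inr ` edges t \<union> {{Inl v, Inr (root t)}},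
      root = Inl (root s)\<rparr>"

subsection \<open>Invariance under isomorphism\<close>

definition giso :: "('a \<Rightarrow> 'b) \<Rightarrow> 'a rgraph \<Rightarrow> 'b rgraph \<Rightarrow> bool" where
  "giso f g h \<longleftrightarrow> bij_betw f (verts g) (verts h) \<and> f (root g) = root h \<and>
     (\<forall>u \<in> verts g. \<forall>v \<in> verts g. {u, v} \<in> edges g \<longleftrightarrow> {f u, f v} \<in> edges h)"

lemma giso_restrict:
  assumes "giso f g h" "root g \<in> verts g"
  shows "restrict f (verts g) \<in> graph_isos g h"
proof -
  have "bij_betw (restrict f (verts g)) (verts g) (verts h)"
    using assms(1) unfolding giso_def by (metis bij_betw_restrict_eq)
  then show ?thesis
    using assms unfolding giso_def graph_isos_def by (auto simp: bij_betw_def)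
qed

lemma isomorphic_iff:
  assumes "root g \<in> verts g"
  shows "isomorphic g h \<longleftrightarrow> (\<exists>f. giso f g h)"
proof
  show "isomorphic g h \<Longrightarrow> \<exists>f. giso f g h"
    unfolding isomorphic_def graph_isos_def giso_def by auto
  show "\<exists>f. giso f g h \<Longrightarrow> isomorphic g h"
    using giso_restrict[OF _ assms] unfolding isomorphic_def by blast
qed

lemma giso_id: "giso id g g"
  by (simp add: giso_def)

lemma giso_inv:
  assumes "giso f g h" "root g \<in> verts g"
  shows "giso (inv_into (verts g) f) h g"
  using assms unfolding giso_def
  by (smt (verit, best) bij_betw_def bij_betw_inv_into f_inv_into_f inv_into_f_f inv_into_into)

lemma giso_comp:
  assumes "giso f g h" "giso k h l"
  shows "giso (k \<circ> f) g l"
  using assms unfolding giso_def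
  by (auto intro: bij_betw_trans simp: bij_betw_apply)

definition tree_iso :: "nat rgraph \<Rightarrow> nat rgraph \<Rightarrow> bool" where
  "tree_iso g h \<longleftrightarrow> rooted_tree g \<and> rooted_tree h \<and> isomorphic g h"

lemma rooted_tree_root: "rooted_tree g \<Longrightarrow> root g \<in> verts g"
  by (simp add: rooted_tree_def)

lemma tree_isoE:
  assumes "tree_iso g h"
  obtains f where "rooted_tree g" "rooted_tree h" "giso f g h"
  using assms isomorphic_iff rooted_tree_root unfolding tree_iso_def by blast

lemma isomorphic_sym:
  assumes "root g \<in> verts g" "root h \<in> verts h" "isomorphic g h"
  shows "isomorphic h g"
  using assms giso_inv isomorphic_iff by metis

lemma isomorphic_trans:
  assumes "root g \<in> verts g" "root h \<in> verts h" "isomorphic g h" "isomorphic h l"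
  shows "isomorphic g l"
  using assms giso_comp isomorphic_iff by metis

lemma isomorphic_cong:
  assumes "root g \<in> verts g" "root g' \<in> verts g'" "root h \<in> verts h" "root h' \<in> verts h'"
    and "isomorphic g g'" "isomorphic h h'"
  shows "isomorphic g h \<longleftrightarrow> isomorphic g' h'"
  using assms isomorphic_sym isomorphic_trans by metis

lemma rooted_tree_single: "rooted_tree \<lparr>verts = {0}, edges = {}, root = 0\<rparr>"
  by (auto simp: rooted_tree_def is_cycle_def intro!: exI[of _ 0])

lemma part_equivp_tree_iso: "part_equivp tree_iso"
proof (rule part_equivpI)
  show "\<exists>x. tree_iso x x"
    using rooted_tree_single giso_id isomorphic_iff rooted_tree_root
    unfolding tree_iso_def by metis
  show "symp tree_iso"
    by (rule sympI) (use isomorphic_sym rooted_tree_root in \<open>unfold tree_iso_def, blast\<close>)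
  show "transp tree_iso"
    by (rule transpI) (use isomorphic_trans rooted_tree_root in \<open>unfold tree_iso_def, blast\<close>)
qed


lemma card_transport:
  assumes "bij_betw f A B" "\<And>x. x \<in> A \<Longrightarrow> P x \<longleftrightarrow> Q (f x)"
  shows "card {x \<in> A. P x} = card {x \<in> B. Q x}"
proof -
  have inj: "inj_on f {x \<in> A. P x}"
    using assms(1) by (auto simp: bij_betw_def intro: inj_on_subset)
  have "{x \<in> B. Q x} = f ` {x \<in> A. P x}"
    unfolding bij_betw_imp_surj_on[OF assms(1), symmetric] using assms(2) by blast
  then show ?thesis using card_image[OF inj] by simp
qed

lemma giso_card_aut:
  assumes "rooted_tree g" "rooted_tree h" "giso f g h"
  shows "card (graph_isos g g) \<le> card (graph_isos h h)"
proof (rule card_inj_on_le)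
  let ?f' = "inv_into (verts g) f"
  let ?c = "\<lambda>k. restrict (f \<circ> k \<circ> ?f') (verts h)"
  note rg = rooted_tree_root[OF assms(1)] and rh = rooted_tree_root[OF assms(2)]
  have f': "giso ?f' h g" using giso_inv[OF assms(3) rg] .
  have b: "inj_on f (verts g)" "f ` verts g = verts h"
    using assms(3) by (auto simp: giso_def bij_betw_def)
  show "?c ` graph_isos g g \<subseteq> graph_isos h h"
  proof (intro image_subsetI)
    fix k assume "k \<in> graph_isos g g"
    then have "giso k g g" by (simp add: graph_isos_def giso_def)
    then show "?c k \<in> graph_isos h h"
      using giso_comp[OF f' giso_comp[OF _ assms(3)]] giso_restrict[OF _ rh] by blast
  qed
  show "inj_on ?c (graph_isos g g)"
  proof (rule inj_onI)
    fix k l assume k: "k \<in> graph_isos g g" and l: "l \<in> graph_isos g g" and eq: "?c k = ?c l"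
    show "k = l"
    proof (rule PiE_ext[of _ "verts g" "\<lambda>_. verts g"])
      show "k \<in> verts g \<rightarrow>\<^sub>E verts g" "l \<in> verts g \<rightarrow>\<^sub>E verts g"
        using k l by (auto simp: graph_isos_def)
      fix v assume v: "v \<in> verts g"
      then have "f (k v) = f (l v)"
        using fun_cong[OF eq, of "f v"] b(1) imageI[OF v, of f] unfolding b(2)
        by (simp add: inv_into_f_f)
      moreover have "k v \<in> verts g" "l v \<in> verts g"
        using k l v by (auto simp: graph_isos_def)
      ultimately show "k v = l v"
        using b(1) by (simp add: inj_on_eq_iff)
    qed
  qed
  have "graph_isos h h \<subseteq> verts h \<rightarrow>\<^sub>E verts h" by (auto simp: graph_isos_def)
  then show "finite (graph_isos h h)"
    using assms(2) by (meson finite_PiE finite_subset rooted_tree_def)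
qed

lemma relpow_map:
  assumes "r \<subseteq> V \<times> V" "inj_on f V" "u \<in> V" "v \<in> V"
  shows "(f u, f v) \<in> (map_prod f f ` r) ^^ n \<longleftrightarrow> (u, v) \<in> r ^^ n"
  using \<open>v \<in> V\<close>
proof (induction n arbitrary: v)
  case 0
  then show ?case using assms by (auto dest: inj_onD)
next
  case (Suc n)
  show ?case
  proof
    assume "(f u, f v) \<in> (map_prod f f ` r) ^^ Suc n"
    then obtain y' where y': "(f u, y') \<in> (map_prod f f ` r) ^^ n" "(y', f v) \<in> map_prod f f ` r"
      unfolding relpow.simps by (rule relcompEpair)
    then obtain y w where yw: "(y, w) \<in> r" "y' = f y" "f v = f w"
      by auto
    have "y \<in> V" "w \<in> V" using assms(1) yw(1) by auto
    then have "w = v" using assms(2) yw(3) Suc.prems by (simp add: inj_on_eq_iff)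
    have "(u, y) \<in> r ^^ n" using Suc.IH[OF \<open>y \<in> V\<close>] y'(1) yw(2) by blast
    then show "(u, v) \<in> r ^^ Suc n"
      using yw(1) \<open>w = v\<close> by (simp add: relcompI)
  next
    assume "(u, v) \<in> r ^^ Suc n"
    then obtain y where y: "(u, y) \<in> r ^^ n" "(y, v) \<in> r"
      by auto
    then have "y \<in> V" using assms(1) by auto
    have "(f u, f y) \<in> (map_prod f f ` r) ^^ n" using Suc.IH[OF \<open>y \<in> V\<close>] y(1) by blast
    moreover have "(f y, f v) \<in> map_prod f f ` r" using y(2) by (rule map_prod_imageI)
    ultimately show "(f u, f v) \<in> (map_prod f f ` r) ^^ Suc n"
      unfolding relpow.simps by (rule relcompI)
  qed
qed

lemma rtrancl_map:
  assumes "r \<subseteq> V \<times> V" "inj_on f V" "u \<in> V" "v \<in> V"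
  shows "(f u, f v) \<in> (map_prod f f ` r)\<^sup>* \<longleftrightarrow> (u, v) \<in> r\<^sup>*"
  using relpow_map[OF assms] unfolding rtrancl_power by blast

lemma edgeE:
  assumes "rooted_tree g" "e \<in> edges g"
  obtains u v where "e = {u, v}" "u \<in> verts g" "v \<in> verts g" "u \<noteq> v"
  using assms unfolding rooted_tree_def by blast

lemma adj_subset: "rooted_tree g \<Longrightarrow> F \<subseteq> edges g \<Longrightarrow> adj_of F \<subseteq> verts g \<times> verts g"
  unfolding adj_of_def by (auto elim!: edgeE[rotated] dest!: subsetD simp: doubleton_eq_iff)

lemma edges_subset: "rooted_tree g \<Longrightarrow> e \<in> edges g \<Longrightarrow> e \<subseteq> verts g"
  by (auto elim: edgeE)

lemma giso_edges:
  assumes "rooted_tree g" "rooted_tree h" "giso f g h"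
  shows "edges h = image f ` edges g" "inj_on (image f) (edges g)"
proof -
  have b: "bij_betw f (verts g) (verts h)" using assms(3) by (simp add: giso_def)
  show "inj_on (image f) (edges g)"
    using b edges_subset[OF assms(1)] by (meson bij_betw_def inj_on_image_eq_iff inj_onI)
  show "edges h = image f ` edges g"
  proof (intro equalityI subsetI)
    fix e assume e: "e \<in> edges h"
    then obtain u v where uv: "e = {u, v}" "u \<in> verts h" "v \<in> verts h"
      using edgeE[OF assms(2)] by metis
    then obtain u' v' where "u = f u'" "v = f v'" "u' \<in> verts g" "v' \<in> verts g"
      using b by (metis bij_betw_def imageE)
    then have "e = f ` {u', v'}" "{u', v'} \<in> edges g"
      using assms(3) uv e by (auto simp: giso_def)
    then show "e \<in> image f ` edges g" by blast
  next
    fix e assume "e \<in> image f ` edges g"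
    then obtain e' where e': "e = f ` e'" "e' \<in> edges g" by blast
    then obtain u v where uv: "e' = {u, v}" "u \<in> verts g" "v \<in> verts g"
      using edgeE[OF assms(1)] by metis
    then show "e \<in> edges h" using e' assms(3) by (auto simp: giso_def)
  qed
qed

lemma adj_of_image:
  assumes "rooted_tree g" "inj_on f (verts g)" "F \<subseteq> edges g"
  shows "adj_of (image f ` F) = map_prod f f ` adj_of F"
proof (intro equalityI subsetI)
  fix p assume "p \<in> adj_of (image f ` F)"
  then obtain x y e where p: "p = (x, y)" "{x, y} = f ` e" "e \<in> F"
    by (auto simp: adj_of_def)
  then obtain u v where uv: "e = {u, v}" "u \<in> verts g" "v \<in> verts g"
    using edgeE[OF assms(1)] assms(3) by (metis subsetD)
  then have "(x = f u \<and> y = f v) \<or> (x = f v \<and> y = f u)"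
    using p by (auto simp: doubleton_eq_iff)
  moreover have "(u, v) \<in> adj_of F" "(v, u) \<in> adj_of F"
    using p uv by (auto simp: adj_of_def insert_commute)
  ultimately show "p \<in> map_prod f f ` adj_of F"
    unfolding p(1) by (elim disjE) (auto intro!: map_prod_imageI)
next
  fix p assume "p \<in> map_prod f f ` adj_of F"
  then obtain u v where "p = (f u, f v)" "{u, v} \<in> F"
    by (auto simp: adj_of_def)
  moreover have "{f u, f v} = f ` {u, v}" by simp
  ultimately show "p \<in> adj_of (image f ` F)"
    unfolding adj_of_def by blast
qed

lemma giso_gdist:
  assumes "rooted_tree g" "rooted_tree h" "giso f g h" "u \<in> verts g" "v \<in> verts g"
  shows "gdist h (f u) (f v) = gdist g u v"
proof -
  have i: "inj_on f (verts g)" using assms(3) by (auto simp: giso_def bij_betw_def)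
  have "adj_of (edges h) = map_prod f f ` adj_of (edges g)"
    using adj_of_image[OF assms(1) i] giso_edges[OF assms(1-3)] by simp
  then show ?thesis
    unfolding gdist_def using relpow_map[OF adj_subset[OF assms(1) order_refl] i assms(4,5)]
    by simp
qed

lemma giso_R_verts:
  assumes "rooted_tree g" "rooted_tree h" "giso f g h" "e \<in> edges g"
  shows "R_verts h (f ` e) = f ` R_verts g e"
proof -
  have b: "bij_betw f (verts g) (verts h)" and r: "f (root g) = root h"
    using assms(3) by (auto simp: giso_def)
  then have i: "inj_on f (verts g)" and im: "verts h = f ` verts g"
    by (auto simp: bij_betw_def)
  have "edges h - {f ` e} = image f ` (edges g - {e})"
    using giso_edges[OF assms(1-3)] assms(4) by (auto dest: inj_onD)
  then have "adj_of (edges h - {f ` e}) = map_prod f f ` adj_of (edges g - {e})"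
    using adj_of_image[OF assms(1) i, of "edges g - {e}"] by auto
  then have "(root h, f v) \<in> (adj_of (edges h - {f ` e}))\<^sup>* \<longleftrightarrow>
      (root g, v) \<in> (adj_of (edges g - {e}))\<^sup>*" if "v \<in> verts g" for v
    using rtrancl_map[OF adj_subset[OF assms(1), of "edges g - {e}"] i _ that, of "root g"]
      rooted_tree_root[OF assms(1)] r by auto
  then show ?thesis
    unfolding R_verts_def im by auto
qed

definition sub_root :: "'a rgraph \<Rightarrow> 'a set \<Rightarrow> 'a \<Rightarrow> bool" where
  "sub_root g W m \<longleftrightarrow> m \<in> W \<and> (\<forall>w \<in> W. w \<noteq> m \<longrightarrow> gdist g (root g) m < gdist g (root g) w)"

lemma sub_root_arg_min:
  assumes "sub_root g W m"
  shows "root (rooted_sub g W) = m"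
proof -
  have "arg_min (gdist g (root g)) (\<lambda>v. v \<in> W) = m"
  proof (rule arg_minI[where Q = "\<lambda>x. x = m"])
    show "m \<in> W" using assms by (simp add: sub_root_def)
    show "\<not> gdist g (root g) y < gdist g (root g) m" if "y \<in> W" for y
      using assms that by (cases "y = m") (auto simp: sub_root_def dest: less_not_sym)
    show "x = m" if "x \<in> W" "\<forall>y. y \<in> W \<longrightarrow> \<not> gdist g (root g) y < gdist g (root g) x" for x
      using assms that by (auto simp: sub_root_def)
  qed
  then show ?thesis by (simp add: rooted_sub_def)
qed

lemma giso_rooted_sub:
  assumes "rooted_tree g" "rooted_tree h" "giso f g h" "W \<subseteq> verts g" "sub_root g W m"
  shows "giso f (rooted_sub g W) (rooted_sub h (f ` W))"
proof -
  have b: "bij_betw f (verts g) (verts h)" and r: "f (root g) = root h"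
    using assms(3) by (auto simp: giso_def)
  have "bij_betw f W (f ` W)"
    using b assms(4) by (meson bij_betw_def inj_on_imp_bij_betw inj_on_subset)
  moreover have "sub_root h (f ` W) (f m)"
    using assms(4,5) giso_gdist[OF assms(1-3) rooted_tree_root[OF assms(1)]] r
    unfolding sub_root_def by (auto simp: subset_iff)
  moreover have "{u, v} \<in> edges g \<longleftrightarrow> {f u, f v} \<in> edges h" if "u \<in> W" "v \<in> W" for u v
    using that assms(3,4) by (auto simp: giso_def)
  ultimately show ?thesis
    using sub_root_arg_min[OF assms(5)] sub_root_arg_min[of h "f ` W" "f m"]
    by (auto simp: giso_def rooted_sub_def)
qed

lemma adj_of_sym: "(u, v) \<in> adj_of F \<Longrightarrow> (v, u) \<in> adj_of F"
  by (simp add: adj_of_def insert_commute)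

lemma adj_of_rtrancl_sym: "(u, v) \<in> (adj_of F)\<^sup>* \<Longrightarrow> (v, u) \<in> (adj_of F)\<^sup>*"
  by (meson adj_of_sym sym_rtrancl symD symI)

lemma bridge:
  assumes "rooted_tree g" "{a, b} \<in> edges g" "a \<noteq> b"
  shows "(a, b) \<notin> (adj_of (edges g - {{a, b}}))\<^sup>*"
proof
  let ?r = "adj_of (edges g - {{a, b}})"
  assume "(a, b) \<in> ?r\<^sup>*"
  then have ex: "\<exists>n. (a, b) \<in> ?r ^^ n" by (simp add: rtrancl_power)
  define n where "n = (LEAST n. (a, b) \<in> ?r ^^ n)"
  have n: "(a, b) \<in> ?r ^^ n" unfolding n_def using ex by (rule LeastI_ex)
  have least: "n \<le> m" if "(a, b) \<in> ?r ^^ m" for m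
    unfolding n_def using that by (rule Least_le)
  obtain p where p: "p 0 = a" "p n = b" "\<And>i. i < n \<Longrightarrow> (p i, p (Suc i)) \<in> ?r"
    using n unfolding relpow_fun_conv by blast
  have pre: "(p 0, p i) \<in> ?r ^^ i" if "i \<le> n" for i
    unfolding relpow_fun_conv using p that by (intro exI[of _ p]) auto
  have suf: "(p j, p n) \<in> ?r ^^ (n - j)" if "j \<le> n" for j
    unfolding relpow_fun_conv using p that by (intro exI[of _ "\<lambda>i. p (j + i)"]) auto
  have inj': False if "i < j" "j \<le> n" "p i = p j" for i j
  proof -
    have "(p 0, p n) \<in> ?r ^^ (i + (n - j))"
      unfolding relpow_add using pre[of i] suf[of j] that by auto
    then show False using least p that by fastforce
  qed
  have inj: "inj_on p {0..<Suc n}"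
    by (rule linorder_inj_onI) (use inj' in \<open>force simp: less_Suc_eq_le\<close>)+
  have "n \<noteq> 0" using p(1,2) assms(3) by metis
  moreover have "n \<noteq> 1" using p by (auto simp: adj_of_def)
  ultimately have n2: "2 \<le> n" by linarith
  have "is_cycle (edges g) (map p [0..<Suc n])"
    unfolding is_cycle_def
  proof (intro conjI allI impI)
    show "3 \<le> length (map p [0..<Suc n])" using n2 by simp
    show "distinct (map p [0..<Suc n])"
      using inj by (simp only: distinct_map distinct_upt set_upt simp_thms)
    fix i assume i: "i < length (map p [0..<Suc n])"
    show "{map p [0..<Suc n] ! i, map p [0..<Suc n] ! (Suc i mod length (map p [0..<Suc n]))}
        \<in> edges g"
    proof (cases "i = n")
      case True
      then show ?thesis
        using p assms(2) by (simp del: upt_Suc add: insert_commute)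
    next
      case False
      then show ?thesis
        using i p(3)[of i] by (simp del: upt_Suc add: adj_of_def)
    qed
  qed
  then show False using assms(1) by (auto simp: rooted_tree_def)
qed

lemma walk_leaves_R:
  assumes "rooted_tree g" "e \<in> edges g" "(root g, w) \<in> adj_of (edges g) ^^ n"
    "w \<in> verts g" "w \<notin> R_verts g e"
  shows "\<exists>a b m. e = {a, b} \<and> a \<in> R_verts g e \<and> b \<in> verts g - R_verts g e \<and>
    (root g, b) \<in> adj_of (edges g) ^^ m \<and> (m < n \<or> w = b)"
  using assms(3-5)
proof (induction n arbitrary: w)
  case 0
  then show ?case by (auto simp: R_verts_def)
next
  case (Suc n)
  then obtain y where y: "(root g, y) \<in> adj_of (edges g) ^^ n" "(y, w) \<in> adj_of (edges g)"
    by auto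
  have yV: "y \<in> verts g" using y(2) adj_subset[OF assms(1) order_refl] by blast
  show ?case
  proof (cases "y \<in> R_verts g e")
    case True
    have "{y, w} = e"
    proof (rule ccontr)
      assume "{y, w} \<noteq> e"
      then have "(y, w) \<in> adj_of (edges g - {e})" using y(2) by (auto simp: adj_of_def)
      moreover have "(root g, y) \<in> (adj_of (edges g - {e}))\<^sup>*"
        using True by (simp add: R_verts_def)
      ultimately have "(root g, w) \<in> (adj_of (edges g - {e}))\<^sup>*"
        by (rule rtrancl_into_rtrancl[rotated])
      then have "w \<in> R_verts g e"
        using Suc.prems by (simp add: R_verts_def)
      then show False using Suc.prems by blast
    qed
    then have "e = {y, w}" by simp
    moreover have "w \<in> verts g - R_verts g e" using Suc.prems by blast
    ultimately show ?thesis using True Suc.prems(1) by blast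
  next
    case False
    obtain a b m where "e = {a, b}" "a \<in> R_verts g e" "b \<in> verts g - R_verts g e"
      "(root g, b) \<in> adj_of (edges g) ^^ m" "m < n \<or> y = b"
      using Suc.IH[OF y(1) yV False] by blast
    moreover from this(5) have "\<exists>m. (root g, b) \<in> adj_of (edges g) ^^ m \<and> (m < Suc n \<or> w = b)"
    proof
      assume "m < n"
      then show ?thesis using \<open>(root g, b) \<in> _ ^^ m\<close> less_SucI by blast
    next
      assume "y = b"
      then show ?thesis using y(1) by blast
    qed
    ultimately show ?thesis by blast
  qed
qed

lemma gdist_walk:
  assumes "rooted_tree g" "u \<in> verts g" "v \<in> verts g"
  shows "(u, v) \<in> adj_of (edges g) ^^ gdist g u v"
proof -
  have "\<exists>n. (u, v) \<in> adj_of (edges g) ^^ n"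
    using assms by (auto simp: rooted_tree_def rtrancl_power)
  then show ?thesis unfolding gdist_def by (rule LeastI_ex)
qed

lemma gdist_le: "(u, v) \<in> adj_of (edges g) ^^ n \<Longrightarrow> gdist g u v \<le> n"
  unfolding gdist_def by (rule Least_le)

lemma R_root:
  assumes "rooted_tree g"
  shows "sub_root g (R_verts g e) (root g)"
proof -
  have 0: "gdist g (root g) (root g) = 0"
    using gdist_le[of "root g" "root g" 0 g] by simp
  have "gdist g (root g) w \<noteq> 0" if "w \<in> verts g" "w \<noteq> root g" for w
  proof
    assume "gdist g (root g) w = 0"
    then show False
      using gdist_walk[OF assms rooted_tree_root[OF assms] that(1)] that(2) by simp
  qed
  then show ?thesis
    using 0 rooted_tree_root[OF assms] by (auto simp: sub_root_def R_verts_def)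
qed

lemma P_root:
  assumes "rooted_tree g" "e \<in> edges g"
  obtains a b where "e = {a, b}" "a \<in> R_verts g e" "sub_root g (verts g - R_verts g e) b"
proof -
  note rt = rooted_tree_root[OF assms(1)]
  obtain x y where xy: "e = {x, y}" "x \<in> verts g" "y \<in> verts g" "x \<noteq> y"
    using edgeE[OF assms] .
  have "\<exists>w. w \<in> verts g - R_verts g e"
  proof (rule ccontr)
    assume "\<nexists>w. w \<in> verts g - R_verts g e"
    then have "(root g, x) \<in> (adj_of (edges g - {e}))\<^sup>*" "(root g, y) \<in> (adj_of (edges g - {e}))\<^sup>*"
      using xy by (auto simp: R_verts_def)
    then have "(x, y) \<in> (adj_of (edges g - {e}))\<^sup>*"
      using adj_of_rtrancl_sym rtrancl_trans by metis
    then show False using bridge[OF assms(1), of x y] xy assms(2) by simp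
  qed
  then obtain w where w: "w \<in> verts g" "w \<notin> R_verts g e" by blast
  obtain a b where ab: "e = {a, b}" "a \<in> R_verts g e" "b \<in> verts g - R_verts g e"
    using walk_leaves_R[OF assms gdist_walk[OF assms(1) rt w(1)] w] by blast
  have "gdist g (root g) b < gdist g (root g) v"
    if v: "v \<in> verts g - R_verts g e" "v \<noteq> b" for v
  proof -
    obtain a' b' m where *: "e = {a', b'}" "a' \<in> R_verts g e" "b' \<in> verts g - R_verts g e"
      "(root g, b') \<in> adj_of (edges g) ^^ m" "m < gdist g (root g) v \<or> v = b'"
      using walk_leaves_R[OF assms gdist_walk[OF assms(1) rt], of v] v by blast
    have "b' = b" using ab(1,2) *(1,3) by (auto simp: doubleton_eq_iff)
    then have "m < gdist g (root g) v" "gdist g (root g) b \<le> m"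
      using *(4,5) v(2) gdist_le by auto
    then show ?thesis by simp
  qed
  then show thesis using that ab by (auto simp: sub_root_def)
qed

lemma giso_parts:
  assumes "rooted_tree g" "rooted_tree h" "giso f g h" "e \<in> edges g"
  shows "giso f (R_part g e) (R_part h (f ` e))" "giso f (P_part g e) (P_part h (f ` e))"
proof -
  have R: "R_verts g e \<subseteq> verts g" by (auto simp: R_verts_def)
  show "giso f (R_part g e) (R_part h (f ` e))"
    unfolding R_part_def giso_R_verts[OF assms]
    by (rule giso_rooted_sub[OF assms(1-3) R R_root[OF assms(1)]])
  obtain b where b: "sub_root g (verts g - R_verts g e) b"
    using P_root[OF assms(1,4)] by metis
  have "verts h - f ` R_verts g e = f ` (verts g - R_verts g e)"
    using inj_on_image_set_diff[of f "verts g" "verts g" "R_verts g e"] assms(3) R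
    unfolding giso_def bij_betw_def by blast
  then show "giso f (P_part g e) (P_part h (f ` e))"
    unfolding P_part_def giso_R_verts[OF assms]
    using giso_rooted_sub[OF assms(1-3) _ b] by simp
qed

lemma parts_root:
  assumes "rooted_tree g" "e \<in> edges g"
  shows "root (R_part g e) \<in> verts (R_part g e)" "root (P_part g e) \<in> verts (P_part g e)"
proof -
  have *: "root (rooted_sub g W) \<in> verts (rooted_sub g W)" if "sub_root g W m" for W m
    using that sub_root_arg_min[OF that] by (simp add: sub_root_def rooted_sub_def)
  show "root (R_part g e) \<in> verts (R_part g e)"
    unfolding R_part_def using R_root[OF assms(1)] by (rule *)
  obtain a b where "sub_root g (verts g - R_verts g e) b"
    by (rule P_root[OF assms])
  then show "root (P_part g e) \<in> verts (P_part g e)"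
    unfolding P_part_def by (rule *)
qed

lemma graft_edges:
  "{Inl x, Inl y} \<in> edges (graft s v t) \<longleftrightarrow> {x, y} \<in> edges s"
  "{Inr x', Inr y'} \<in> edges (graft s v t) \<longleftrightarrow> {x', y'} \<in> edges t"
  "{Inl x, Inr y'} \<in> edges (graft s v t) \<longleftrightarrow> x = v \<and> y' = root t"
  "{Inr y', Inl x} \<in> edges (graft s v t) \<longleftrightarrow> x = v \<and> y' = root t"
proof -
  have inl: "inj (image (Inl :: 'a \<Rightarrow> 'a + 'b))" and inr: "inj (image (Inr :: 'b \<Rightarrow> 'a + 'b))"
    by (auto intro!: injI simp: inj_image_eq_iff)
  have "{Inl x, Inl y} \<notin> image Inr ` edges t" "{Inl x, Inl y} \<noteq> {Inl v, Inr (root t)}"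
    by auto
  moreover have "(Inl ` {x, y} :: (_ + 'b) set) \<in> image Inl ` edges s \<longleftrightarrow> {x, y} \<in> edges s"
    by (rule inj_image_mem_iff[OF inl])
  ultimately show "{Inl x, Inl y} \<in> edges (graft s v t) \<longleftrightarrow> {x, y} \<in> edges s"
    by (simp add: graft_def)
  have "{Inr x', Inr y'} \<notin> image Inl ` edges s" "{Inr x', Inr y'} \<noteq> {Inl v, Inr (root t)}"
    by auto
  moreover have "(Inr ` {x', y'} :: ('a + _) set) \<in> image Inr ` edges t \<longleftrightarrow> {x', y'} \<in> edges t"
    by (rule inj_image_mem_iff[OF inr])
  ultimately show "{Inr x', Inr y'} \<in> edges (graft s v t) \<longleftrightarrow> {x', y'} \<in> edges t"
    by (simp add: graft_def)
  show "{Inl x, Inr y'} \<in> edges (graft s v t) \<longleftrightarrow> x = v \<and> y' = root t"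
    unfolding graft_def by (auto simp: doubleton_eq_iff)
  then show "{Inr y', Inl x} \<in> edges (graft s v t) \<longleftrightarrow> x = v \<and> y' = root t"
    by (simp add: insert_commute)
qed

lemma giso_graft:
  assumes "giso f s s'" "giso k t t'" "v \<in> verts s" "root t \<in> verts t"
  shows "giso (map_sum f k) (graft s v t) (graft s' (f v) t')"
proof -
  have inj: "inj_on f (verts s)" "inj_on k (verts t)"
    and im: "f ` verts s = verts s'" "k ` verts t = verts t'"
    and rt: "k (root t) = root t'" "f (root s) = root s'"
    using assms(1,2) by (auto simp: giso_def bij_betw_def)
  have es: "{x, y} \<in> edges s \<longleftrightarrow> {f x, f y} \<in> edges s'" if "x \<in> verts s" "y \<in> verts s" for x y
    using assms(1) that by (auto simp: giso_def)
  have et: "{x, y} \<in> edges t \<longleftrightarrow> {k x, k y} \<in> edges t'" if "x \<in> verts t" "y \<in> verts t" for x y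
    using assms(2) that by (auto simp: giso_def)
  have "inj_on (map_sum f k) (verts s <+> verts t)"
    by (rule inj_onI) (use inj in \<open>auto dest: inj_onD\<close>)
  moreover have "map_sum f k ` (verts s <+> verts t) = verts s' <+> verts t'"
    unfolding Plus_def image_Un image_image im[symmetric] by simp
  ultimately have bij: "bij_betw (map_sum f k) (verts s <+> verts t) (verts s' <+> verts t')"
    by (simp add: bij_betw_def)
  have "{x, y} \<in> edges (graft s v t) \<longleftrightarrow>
      {map_sum f k x, map_sum f k y} \<in> edges (graft s' (f v) t')"
    if "x \<in> verts s <+> verts t" "y \<in> verts s <+> verts t" for x y
    using that es et inj_on_eq_iff[OF inj(1) _ assms(3)] inj_on_eq_iff[OF inj(2) _ assms(4)]
    by (auto simp: graft_edges simp flip: rt(1))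
  then show ?thesis
    using bij rt(2) unfolding giso_def by (simp add: graft_def)
qed

subsection \<open>Isomorphism classes\<close>

text \<open>
  Every finite tree is isomorphic to one whose vertices are natural numbers, so \<open>rtree\<close> is the set
  of all isomorphism classes of rooted trees.
\<close>

quotient_type rtree = "nat rgraph" / partial: tree_iso
  by (rule part_equivp_tree_iso)

lift_definition tsize :: "rtree \<Rightarrow> nat" is "\<lambda>t. card (verts t)"
  by (auto elim!: tree_isoE simp: giso_def bij_betw_same_card)

lift_definition aut_count :: "rtree \<Rightarrow> nat" is "\<lambda>t. card (graph_isos t t)"
proof -
  fix t t' :: "nat rgraph"
  assume "tree_iso t t'"
  then obtain f where f: "rooted_tree t" "rooted_tree t'" "giso f t t'"
    by (elim tree_isoE)
  have "giso (inv_into (verts t) f) t' t"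
    using f rooted_tree_root giso_inv by metis
  then show "card (graph_isos t t) = card (graph_isos t' t')"
    using f giso_card_aut by (metis le_antisym)
qed

lift_definition \<alpha> :: "rtree \<Rightarrow> rtree \<Rightarrow> rtree \<Rightarrow> nat" is
  "\<lambda>t1 t2 t3. card {e \<in> edges t2. isomorphic (R_part t2 e) t3 \<and> isomorphic (P_part t2 e) t1}"
proof -
  fix t1 t1' t2 t2' t3 t3' :: "nat rgraph"
  assume t: "tree_iso t1 t1'" "tree_iso t2 t2'" "tree_iso t3 t3'"
  then obtain f where f: "rooted_tree t2" "rooted_tree t2'" "giso f t2 t2'"
    by (elim tree_isoE)
  let ?Q = "\<lambda>t1 t2 t3 e. isomorphic (R_part t2 e) t3 \<and> isomorphic (P_part t2 e) t1"
  note ed = giso_edges[OF f]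
  have cong: "?Q t1 t2 t3 e \<longleftrightarrow> ?Q t1' t2' t3' (f ` e)" if e: "e \<in> edges t2" for e
  proof -
    have e': "f ` e \<in> edges t2'" using ed e by simp
    note p = parts_root[OF f(1) e] parts_root[OF f(2) e']
    note i = giso_parts[OF f e]
    show ?thesis
      using isomorphic_cong[OF p(1) p(3), of t3 t3'] isomorphic_cong[OF p(2) p(4), of t1 t1']
        isomorphic_iff[OF p(1)] isomorphic_iff[OF p(2)] i t
      unfolding tree_iso_def by (metis rooted_tree_root)
  qed
  have "bij_betw (image f) (edges t2) (edges t2')"
    using ed by (simp add: bij_betw_def)
  then show "card {e \<in> edges t2. ?Q t1 t2 t3 e} = card {e \<in> edges t2'. ?Q t1' t2' t3' e}"
    using cong by (rule card_transport)
qed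

lift_definition \<beta> :: "rtree \<Rightarrow> rtree \<Rightarrow> rtree \<Rightarrow> nat" is
  "\<lambda>t1 t2 t3. card {v \<in> verts t3. isomorphic t1 (graft t3 v t2)}"
proof -
  fix t1 t1' t2 t2' t3 t3' :: "nat rgraph"
  assume t: "tree_iso t1 t1'" "tree_iso t2 t2'" "tree_iso t3 t3'"
  then obtain f where f: "rooted_tree t3" "rooted_tree t3'" "giso f t3 t3'"
    by (elim tree_isoE)
  from t obtain k where k: "rooted_tree t2" "rooted_tree t2'" "giso k t2 t2'"
    by (elim tree_isoE)
  have r: "root (graft s v t) \<in> verts (graft s v t)" if "rooted_tree s"
    for s t :: "nat rgraph" and v
    using rooted_tree_root[OF that] by (auto simp: graft_def)
  have cong: "isomorphic t1 (graft t3 v t2) \<longleftrightarrow> isomorphic t1' (graft t3' (f v) t2')"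
    if v: "v \<in> verts t3" for v
    using isomorphic_cong[OF _ _ r[OF f(1)] r[OF f(2)], of t1 t1' v t2 "f v" t2']
      giso_graft[OF f(3) k(3) v rooted_tree_root[OF k(1)]] isomorphic_iff[OF r[OF f(1)]] t(1)
    unfolding tree_iso_def by (metis rooted_tree_root)
  have "bij_betw f (verts t3) (verts t3')" using f(3) by (simp add: giso_def)
  then show "card {v \<in> verts t3. isomorphic t1 (graft t3 v t2)} =
      card {v \<in> verts t3'. isomorphic t1' (graft t3' v t2')}"
    using cong by (rule card_transport)
qed

subsection \<open>Finiteness of the structure constants\<close>

lemma rtree_rep:
  obtains g where "rooted_tree g" "t = abs_rtree g"
proof -
  have "\<exists>g. tree_iso g g \<and> t = abs_rtree g"
    by (rule rtree.abs_induct) blast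
  then obtain g where "tree_iso g g" "t = abs_rtree g" by blast
  then show thesis using that by (auto simp: tree_iso_def)
qed

lemma tree_iso_refl: "rooted_tree g \<Longrightarrow> tree_iso g g"
  using giso_id isomorphic_iff rooted_tree_root unfolding tree_iso_def by metis

lemma tsize_abs: "rooted_tree g \<Longrightarrow> tsize (abs_rtree g) = card (verts g)"
  by (simp add: tsize.abs_eq tree_iso_refl)

lemma finite_tsize_le: "finite {t. tsize t \<le> n}"
proof -
  define rel :: "rtree \<Rightarrow> nat rgraph \<Rightarrow> bool" where
    "rel t c \<longleftrightarrow> (\<exists>g f. rooted_tree g \<and> t = abs_rtree g \<and> giso f g c)" for t c
  define C where "C = (\<lambda>(V, E, r). \<lparr>verts = V, edges = E, root = r\<rparr>) `
      (Pow {..<n} \<times> Pow (Pow {..<n}) \<times> {..<n})"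
  have ex: "\<exists>c \<in> C. rel t c" if t: "tsize t \<le> n" for t
  proof -
    obtain g where g: "rooted_tree g" "t = abs_rtree g" by (rule rtree_rep)
    then have c: "card (verts g) \<le> n" "finite (verts g)"
      using t tsize_abs by (auto simp: rooted_tree_def)
    obtain f where f: "bij_betw f (verts g) {0..<card (verts g)}"
      using ex_bij_betw_finite_nat[OF c(2)] by blast
    let ?c = "\<lparr>verts = f ` verts g, edges = image f ` edges g, root = f (root g)\<rparr>"
    have sub: "f ` verts g \<subseteq> {..<n}" using f c by (auto simp: bij_betw_def)
    have inj: "inj_on f (verts g)" using f by (simp add: bij_betw_def)
    have "{u, v} \<in> edges g \<longleftrightarrow> {f u, f v} \<in> image f ` edges g"
      if "u \<in> verts g" "v \<in> verts g" for u v
    proof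
      assume "{f u, f v} \<in> image f ` edges g"
      then obtain e where e: "e \<in> edges g" "f ` {u, v} = f ` e" by auto
      then have "e = {u, v}"
        using inj_on_image_eq_iff[OF inj, of "{u, v}" e] that edges_subset[OF g(1)] by auto
      then show "{u, v} \<in> edges g" using e by simp
    next
      assume "{u, v} \<in> edges g"
      then have "f ` {u, v} \<in> image f ` edges g" by (rule imageI)
      then show "{f u, f v} \<in> image f ` edges g" by simp
    qed
    then have "giso f g ?c" using inj by (auto simp: giso_def bij_betw_def)
    then have "rel t ?c" unfolding rel_def using g by blast
    have "(f ` verts g, image f ` edges g, f (root g)) \<in> Pow {..<n} \<times> Pow (Pow {..<n}) \<times> {..<n}"
    proof -
      have "f ` e \<subseteq> {..<n}" if "e \<in> edges g" for e
        using sub edges_subset[OF g(1) that] by fast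
      then show ?thesis using sub rooted_tree_root[OF g(1)] by auto
    qed
    then have "?c \<in> C" unfolding C_def by (rule rev_image_eqI) simp
    with \<open>rel t ?c\<close> show ?thesis by blast
  qed
  have uniq: "t = t'" if "rel t c" "rel t' c" for t t' and c :: "nat rgraph"
  proof -
    from that obtain g f g' f' where *: "rooted_tree g" "t = abs_rtree g" "giso f g c"
      "rooted_tree g'" "t' = abs_rtree g'" "giso f' g' c"
      unfolding rel_def by blast
    then have "isomorphic g g'"
      using giso_comp[OF *(3) giso_inv[OF *(6) rooted_tree_root[OF *(4)]]]
        isomorphic_iff[OF rooted_tree_root[OF *(1)]] by blast
    then have "tree_iso g g'" using * by (simp add: tree_iso_def)
    then show ?thesis using *(2,5) Quotient3_rel_abs[OF Quotient3_rtree] by simp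
  qed
  have "\<forall>t. \<exists>c. tsize t \<le> n \<longrightarrow> c \<in> C \<and> rel t c" using ex by blast
  then obtain h where h: "\<And>t. tsize t \<le> n \<Longrightarrow> h t \<in> C \<and> rel t (h t)"
    unfolding choice_iff by blast
  have inj: "inj_on h {t. tsize t \<le> n}"
  proof (rule inj_onI)
    fix t t' assume "t \<in> {t. tsize t \<le> n}" "t' \<in> {t. tsize t \<le> n}" "h t = h t'"
    then show "t = t'" using h[of t] h[of t'] uniq[of t "h t" t'] by simp
  qed
  have "h ` {t. tsize t \<le> n} \<subseteq> C" using h by blast
  moreover have "finite C" unfolding C_def by simp
  ultimately show ?thesis using inj_on_finite[OF inj] by blast
qed

lemma isomorphic_card: "isomorphic g h \<Longrightarrow> card (verts g) = card (verts h)"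
  by (auto simp: isomorphic_def graph_isos_def bij_betw_same_card)

lemma \<alpha>_size:
  assumes "\<alpha> t1 t2 t3 \<noteq> 0"
  shows "tsize t2 = tsize t1 + tsize t3"
proof -
  obtain g1 where 1: "rooted_tree g1" "t1 = abs_rtree g1" by (rule rtree_rep)
  obtain g2 where 2: "rooted_tree g2" "t2 = abs_rtree g2" by (rule rtree_rep)
  obtain g3 where 3: "rooted_tree g3" "t3 = abs_rtree g3" by (rule rtree_rep)
  have "card {e \<in> edges g2. isomorphic (R_part g2 e) g3 \<and> isomorphic (P_part g2 e) g1} \<noteq> 0"
    using assms 1 2 3 by (simp add: \<alpha>.abs_eq tree_iso_refl)
  then obtain e where "isomorphic (R_part g2 e) g3" "isomorphic (P_part g2 e) g1"
    by (metis (mono_tags, lifting) card.empty empty_Collect_eq)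
  then have "card (R_verts g2 e) = card (verts g3)"
    "card (verts g2 - R_verts g2 e) = card (verts g1)"
    using isomorphic_card by (force simp: R_part_def P_part_def rooted_sub_def)+
  moreover have "R_verts g2 e \<subseteq> verts g2" "finite (verts g2)"
    using 2 by (auto simp: R_verts_def rooted_tree_def)
  ultimately show ?thesis
    using 1 2 3 card_Diff_subset[of "R_verts g2 e" "verts g2"] card_mono[of "verts g2" "R_verts g2 e"]
    by (auto simp: tsize_abs dest: finite_subset)
qed

lemma \<beta>_size:
  assumes "\<beta> t1 t2 t3 \<noteq> 0"
  shows "tsize t1 = tsize t2 + tsize t3"
proof -
  obtain g1 where 1: "rooted_tree g1" "t1 = abs_rtree g1" by (rule rtree_rep)
  obtain g2 where 2: "rooted_tree g2" "t2 = abs_rtree g2" by (rule rtree_rep)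
  obtain g3 where 3: "rooted_tree g3" "t3 = abs_rtree g3" by (rule rtree_rep)
  have "card {v \<in> verts g3. isomorphic g1 (graft g3 v g2)} \<noteq> 0"
    using assms 1 2 3 by (simp add: \<beta>.abs_eq tree_iso_refl)
  then obtain v where "isomorphic g1 (graft g3 v g2)"
    by (metis (mono_tags, lifting) card.empty empty_Collect_eq)
  then have "card (verts g1) = card (verts g3 <+> verts g2)"
    using isomorphic_card by (force simp: graft_def)
  then show ?thesis
    using 1 2 3 by (simp add: tsize_abs card_Plus rooted_tree_def)
qed

lemma finite_\<alpha>: "finite {r. \<alpha> s t r \<noteq> 0}" "finite {r. \<alpha> s r t \<noteq> 0}"
  by (rule finite_subset[OF _ finite_tsize_le[of "tsize s + tsize t"]]; use \<alpha>_size in fastforce)+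

lemma finite_\<beta>: "finite {r. \<beta> s t r \<noteq> 0}" "finite {r. \<beta> r s t \<noteq> 0}"
  by (rule finite_subset[OF _ finite_tsize_le[of "tsize s + tsize t"]]; use \<beta>_size in fastforce)+

section \<open>The insertion-elimination algebra\<close>

datatype ie_basis = Bd | Bplus rtree | Bminus rtree

type_synonym ie_alg = "ie_basis \<Rightarrow>\<^sub>0 complex"

definition smult :: "complex \<Rightarrow> ie_alg \<Rightarrow> ie_alg" where
  "smult c x = Poly_Mapping.map ((*) c) x"

lemma lookup_smult [simp]: "Poly_Mapping.lookup (smult c x) b = c * Poly_Mapping.lookup x b"
  by (simp add: smult_def Poly_Mapping.map.rep_eq when_def)

lemma vector_space_smult: "vector_space smult"
  by unfold_locales (auto intro!: poly_mapping_eqI simp: lookup_add algebra_simps)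

definition D0 :: ie_alg where "D0 = Poly_Mapping.single Bd 1"
definition Dplus :: "rtree \<Rightarrow> ie_alg" where "Dplus t = Poly_Mapping.single (Bplus t) 1"
definition Dminus :: "rtree \<Rightarrow> ie_alg" where "Dminus t = Poly_Mapping.single (Bminus t) 1"

text \<open>
  The sums over all rooted trees are finite by \<open>finite_\<alpha>\<close> and \<open>finite_\<beta>\<close>, as \<open>Sum_any\<close> requires (its
  value would otherwise be 0). The bracket is given on all ordered pairs of basis elements, the
  pairs missing from the defining relations being supplied by antisymmetry, and is then extended
  bilinearly. \<open>bracket_mp s t\<close> is the bracket of \<open>Dminus s\<close> with \<open>Dplus t\<close>.
\<close>

definition bracket_mp :: "rtree \<Rightarrow> rtree \<Rightarrow> ie_alg" where
  "bracket_mp s t = (if s = t then D0 else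
     Sum_any (\<lambda>r. smult (of_nat (\<alpha> s t r)) (Dplus r)) +
     Sum_any (\<lambda>r. smult (of_nat (\<beta> s t r)) (Dminus r)))"

fun basis_bracket :: "ie_basis \<Rightarrow> ie_basis \<Rightarrow> ie_alg" where
  "basis_bracket (Bplus s) (Bplus t) =
     Sum_any (\<lambda>r. smult (of_nat (\<beta> r s t) - of_nat (\<beta> r t s)) (Dplus r))"
| "basis_bracket (Bminus s) (Bminus t) =
     Sum_any (\<lambda>r. smult (of_nat (\<alpha> t r s) - of_nat (\<alpha> s r t)) (Dminus r))"
| "basis_bracket (Bminus s) (Bplus t) = bracket_mp s t"
| "basis_bracket (Bplus t) (Bminus s) = - bracket_mp s t"
| "basis_bracket Bd (Bminus t) = smult (- of_nat (tsize t)) (Dminus t)"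
| "basis_bracket (Bminus t) Bd = smult (of_nat (tsize t)) (Dminus t)"
| "basis_bracket Bd (Bplus t) = smult (of_nat (tsize t)) (Dplus t)"
| "basis_bracket (Bplus t) Bd = smult (- of_nat (tsize t)) (Dplus t)"
| "basis_bracket Bd Bd = 0"

definition lin_ext :: "(ie_basis \<Rightarrow> ie_alg) \<Rightarrow> ie_alg \<Rightarrow> ie_alg" where
  "lin_ext f x = (\<Sum>b \<in> Poly_Mapping.keys x. smult (Poly_Mapping.lookup x b) (f b))"

definition bracket :: "ie_alg \<Rightarrow> ie_alg \<Rightarrow> ie_alg" where
  "bracket x y = lin_ext (\<lambda>a. lin_ext (\<lambda>b. basis_bracket a b) y) x"

section \<open>Automorphisms\<close>

definition ie_automorphism :: "(ie_alg \<Rightarrow> ie_alg) \<Rightarrow> bool" where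
  "ie_automorphism f \<longleftrightarrow> Vector_Spaces.linear smult smult f \<and> bij f \<and>
     (\<forall>x y. f (bracket x y) = bracket (f x) (f y))"

definition Aut_ie :: "(ie_alg \<Rightarrow> ie_alg) monoid" where
  "Aut_ie = \<lparr>carrier = {f. ie_automorphism f}, monoid.mult = (\<circ>), one = id\<rparr>"

definition \<tau> :: "complex \<Rightarrow> ie_alg \<Rightarrow> ie_alg" where
  "\<tau> \<zeta> = lin_ext (\<lambda>b. case b of
       Bd \<Rightarrow> D0
     | Bplus t \<Rightarrow> smult (\<zeta> powi int (tsize t)) (Dplus t)
     | Bminus t \<Rightarrow> smult (\<zeta> powi (- int (tsize t))) (Dminus t))"

definition \<sigma> :: "ie_alg \<Rightarrow> ie_alg" where
  "\<sigma> = lin_ext (\<lambda>b. case b of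
       Bd \<Rightarrow> D0
     | Bplus t \<Rightarrow> smult (of_nat (aut_count t)) (Dminus t)
     | Bminus t \<Rightarrow> smult (inverse (of_nat (aut_count t))) (Dplus t))"

definition \<tau>\<^sub>0 :: "ie_alg \<Rightarrow> ie_alg" where
  "\<tau>\<^sub>0 = \<sigma> \<circ> uminus"

definition A_Cstar :: "(ie_alg \<Rightarrow> ie_alg) set" where
  "A_Cstar = {\<tau> \<zeta> | \<zeta>. \<zeta> \<noteq> 0}"

definition A_zero :: "(ie_alg \<Rightarrow> ie_alg) set" where
  "A_zero = {id, \<tau>\<^sub>0}"

text \<open>The locale \<^locale>\<open>normal\<close> includes that \<open>G\<close> is a group.\<close>

definition internal_semidirect_product ::
    "('a, 'b) monoid_scheme \<Rightarrow> 'a set \<Rightarrow> 'a set \<Rightarrow> bool" where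
  "internal_semidirect_product G N H \<longleftrightarrow>
     N \<lhd> G \<and> subgroup H G \<and> N <#>\<^bsub>G\<^esub> H = carrier G \<and> N \<inter> H = {\<one>\<^bsub>G\<^esub>}"

end

theory Submission
  imports Defs
begin

text \<open>
  The maps \<open>\<tau> \<zeta>\<close> are automorphisms because the bracket respects the grading by tree size. That
  \<open>\<tau>\<^sub>0\<close> is one amounts to \<open>\<alpha> s t r \<xi>\<^sub>s \<xi>\<^sub>r = \<beta> t s r \<xi>\<^sub>t\<close> (where \<open>\<xi>\<close> is \<open>aut_count\<close>), which is
  a double count of isomorphisms (\<open>\<alpha>_\<beta>_aut_count\<close>). The substance is that there are no other
  automorphisms \<open>f\<close>. The argument rests on one statistic of trees, the root degree, that is, the
  number of children of the root. Joining \<open>s\<close> to the root of \<open>r\<close> raises the root degree of \<open>r\<close> by one,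
  while joining it to any other vertex of \<open>r\<close> leaves the root degree unchanged.

  Consider first \<open>f D0\<close>. Since \<open>D0\<close> acts diagonally, the iterates of \<open>bracket (f D0)\<close> on a fixed
  vector involve only finitely many basis vectors. Suppose that some \<open>Dplus t\<close> occurs in \<open>f D0\<close>, and
  choose \<open>t\<close> of maximal size. Apply the iterates to a bouquet, that is, to \<open>k\<close> copies of \<open>t\<close> joined to
  a common root. If \<open>k\<close> is at least the size of \<open>t\<close>, then among the terms of maximal size those of
  maximal root degree arise only from joining at the root, which behaves like multiplication in a
  polynomial ring whose variables are the trees; in particular the bouquet with \<open>k + 1\<close> copies
  occurs in the next iterate (\<open>bouquet_leads_bracket\<close>). Thus infinitely many basis vectors occur, a
  contradiction. Composing with \<open>\<tau>\<^sub>0\<close> excludes the vectors \<open>Dminus t\<close> as well, so \<open>f D0\<close> is a multiple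
  of \<open>D0\<close>, and comparing eigenvalues for \<open>f\<close> and its inverse shows that the factor is 1 or -1
  (\<open>automorphism_D0\<close>).

  Composing with \<open>\<tau>\<^sub>0\<close> if necessary, let \<open>f D0 = D0\<close>. Then \<open>f\<close> is graded, and it scales the vectors
  of the one-vertex tree by inverse factors because their bracket is \<open>D0\<close>. Composing with some
  \<open>\<tau> \<zeta>\<close>, let these two vectors be fixed. By induction on the size \<open>n\<close> all basis vectors are
  fixed: if this is known below \<open>n\<close>, then \<open>u = f (Dplus t) - Dplus t\<close> has zero bracket with every
  \<open>Dminus s\<close>, where \<open>s\<close> is smaller than \<open>t\<close>. This is a linear system for the coefficients of \<open>u\<close>
  which is triangular with respect to the root degree, hence \<open>u = 0\<close> (\<open>\<alpha>_nondegenerate\<close>). The vectors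
  \<open>Dminus t\<close> are treated by conjugating \<open>f\<close> with \<open>\<tau>\<^sub>0\<close>.
\<close>

section \<open>Trees up to isomorphism, on arbitrary vertex types\<close>

text \<open>
  Together with \<open>bridge\<close> this replaces the absence of cycles by a condition on walks, which can be
  transported along graph maps without handling lists of vertices.
\<close>

lemma acyclic_if_all_bridges:
  assumes "\<And>a b. {a, b} \<in> F \<Longrightarrow> a \<noteq> b \<Longrightarrow> (a, b) \<notin> (adj_of (F - {{a, b}}))\<^sup>*"
  shows "\<not> is_cycle F p"
proof
  assume p: "is_cycle F p"
  then have len: "3 \<le> length p" and dist: "distinct p"
    and ed: "\<And>i. i < length p \<Longrightarrow> {p ! i, p ! (Suc i mod length p)} \<in> F"
    by (auto simp: is_cycle_def)
  have ne: "p \<noteq> []" using len by auto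
  let ?r = "adj_of (F - {{p ! 0, p ! 1}})"
  have other: "{p ! i, p ! j} \<noteq> {p ! 0, p ! 1}"
    if "i < length p" "j < length p" "i \<noteq> 0" "j \<noteq> 0 \<or> i \<noteq> 1" for i j
  proof
    assume "{p ! i, p ! j} = {p ! 0, p ! 1}"
    then have "p ! 0 = p ! i \<or> p ! 0 = p ! j \<and> p ! 1 = p ! i"
      by (auto simp: doubleton_eq_iff)
    moreover have "0 < length p" "1 < length p" using len by linarith+
    ultimately show False using that dist by (metis nth_eq_iff_index_eq)
  qed
  have step: "(p ! 1, p ! Suc j) \<in> ?r\<^sup>*" if "Suc j < length p" for j
    using that
  proof (induction j)
    case 0
    then show ?case by simp
  next
    case (Suc j)
    have "{p ! Suc j, p ! Suc (Suc j)} \<in> F"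
      using ed[of "Suc j"] Suc.prems by simp
    moreover have "{p ! Suc j, p ! Suc (Suc j)} \<noteq> {p ! 0, p ! 1}"
      using Suc.prems by (intro other) auto
    ultimately have "(p ! Suc j, p ! Suc (Suc j)) \<in> ?r" by (simp add: adj_of_def)
    moreover have "(p ! 1, p ! Suc j) \<in> ?r\<^sup>*" using Suc by simp
    ultimately show ?case by simp
  qed
  have last: "(p ! 1, p ! (length p - 1)) \<in> ?r\<^sup>*"
    using step[of "length p - 2"] len by (simp add: numeral_2_eq_2 Suc_diff_Suc)
  have "{p ! (length p - 1), p ! 0} \<in> F"
    using ed[of "length p - 1"] len by (cases "length p") auto
  moreover have "{p ! (length p - 1), p ! 0} \<noteq> {p ! 0, p ! 1}"
    using len by (intro other) auto
  ultimately have "(p ! (length p - 1), p ! 0) \<in> ?r" by (simp add: adj_of_def)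
  with last have "(p ! 1, p ! 0) \<in> ?r\<^sup>*" by simp
  then have "(p ! 0, p ! 1) \<in> ?r\<^sup>*" by (rule adj_of_rtrancl_sym)
  moreover have "{p ! 0, p ! 1} \<in> F" using ed[of 0] len ne by simp
  moreover have "p ! 0 \<noteq> p ! 1" using dist len ne nth_eq_iff_index_eq[of p 0 1] by force
  ultimately show False using assms by blast
qed

lemma rooted_treeI:
  assumes "finite (verts g)"
    and "\<And>e. e \<in> edges g \<Longrightarrow> \<exists>u v. e = {u, v} \<and> u \<in> verts g \<and> v \<in> verts g \<and> u \<noteq> v"
    and "root g \<in> verts g"
    and conn: "\<And>v. v \<in> verts g \<Longrightarrow> (root g, v) \<in> (adj_of (edges g))\<^sup>*"
    and "\<And>a b. {a, b} \<in> edges g \<Longrightarrow> a \<noteq> b \<Longrightarrow> (a, b) \<notin> (adj_of (edges g - {{a, b}}))\<^sup>*"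
  shows "rooted_tree g"
proof -
  have "(u, v) \<in> (adj_of (edges g))\<^sup>*" if "u \<in> verts g" "v \<in> verts g" for u v
    using adj_of_rtrancl_sym[OF conn[OF that(1)]] conn[OF that(2)] by (rule rtrancl_trans)
  then show ?thesis
    unfolding rooted_tree_def using assms acyclic_if_all_bridges[of "edges g"] by blast
qed

lemma rooted_tree_connected:
  "rooted_tree g \<Longrightarrow> v \<in> verts g \<Longrightarrow> (root g, v) \<in> (adj_of (edges g))\<^sup>*"
  by (simp add: rooted_tree_def)

lemma rooted_tree_no_loop: "rooted_tree g \<Longrightarrow> {u, v} \<in> edges g \<Longrightarrow> u \<noteq> v"
  by (erule edgeE) (auto simp: doubleton_eq_iff)

lemma rooted_tree_edge_verts:
  "rooted_tree g \<Longrightarrow> {u, v} \<in> edges g \<Longrightarrow> u \<in> verts g \<and> v \<in> verts g"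
  using edges_subset by fastforce

lemma ex_relabelling:
  assumes "rooted_tree g" "inj_on f (verts g)"
  shows "\<exists>h. rooted_tree h \<and> giso f g h"
proof -
  let ?h = "\<lparr>verts = f ` verts g, edges = image f ` edges g, root = f (root g)\<rparr>"
  have inj: "inj_on (image f) (edges g)"
    using assms edges_subset by (meson inj_on_image_eq_iff inj_onI)
  have adj: "adj_of (image f ` F) = map_prod f f ` adj_of F" if "F \<subseteq> edges g" for F
    by (rule adj_of_image[OF assms that])
  have edge: "{f u, f v} \<in> image f ` edges g \<longleftrightarrow> {u, v} \<in> edges g"
    if "u \<in> verts g" "v \<in> verts g" for u v
  proof
    assume "{f u, f v} \<in> image f ` edges g"
    then obtain e where e: "e \<in> edges g" "f ` {u, v} = f ` e" by auto
    then have "e = {u, v}"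
      using inj_on_image_eq_iff[OF assms(2), of "{u, v}" e] that edges_subset[OF assms(1)] by auto
    then show "{u, v} \<in> edges g" using e by simp
  next
    assume "{u, v} \<in> edges g"
    then have "f ` {u, v} \<in> image f ` edges g" by (rule imageI)
    then show "{f u, f v} \<in> image f ` edges g" by simp
  qed
  have "rooted_tree ?h"
  proof (rule rooted_treeI)
    show "finite (verts ?h)" using assms(1) by (simp add: rooted_tree_def)
    show "root ?h \<in> verts ?h" using rooted_tree_root[OF assms(1)] by simp
    show "\<exists>u v. e = {u, v} \<and> u \<in> verts ?h \<and> v \<in> verts ?h \<and> u \<noteq> v"
      if e: "e \<in> edges ?h" for e
    proof -
      obtain e' where e': "e' \<in> edges g" "e = f ` e'" using e by auto
      then obtain u v where uv: "e' = {u, v}" "u \<in> verts g" "v \<in> verts g" "u \<noteq> v"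
        using edgeE[OF assms(1)] by metis
      then have "f u \<noteq> f v" using assms(2) by (simp add: inj_on_eq_iff)
      then show ?thesis
        using e'(2) uv by (intro exI[of _ "f u"] exI[of _ "f v"]) simp
    qed
    show "(root ?h, v) \<in> (adj_of (edges ?h))\<^sup>*" if v: "v \<in> verts ?h" for v
    proof -
      obtain u where u: "u \<in> verts g" "v = f u" using v by auto
      then have "(f (root g), f u) \<in> (map_prod f f ` adj_of (edges g))\<^sup>*"
        using rtrancl_map[OF adj_subset[OF assms(1) order_refl] assms(2)
            rooted_tree_root[OF assms(1)] u(1)] rooted_tree_connected[OF assms(1)] by blast
      then show ?thesis using adj[OF order_refl] u(2) by simp
    qed
    show "(a, b) \<notin> (adj_of (edges ?h - {{a, b}}))\<^sup>*" if ab: "{a, b} \<in> edges ?h" "a \<noteq> b" for a b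
    proof -
      obtain e' where e': "e' \<in> edges g" "{a, b} = f ` e'" using ab by auto
      then obtain x y where xy: "e' = {x, y}" "x \<in> verts g" "y \<in> verts g"
        using edgeE[OF assms(1)] by metis
      then have "a = f x \<and> b = f y \<or> a = f y \<and> b = f x"
        using e'(2) by (simp add: doubleton_eq_iff)
      moreover have "{x, y} \<in> edges g" "{y, x} \<in> edges g"
        using xy(1) e'(1) by (simp_all add: insert_commute)
      ultimately have "\<exists>u v. a = f u \<and> b = f v \<and> {u, v} \<in> edges g \<and> u \<in> verts g \<and> v \<in> verts g"
        using xy(2,3) by blast
      then obtain u v where uv: "a = f u" "b = f v" "{u, v} \<in> edges g" "u \<in> verts g" "v \<in> verts g"
        by blast
      have "edges ?h - {{a, b}} = image f ` (edges g - {{u, v}})"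
        using inj_on_image_set_diff[OF inj, of "edges g" "{{u, v}}"] uv by simp
      then have "adj_of (edges ?h - {{a, b}}) = map_prod f f ` adj_of (edges g - {{u, v}})"
        using adj[of "edges g - {{u, v}}"] by auto
      moreover have "(u, v) \<notin> (adj_of (edges g - {{u, v}}))\<^sup>*"
        using bridge[OF assms(1) uv(3)] ab uv by blast
      ultimately show ?thesis
        using rtrancl_map[OF adj_subset[OF assms(1)] assms(2) uv(4,5), of "edges g - {{u, v}}"] uv
        by auto
    qed
  qed
  moreover have "giso f g ?h"
    using assms(2) edge by (auto simp: giso_def bij_betw_def)
  ultimately show ?thesis by blast
qed

text \<open>
  Grafting changes the vertex type, and the parts of a cut come as subgraphs, so the isomorphism
  class is needed for trees on vertices of any type; the class of \<open>G\<close> is that of any copy of \<open>G\<close> on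
  natural numbers.
\<close>

definition tree_class :: "'a rgraph \<Rightarrow> rtree" where
  "tree_class G = (THE t. \<exists>g f. rooted_tree g \<and> t = abs_rtree g \<and> giso f g G)"

lemma ex_giso_sym:
  "rooted_tree g \<Longrightarrow> giso f g h \<Longrightarrow> \<exists>f. giso f h g"
  using giso_inv rooted_tree_root by metis

lemma abs_rtree_eqI:
  assumes "rooted_tree g" "rooted_tree h" "giso f g h"
  shows "abs_rtree g = abs_rtree h"
proof -
  have "tree_iso g h"
    using assms isomorphic_iff[OF rooted_tree_root[OF assms(1)]] unfolding tree_iso_def by blast
  then show ?thesis by (rule Quotient3_rel_abs[OF Quotient3_rtree])
qed

lemma tree_classI:
  assumes "rooted_tree g" "giso f g G"
  shows "tree_class G = abs_rtree g"
  unfolding tree_class_def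
proof (rule the_equality)
  show "\<exists>h f. rooted_tree h \<and> abs_rtree g = abs_rtree h \<and> giso f h G" using assms by blast
  fix t assume "\<exists>h f. rooted_tree h \<and> t = abs_rtree h \<and> giso f h G"
  then obtain h k where h: "rooted_tree h" "t = abs_rtree h" "giso k h G" by blast
  have "giso (inv_into (verts g) f \<circ> k) h g"
    using h(3) giso_inv[OF assms(2) rooted_tree_root[OF assms(1)]] by (rule giso_comp)
  then show "t = abs_rtree g" using abs_rtree_eqI h assms(1) by simp
qed

lemma ex_nat_copy:
  assumes "rooted_tree G"
  obtains g :: "nat rgraph" and f where "rooted_tree g" "giso f g G" "tree_class G = abs_rtree g"
proof -
  have "finite (verts G)" using assms by (simp add: rooted_tree_def)
  from finite_imp_inj_to_nat_seg[OF this] obtain k :: "_ \<Rightarrow> nat" where k: "inj_on k (verts G)"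
    by blast
  obtain g where g: "rooted_tree g" "giso k G g"
    using ex_relabelling[OF assms k] by blast
  obtain f where f: "giso f g G" using ex_giso_sym[OF assms g(2)] ..
  show thesis by (rule that[OF g(1) f tree_classI[OF g(1) f]])
qed

lemma tree_class_nat: "rooted_tree g \<Longrightarrow> tree_class g = abs_rtree g"
  using tree_classI giso_id by blast

lemma rtree_cases:
  obtains g :: "nat rgraph" where "rooted_tree g" "t = tree_class g"
  using rtree_rep tree_class_nat by metis

lemma tree_class_eqI:
  assumes "rooted_tree G" "giso f G H"
  shows "tree_class G = tree_class H"
  by (rule ex_nat_copy[OF assms(1)]) (metis assms(2) giso_comp tree_classI)

lemma tree_class_eq_iff:
  assumes "rooted_tree G" "rooted_tree H"
  shows "tree_class G = tree_class H \<longleftrightarrow> (\<exists>f. giso f G H)"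
proof
  assume eq: "tree_class G = tree_class H"
  obtain g :: "nat rgraph" and f where g: "rooted_tree g" "giso f g G" "tree_class G = abs_rtree g"
    using ex_nat_copy[OF assms(1)] .
  obtain h :: "nat rgraph" and k where h: "rooted_tree h" "giso k h H" "tree_class H = abs_rtree h"
    using ex_nat_copy[OF assms(2)] .
  have "tree_iso g h"
    using eq g h Quotient3_rel[OF Quotient3_rtree, of g h] tree_iso_refl by metis
  then obtain m where "giso m g h" by (rule tree_isoE)
  then show "\<exists>f. giso f G H" using ex_giso_sym[OF g(1,2)] h(2) giso_comp by metis
next
  show "\<exists>f. giso f G H \<Longrightarrow> tree_class G = tree_class H" using tree_class_eqI[OF assms(1)] by blast
qed

lemma isomorphic_iff_tree_class:
  assumes "rooted_tree G" "rooted_tree H"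
  shows "isomorphic G H \<longleftrightarrow> tree_class G = tree_class H"
  using tree_class_eq_iff[OF assms] isomorphic_iff[OF rooted_tree_root[OF assms(1)]] by simp

lemma tsize_tree_class:
  assumes "rooted_tree G"
  shows "tsize (tree_class G) = card (verts G)"
proof (rule ex_nat_copy[OF assms])
  fix g :: "nat rgraph" and f
  assume "rooted_tree g" "giso f g G" "tree_class G = abs_rtree g"
  then show ?thesis by (auto simp: tsize_abs giso_def dest: bij_betw_same_card)
qed

lemma finite_graph_isos:
  assumes "rooted_tree g" "rooted_tree h"
  shows "finite (graph_isos g h)"
proof -
  have "graph_isos g h \<subseteq> verts g \<rightarrow>\<^sub>E verts h" by (auto simp: graph_isos_def)
  then show ?thesis
    using assms by (meson finite_PiE finite_subset rooted_tree_def)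
qed

lemma graph_isos_giso: "f \<in> graph_isos g h \<Longrightarrow> giso f g h"
  by (simp add: graph_isos_def giso_def)

text \<open>The isomorphisms between two isomorphic trees form a torsor under the automorphisms.\<close>

lemma card_graph_isos_torsor:
  assumes "rooted_tree g" "rooted_tree h" "rooted_tree l" "giso f g h"
  shows "card (graph_isos h l) \<le> card (graph_isos g l)"
proof (rule card_inj_on_le)
  let ?c = "\<lambda>k. restrict (k \<circ> f) (verts g)"
  have b: "f ` verts g = verts h" using assms(4) by (simp add: giso_def bij_betw_def)
  show "?c ` graph_isos h l \<subseteq> graph_isos g l"
    using giso_restrict giso_comp[OF assms(4)] graph_isos_giso rooted_tree_root[OF assms(1)] by blast
  show "inj_on ?c (graph_isos h l)"
  proof (rule inj_onI)
    fix k m assume k: "k \<in> graph_isos h l" and m: "m \<in> graph_isos h l" and eq: "?c k = ?c m"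
    show "k = m"
    proof (rule PiE_ext[of _ "verts h" "\<lambda>_. verts l"])
      show "k \<in> verts h \<rightarrow>\<^sub>E verts l" "m \<in> verts h \<rightarrow>\<^sub>E verts l"
        using k m by (auto simp: graph_isos_def)
      fix v assume "v \<in> verts h"
      then obtain u where "u \<in> verts g" "v = f u" using b by blast
      then show "k v = m v" using fun_cong[OF eq, of u] by simp
    qed
  qed
  show "finite (graph_isos g l)" by (rule finite_graph_isos[OF assms(1,3)])
qed

lemma card_graph_isos:
  assumes "rooted_tree G" "rooted_tree (h :: nat rgraph)"
  shows "card (graph_isos G h) =
    (if tree_class G = tree_class h then aut_count (tree_class h) else 0)"
proof (cases "tree_class G = tree_class h")
  case True
  then obtain f where f: "giso f G h" using tree_class_eq_iff[OF assms] by blast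
  then obtain f' where f': "giso f' h G" using ex_giso_sym[OF assms(1)] by blast
  have "card (graph_isos G h) = card (graph_isos h h)"
    using card_graph_isos_torsor[OF assms assms(2) f]
      card_graph_isos_torsor[OF assms(2,1) assms(2) f'] by simp
  then show ?thesis
    using True assms(2) by (simp add: tree_class_nat aut_count.abs_eq tree_iso_refl)
next
  case False
  then have "graph_isos G h = {}" using tree_class_eq_iff[OF assms] graph_isos_giso by blast
  then show ?thesis using False by simp
qed

lemma aut_count_pos: "aut_count t > 0"
proof (rule rtree_cases[of t])
  fix g :: "nat rgraph" assume g: "rooted_tree g" "t = tree_class g"
  have "graph_isos g g \<noteq> {}" using giso_restrict[OF giso_id rooted_tree_root[OF g(1)]] by blast
  then have "card (graph_isos g g) > 0" using finite_graph_isos g(1) by (auto simp: card_gt_0_iff)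
  then show ?thesis using g by (simp add: tree_class_nat aut_count.abs_eq tree_iso_refl)
qed

section \<open>Cutting a tree at an edge and grafting\<close>

lemma graft_edge_iff:
  "e \<in> edges (graft S v T) \<longleftrightarrow>
    (\<exists>e' \<in> edges S. e = Inl ` e') \<or> (\<exists>e' \<in> edges T. e = Inr ` e') \<or> e = {Inl v, Inr (root T)}"
  unfolding graft_def by auto

lemma graft_verts [simp]: "verts (graft S v T) = Inl ` verts S \<union> Inr ` verts T"
  by (auto simp: graft_def)

lemma graft_root [simp]: "root (graft S v T) = Inl (root S)"
  by (simp add: graft_def)

lemma rtrancl_mono_map:
  assumes "(x, y) \<in> r\<^sup>*" "\<And>x y. (x, y) \<in> r \<Longrightarrow> (f x, f y) \<in> s\<^sup>*"
  shows "(f x, f y) \<in> s\<^sup>*"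
  using assms(1) by (induction rule: rtrancl_induct) (use assms(2) in \<open>auto intro: rtrancl_trans\<close>)

lemma rtrancl_invariant:
  assumes "(x, y) \<in> r\<^sup>*" "P x" "\<And>x y. (x, y) \<in> r \<Longrightarrow> P x \<Longrightarrow> P y"
  shows "P y"
  using assms(1) by (induction rule: rtrancl_induct) (use assms(2,3) in auto)

lemma adj_of_iff: "(x, y) \<in> adj_of F \<longleftrightarrow> {x, y} \<in> F"
  by (simp add: adj_of_def)

lemma graft_adj_Inl: "(x, y) \<in> (adj_of (edges S))\<^sup>* \<Longrightarrow>
    (Inl x, Inl y) \<in> (adj_of (edges (graft S v T) - {{Inl v, Inr (root T)}}))\<^sup>*"
  by (erule rtrancl_mono_map) (auto simp: adj_of_iff graft_edges doubleton_eq_iff intro!: r_into_rtrancl)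

lemma graft_adj_Inr: "(x, y) \<in> (adj_of (edges T))\<^sup>* \<Longrightarrow>
    (Inr x, Inr y) \<in> (adj_of (edges (graft S v T) - {{Inl v, Inr (root T)}}))\<^sup>*"
  by (erule rtrancl_mono_map) (auto simp: adj_of_iff graft_edges doubleton_eq_iff intro!: r_into_rtrancl)

lemma adj_of_rtrancl_mono: "F \<subseteq> F' \<Longrightarrow> x \<in> (adj_of F)\<^sup>* \<Longrightarrow> x \<in> (adj_of F')\<^sup>*"
  by (erule rev_subsetD) (auto intro!: rtrancl_mono simp: adj_of_def)

text \<open>
  Collapsing one of the two trees to the vertex at which it is attached maps a walk in the graft that
  avoids an edge of the other tree to a walk in that tree avoiding the same edge. So the edges of both
  trees remain bridges; the joining edge is one because no other edge connects the two sides.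
\<close>

lemma rooted_tree_graft:
  assumes S: "rooted_tree S" and T: "rooted_tree T" and v: "v \<in> verts S"
  shows "rooted_tree (graft S v T)"
proof (rule rooted_treeI)
  let ?G = "graft S v T" and ?e = "{Inl v, Inr (root T)}"
  show "finite (verts ?G)" using S T by (simp add: rooted_tree_def)
  show "root ?G \<in> verts ?G" using rooted_tree_root[OF S] by simp
  show "\<exists>x y. e = {x, y} \<and> x \<in> verts ?G \<and> y \<in> verts ?G \<and> x \<noteq> y" if "e \<in> edges ?G" for e
    using that v rooted_tree_root[OF T] unfolding graft_edge_iff
    by (elim disjE bexE edgeE[OF S] edgeE[OF T]) fastforce+
  show "(root ?G, x) \<in> (adj_of (edges ?G))\<^sup>*" if x: "x \<in> verts ?G" for x
  proof (cases x)
    case (Inl y)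
    then show ?thesis
      using x graft_adj_Inl[OF rooted_tree_connected[OF S, of y], of v T]
      by (auto intro: adj_of_rtrancl_mono[rotated])
  next
    case (Inr y)
    have "(Inl (root S), Inl v) \<in> (adj_of (edges ?G))\<^sup>*"
      using graft_adj_Inl[OF rooted_tree_connected[OF S v], of v T]
      by (auto intro: adj_of_rtrancl_mono[rotated])
    moreover have "(Inl v, Inr (root T)) \<in> adj_of (edges ?G)"
      by (simp add: adj_of_iff graft_edges)
    moreover have "(Inr (root T), Inr y) \<in> (adj_of (edges ?G))\<^sup>*"
      using Inr x graft_adj_Inr[OF rooted_tree_connected[OF T, of y], where S = S and v = v]
      by (auto intro: adj_of_rtrancl_mono[rotated])
    ultimately show ?thesis using Inr by (auto intro: rtrancl_trans rtrancl_into_rtrancl)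
  qed
  show "(a, b) \<notin> (adj_of (edges ?G - {{a, b}}))\<^sup>*" if e: "{a, b} \<in> edges ?G" "a \<noteq> b" for a b
  proof
    assume path: "(a, b) \<in> (adj_of (edges ?G - {{a, b}}))\<^sup>*"
    have left: False if ab: "a = Inl x" "b = Inl y" for x y
    proof -
      let ?p = "case_sum id (\<lambda>_. v)"
      have "(?p a, ?p b) \<in> (adj_of (edges S - {{x, y}}))\<^sup>*"
        using path
      proof (rule rtrancl_mono_map)
        fix c d assume "(c, d) \<in> adj_of (edges ?G - {{a, b}})"
        then show "(?p c, ?p d) \<in> (adj_of (edges S - {{x, y}}))\<^sup>*"
          using ab by (cases c; cases d)
            (auto simp: adj_of_iff graft_edges doubleton_eq_iff intro!: r_into_rtrancl)
      qed
      then show False using bridge[OF S, of x y] e ab by (simp add: graft_edges)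
    qed
    have right: False if ab: "a = Inr x" "b = Inr y" for x y
    proof -
      let ?p = "case_sum (\<lambda>_. root T) id"
      have "(?p a, ?p b) \<in> (adj_of (edges T - {{x, y}}))\<^sup>*"
        using path
      proof (rule rtrancl_mono_map)
        fix c d assume "(c, d) \<in> adj_of (edges ?G - {{a, b}})"
        then show "(?p c, ?p d) \<in> (adj_of (edges T - {{x, y}}))\<^sup>*"
          using ab by (cases c; cases d)
            (auto simp: adj_of_iff graft_edges doubleton_eq_iff intro!: r_into_rtrancl)
      qed
      then show False using bridge[OF T, of x y] e ab by (simp add: graft_edges)
    qed
    have mixed: False if "isl a \<noteq> isl b"
    proof -
      have ab: "{a, b} = ?e"
        using e that by (cases a; cases b) (auto simp: graft_edges insert_commute)
      have "isl b = isl a"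
        using path
      proof (rule rtrancl_invariant[where P = "\<lambda>c. isl c = isl a"])
        show "isl d = isl a" if "(c, d) \<in> adj_of (edges ?G - {{a, b}})" "isl c = isl a" for c d
          using that unfolding ab by (cases c; cases d) (auto simp: adj_of_iff graft_edges insert_commute)
      qed simp
      with that show False by simp
    qed
    show False
      using left right mixed by (cases a; cases b) auto
  qed
qed

context
  fixes S :: "'a rgraph" and T :: "'b rgraph" and v
  assumes S: "rooted_tree S" and T: "rooted_tree T" and v: "v \<in> verts S"
begin

lemma graft_R_verts: "R_verts (graft S v T) {Inl v, Inr (root T)} = Inl ` verts S"
proof (intro equalityI subsetI)
  let ?r = "adj_of (edges (graft S v T) - {{Inl v, Inr (root T)}})"
  fix x assume "x \<in> R_verts (graft S v T) {Inl v, Inr (root T)}"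
  then have x: "x \<in> verts (graft S v T)" "(Inl (root S), x) \<in> ?r\<^sup>*" by (auto simp: R_verts_def)
  have "isl x"
    using x(2)
  proof (rule rtrancl_invariant)
    show "isl d" if "(c, d) \<in> ?r" "isl c" for c d
      using that by (cases c; cases d) (auto simp: adj_of_iff graft_edges insert_commute)
  qed simp
  then show "x \<in> Inl ` verts S" using x(1) by auto
next
  fix x :: "'a + 'b" assume "x \<in> Inl ` verts S"
  then show "x \<in> R_verts (graft S v T) {Inl v, Inr (root T)}"
    using graft_adj_Inl[OF rooted_tree_connected[OF S], of _ v T] by (auto simp: R_verts_def)
qed

lemma graft_joint: "{Inl v, Inr (root T)} \<in> edges (graft S v T)"
  by (simp add: graft_edges)

lemma giso_graft_R_part: "giso Inl S (R_part (graft S v T) {Inl v, Inr (root T)})"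
proof -
  have "root (R_part (graft S v T) {Inl v, Inr (root T)}) = Inl (root S)"
    unfolding R_part_def
    using sub_root_arg_min[OF R_root[OF rooted_tree_graft[OF S T v]]] by simp
  then show ?thesis
    unfolding giso_def R_part_def rooted_sub_def graft_R_verts
    by (auto simp: graft_edges bij_betw_def)
qed

lemma giso_graft_P_part: "giso Inr T (P_part (graft S v T) {Inl v, Inr (root T)})"
proof -
  let ?e = "{Inl v, Inr (root T)}"
  obtain a b where ab: "?e = {a, b}" "a \<in> R_verts (graft S v T) ?e"
    "sub_root (graft S v T) (verts (graft S v T) - R_verts (graft S v T) ?e) b"
    by (rule P_root[OF rooted_tree_graft[OF S T v] graft_joint])
  have "b = Inr (root T)"
    using ab(1,2) unfolding graft_R_verts by (auto simp: doubleton_eq_iff)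
  then have rt: "root (P_part (graft S v T) ?e) = Inr (root T)"
    unfolding P_part_def using sub_root_arg_min[OF ab(3)] by simp
  have vt: "verts (graft S v T) - Inl ` verts S = Inr ` verts T" by auto
  have "verts (P_part (graft S v T) ?e) = Inr ` verts T"
    "edges (P_part (graft S v T) ?e) = {f \<in> edges (graft S v T). f \<subseteq> Inr ` verts T}"
    by (simp_all only: P_part_def rooted_sub_def graft_R_verts vt rgraph.simps)
  with rt show ?thesis
    unfolding giso_def by (auto simp: graft_edges bij_betw_def)
qed

end

lemma R_part_verts [simp]: "verts (R_part g e) = R_verts g e"
  by (simp add: R_part_def rooted_sub_def)

lemma P_part_verts [simp]: "verts (P_part g e) = verts g - R_verts g e"
  by (simp add: P_part_def rooted_sub_def)

lemma R_verts_subset: "R_verts g e \<subseteq> verts g"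
  by (auto simp: R_verts_def)

lemma R_part_root: "rooted_tree g \<Longrightarrow> root (R_part g e) = root g"
  unfolding R_part_def by (rule sub_root_arg_min[OF R_root])

lemma P_part_root_edge:
  assumes "rooted_tree g" "e \<in> edges g"
  obtains a where "e = {a, root (P_part g e)}" "a \<in> R_verts g e"
    "root (P_part g e) \<in> verts g - R_verts g e"
proof -
  obtain a b where ab: "e = {a, b}" "a \<in> R_verts g e" "sub_root g (verts g - R_verts g e) b"
    by (rule P_root[OF assms])
  have "root (P_part g e) = b" unfolding P_part_def by (rule sub_root_arg_min[OF ab(3)])
  then show thesis using that[of a] ab by (simp add: sub_root_def)
qed

text \<open>
  The edge \<open>e\<close> is the only one between the two components, since any other edge leaving a vertex
  reachable without \<open>e\<close> leads to such a vertex again.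
\<close>

lemma R_verts_edge:
  assumes "rooted_tree g" "{x, y} \<in> edges g" "{x, y} \<noteq> e" "x \<in> R_verts g e"
  shows "y \<in> R_verts g e"
proof -
  have "(root g, x) \<in> (adj_of (edges g - {e}))\<^sup>*" using assms(4) by (simp add: R_verts_def)
  moreover have "(x, y) \<in> adj_of (edges g - {e})" using assms(2,3) by (simp add: adj_of_iff)
  ultimately have "(root g, y) \<in> (adj_of (edges g - {e}))\<^sup>*" by (rule rtrancl_into_rtrancl)
  then show ?thesis
    using rooted_tree_edge_verts[OF assms(1,2)] by (simp add: R_verts_def)
qed

lemma rtrancl_restrict_invariant:
  assumes "(x, y) \<in> (adj_of F)\<^sup>*" "x \<in> W" "\<And>x y. {x, y} \<in> F \<Longrightarrow> x \<in> W \<Longrightarrow> y \<in> W"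
  shows "y \<in> W \<and> (x, y) \<in> (adj_of {e \<in> F. e \<subseteq> W})\<^sup>*"
  using assms(1)
proof (induction rule: rtrancl_induct)
  case base
  then show ?case using assms(2) by simp
next
  case (step y z)
  then have "z \<in> W" "(y, z) \<in> adj_of {e \<in> F. e \<subseteq> W}"
    using assms(3)[of y z] by (auto simp: adj_of_iff)
  then show ?case using step.IH by (auto intro: rtrancl_into_rtrancl)
qed

lemma rooted_tree_subgraph:
  assumes g: "rooted_tree g" and h: "verts h \<subseteq> verts g" "edges h \<subseteq> edges g"
    "\<And>e. e \<in> edges h \<Longrightarrow> e \<subseteq> verts h" "root h \<in> verts h"
    "\<And>w. w \<in> verts h \<Longrightarrow> (root h, w) \<in> (adj_of (edges h))\<^sup>*"
  shows "rooted_tree h"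
proof (rule rooted_treeI)
  show "finite (verts h)" using g h(1) by (auto simp: rooted_tree_def intro: finite_subset)
  show "\<exists>u v. e = {u, v} \<and> u \<in> verts h \<and> v \<in> verts h \<and> u \<noteq> v" if e: "e \<in> edges h" for e
  proof -
    obtain u v where uv: "e = {u, v}" "u \<noteq> v" using edgeE[OF g] h(2) e by blast
    then have "u \<in> verts h" "v \<in> verts h" using h(3)[OF e] by auto
    then show ?thesis using uv by blast
  qed
  show "(a, b) \<notin> (adj_of (edges h - {{a, b}}))\<^sup>*" if "{a, b} \<in> edges h" "a \<noteq> b" for a b
  proof
    assume "(a, b) \<in> (adj_of (edges h - {{a, b}}))\<^sup>*"
    then have "(a, b) \<in> (adj_of (edges g - {{a, b}}))\<^sup>*"
      by (rule adj_of_rtrancl_mono[rotated]) (use h(2) in blast)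
    then show False using bridge[OF g] that h(2) by blast
  qed
qed (use h in auto)

lemma rooted_tree_R_part:
  assumes g: "rooted_tree g"
  shows "rooted_tree (R_part g e)"
proof (rule rooted_tree_subgraph[OF g])
  let ?W = "R_verts g e"
  have ed: "edges (R_part g e) = {f \<in> edges g. f \<subseteq> ?W}"
    by (simp add: R_part_def rooted_sub_def)
  have rt: "root g \<in> ?W" using rooted_tree_root[OF g] by (simp add: R_verts_def)
  then show "root (R_part g e) \<in> verts (R_part g e)" by (simp add: R_part_root[OF g])
  show "(root (R_part g e), w) \<in> (adj_of (edges (R_part g e)))\<^sup>*" if "w \<in> verts (R_part g e)" for w
  proof -
    have "(root g, w) \<in> (adj_of (edges g - {e}))\<^sup>*" using that by (simp add: R_verts_def)
    then have "(root g, w) \<in> (adj_of {f \<in> edges g - {e}. f \<subseteq> ?W})\<^sup>*"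
      using rtrancl_restrict_invariant[OF _ rt] R_verts_edge[OF g] by blast
    then show ?thesis
      unfolding R_part_root[OF g] ed by (rule adj_of_rtrancl_mono[rotated]) blast
  qed
qed (auto simp: R_part_def rooted_sub_def R_verts_def)

text \<open>
  The lower part is connected: on a walk from the root to a vertex of it, the part after the last
  passage through \<open>e\<close> joins the lower end of \<open>e\<close> to that vertex without using \<open>e\<close>.
\<close>

lemma rooted_tree_P_part:
  assumes g: "rooted_tree g" and e: "e \<in> edges g"
  shows "rooted_tree (P_part g e)"
proof (rule rooted_tree_subgraph[OF g])
  let ?W = "verts g - R_verts g e" and ?b = "root (P_part g e)"
  have ed: "edges (P_part g e) = {f \<in> edges g. f \<subseteq> ?W}"
    by (simp add: P_part_def rooted_sub_def)
  obtain a where a: "e = {a, ?b}" "a \<in> R_verts g e" "?b \<in> ?W"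
    by (rule P_part_root_edge[OF g e])
  then show "?b \<in> verts (P_part g e)" by simp
  show "(?b, w) \<in> (adj_of (edges (P_part g e)))\<^sup>*" if w: "w \<in> verts (P_part g e)" for w
  proof -
    let ?r = "adj_of (edges g - {e})"
    have "(root g, w) \<in> (adj_of (edges g))\<^sup>*" using rooted_tree_connected[OF g] w by simp
    then have "(root g, w) \<in> ?r\<^sup>* \<or> (?b, w) \<in> ?r\<^sup>*"
    proof (induction rule: rtrancl_induct)
      case base
      then show ?case by simp
    next
      case (step y z)
      show ?case
      proof (cases "{y, z} = e")
        case True
        then have "z = a \<or> z = ?b" using a(1) by (auto simp: doubleton_eq_iff)
        then show ?thesis using a(2) by (auto simp: R_verts_def)
      next
        case False
        then have "(y, z) \<in> ?r" using step.hyps by (simp add: adj_of_iff)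
        then show ?thesis using step.IH by (auto intro: rtrancl_into_rtrancl)
      qed
    qed
    then have "(?b, w) \<in> ?r\<^sup>*" using w by (auto simp: R_verts_def)
    moreover have "y \<in> ?W" if xy: "{x, y} \<in> edges g - {e}" "x \<in> ?W" for x y
    proof
      show "y \<in> verts g" using rooted_tree_edge_verts[OF g] xy by blast
      show "y \<notin> R_verts g e"
      proof
        assume "y \<in> R_verts g e"
        then have "x \<in> R_verts g e"
          using R_verts_edge[OF g, of y x e] xy by (auto simp: insert_commute)
        then show False using xy(2) by simp
      qed
    qed
    ultimately have "(?b, w) \<in> (adj_of {f \<in> edges g - {e}. f \<subseteq> ?W})\<^sup>*"
      using rtrancl_restrict_invariant[OF _ a(3)] by blast
    then show ?thesis
      unfolding ed by (rule adj_of_rtrancl_mono[rotated]) blast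
  qed
qed (auto simp: P_part_def rooted_sub_def)

text \<open>
  Cutting at an edge and grafting are inverse to each other, since \<open>e\<close> is the only edge between the
  two parts.
\<close>

lemma cut_regraft:
  assumes g: "rooted_tree g" and e: "e \<in> edges g"
  obtains a where "a \<in> R_verts g e" "e = {a, root (P_part g e)}"
    "giso (case_sum id id) (graft (R_part g e) a (P_part g e)) g"
proof -
  let ?b = "root (P_part g e)" and ?R = "R_verts g e"
  obtain a where a: "e = {a, ?b}" "a \<in> ?R" "?b \<in> verts g - ?R"
    by (rule P_part_root_edge[OF g e])
  have sub: "?R \<subseteq> verts g" by (rule R_verts_subset)
  let ?f = "case_sum id id" and ?G = "graft (R_part g e) a (P_part g e)"
  have edR: "edges (R_part g e) = {f \<in> edges g. f \<subseteq> ?R}"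
    and edP: "edges (P_part g e) = {f \<in> edges g. f \<subseteq> verts g - ?R}"
    by (simp_all add: R_part_def P_part_def rooted_sub_def)
  have cross: "{x, y} \<in> edges g \<longleftrightarrow> x = a \<and> y = ?b" if "x \<in> ?R" "y \<notin> ?R" for x y
  proof
    assume "{x, y} \<in> edges g"
    then have "{x, y} = e" using R_verts_edge[OF g] that by blast
    then show "x = a \<and> y = ?b" using that a by (metis DiffD2 doubleton_eq_iff)
  qed (use a e in auto)
  then have cross': "{y, x} \<in> edges g \<longleftrightarrow> x = a \<and> y = ?b" if "x \<in> ?R" "y \<notin> ?R" for x y
    using that by (simp add: insert_commute)
  have "giso ?f ?G g"
    unfolding giso_def
  proof (intro conjI ballI)
    show "bij_betw ?f (verts ?G) (verts g)"
      using sub by (auto simp: bij_betw_def inj_on_def image_Un image_image)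
    show "?f (root ?G) = root g" by (simp add: R_part_root[OF g])
    show "{x, y} \<in> edges ?G \<longleftrightarrow> {?f x, ?f y} \<in> edges g" if "x \<in> verts ?G" "y \<in> verts ?G" for x y
      using that by (cases x; cases y) (auto simp: graft_edges edR edP cross cross')
  qed
  then show thesis using that a by blast
qed

text \<open>
  This identifies the two parts of a cut without computing reachable sets: it suffices to present
  the tree as a graft along the given edge.
\<close>

lemma parts_of_graft:
  assumes S: "rooted_tree S" and T: "rooted_tree T" and v: "v \<in> verts S"
    and G: "rooted_tree G" and f: "giso f (graft S v T) G"
  shows "{f (Inl v), f (Inr (root T))} \<in> edges G"
    "giso (f \<circ> Inl) S (R_part G {f (Inl v), f (Inr (root T))})"
    "giso (f \<circ> Inr) T (P_part G {f (Inl v), f (Inr (root T))})"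
proof -
  note gr = rooted_tree_graft[OF S T v]
  let ?e = "{Inl v, Inr (root T)}"
  have e: "?e \<in> edges (graft S v T)" by (rule graft_joint[OF S T v])
  have fe: "f ` ?e = {f (Inl v), f (Inr (root T))}" by simp
  show "{f (Inl v), f (Inr (root T))} \<in> edges G"
    unfolding fe[symmetric] giso_edges(1)[OF gr G f] by (rule imageI[OF e])
  show "giso (f \<circ> Inl) S (R_part G {f (Inl v), f (Inr (root T))})"
    unfolding fe[symmetric]
    by (rule giso_comp[OF giso_graft_R_part[OF S T v] giso_parts(1)[OF gr G f e]])
  show "giso (f \<circ> Inr) T (P_part G {f (Inl v), f (Inr (root T))})"
    unfolding fe[symmetric]
    by (rule giso_comp[OF giso_graft_P_part[OF S T v] giso_parts(2)[OF gr G f e]])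
qed

section \<open>The structure constants\<close>

lemma giso_image: "giso f g h \<Longrightarrow> f ` verts g = verts h"
  by (simp add: giso_def bij_betw_def)


lemma \<alpha>_tree_class:
  assumes G: "rooted_tree G"
  shows "\<alpha> s (tree_class G) r =
    card {e \<in> edges G. tree_class (R_part G e) = r \<and> tree_class (P_part G e) = s}"
proof -
  obtain g :: "nat rgraph" and f where g: "rooted_tree g" "giso f g G" "tree_class G = abs_rtree g"
    using ex_nat_copy[OF G] .
  obtain a :: "nat rgraph" where a: "rooted_tree a" "s = tree_class a" by (rule rtree_cases)
  obtain b :: "nat rgraph" where b: "rooted_tree b" "r = tree_class b" by (rule rtree_cases)
  have "\<alpha> s (tree_class G) r =
      card {e \<in> edges g. isomorphic (R_part g e) b \<and> isomorphic (P_part g e) a}"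
    using a b g by (simp add: tree_class_nat \<alpha>.abs_eq tree_iso_refl)
  also have "\<dots> = card {e \<in> edges G. tree_class (R_part G e) = r \<and> tree_class (P_part G e) = s}"
  proof (rule card_transport)
    show "bij_betw (image f) (edges g) (edges G)"
      using giso_edges[OF g(1) G g(2)] by (simp add: bij_betw_def)
    fix e assume e: "e \<in> edges g"
    have "tree_class (R_part g e) = tree_class (R_part G (f ` e))"
      by (rule tree_class_eqI[OF rooted_tree_R_part[OF g(1)] giso_parts(1)[OF g(1) G g(2) e]])
    moreover have "tree_class (P_part g e) = tree_class (P_part G (f ` e))"
      by (rule tree_class_eqI[OF rooted_tree_P_part[OF g(1) e] giso_parts(2)[OF g(1) G g(2) e]])
    ultimately show "isomorphic (R_part g e) b \<and> isomorphic (P_part g e) a \<longleftrightarrow>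
        tree_class (R_part G (f ` e)) = r \<and> tree_class (P_part G (f ` e)) = s"
      using a b isomorphic_iff_tree_class[OF rooted_tree_R_part[OF g(1)] b(1), of e]
        isomorphic_iff_tree_class[OF rooted_tree_P_part[OF g(1) e] a(1)] by simp
  qed
  finally show ?thesis .
qed

lemma tree_class_graft_cong:
  assumes S: "rooted_tree S" and T: "rooted_tree T" and v: "v \<in> verts S"
    and f: "giso f S S'" and k: "giso k T T'"
  shows "tree_class (graft S v T) = tree_class (graft S' (f v) T')"
  by (rule tree_class_eqI[OF rooted_tree_graft[OF S T v] giso_graft[OF f k v rooted_tree_root[OF T]]])

lemma \<beta>_tree_class:
  assumes S: "rooted_tree S" and T: "rooted_tree T"
  shows "\<beta> r (tree_class T) (tree_class S) = card {v \<in> verts S. tree_class (graft S v T) = r}"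
proof -
  obtain s :: "nat rgraph" and f where s: "rooted_tree s" "giso f s S" "tree_class S = abs_rtree s"
    using ex_nat_copy[OF S] .
  obtain t :: "nat rgraph" and k where t: "rooted_tree t" "giso k t T" "tree_class T = abs_rtree t"
    using ex_nat_copy[OF T] .
  obtain a :: "nat rgraph" where a: "rooted_tree a" "r = tree_class a" by (rule rtree_cases)
  have "\<beta> r (tree_class T) (tree_class S) = card {v \<in> verts s. isomorphic a (graft s v t)}"
    using a s t by (simp add: tree_class_nat \<beta>.abs_eq tree_iso_refl)
  also have "\<dots> = card {v \<in> verts S. tree_class (graft S v T) = r}"
  proof (rule card_transport)
    show "bij_betw f (verts s) (verts S)" using s(2) by (simp add: giso_def)
    fix v assume v: "v \<in> verts s"
    show "isomorphic a (graft s v t) \<longleftrightarrow> tree_class (graft S (f v) T) = r"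
      using isomorphic_iff_tree_class[OF a(1) rooted_tree_graft[OF s(1) t(1) v]] a(2)
        tree_class_graft_cong[OF s(1) t(1) v s(2) t(2)] by auto
  qed
  finally show ?thesis .
qed

text \<open>
  Both sides count the isomorphisms from a tree obtained by joining \<open>s\<close> to some vertex of \<open>r\<close> onto
  \<open>t\<close>. Sorted by that vertex, each vertex yielding \<open>t\<close> contributes the automorphisms of \<open>t\<close>; sorted
  by the image of the joining edge, an edge that cuts \<open>t\<close> into \<open>r\<close> and \<open>s\<close> contributes one
  isomorphism for each choice of isomorphisms from \<open>r\<close> and \<open>s\<close> onto the two parts.
\<close>

lemma \<alpha>_\<beta>_aut_count:
  "\<alpha> s t r * (aut_count s * aut_count r) = \<beta> t s r * aut_count t"
proof -
  obtain S :: "nat rgraph" where S: "rooted_tree S" "s = tree_class S" by (rule rtree_cases)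
  obtain T :: "nat rgraph" where T: "rooted_tree T" "t = tree_class T" by (rule rtree_cases)
  obtain R :: "nat rgraph" where R: "rooted_tree R" "r = tree_class R" by (rule rtree_cases)
  define X where "X = (SIGMA v:verts R. graph_isos (graft R v S) T)"
  define Y where "Y = (SIGMA e:edges T. graph_isos R (R_part T e) \<times> graph_isos S (P_part T e))"
  note gr = rooted_tree_graft[OF R(1) S(1)]
  have finV: "finite (verts g)" if "rooted_tree g" for g :: "nat rgraph"
    using that by (simp add: rooted_tree_def)
  have finE: "finite (edges T)"
  proof (rule finite_subset)
    show "edges T \<subseteq> Pow (verts T)" using edges_subset[OF T(1)] by blast
  qed (simp add: finV[OF T(1)])
  have cX: "card X = \<beta> t s r * aut_count t"
  proof -
    have "card X = (\<Sum>v\<in>verts R. card (graph_isos (graft R v S) T))"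
      unfolding X_def using finV[OF R(1)] finite_graph_isos[OF gr T(1)] by (simp add: card_SigmaI)
    also have "\<dots> = (\<Sum>v\<in>verts R. if tree_class (graft R v S) = t then aut_count t else 0)"
      using card_graph_isos[OF gr T(1)] T(2) by (intro sum.cong) auto
    also have "\<dots> = \<beta> t s r * aut_count t"
      using finV[OF R(1)] \<beta>_tree_class[OF R(1) S(1)] R(2) S(2)
      by (simp add: sum.If_cases Int_def)
    finally show ?thesis .
  qed
  have cY: "card Y = \<alpha> s t r * (aut_count s * aut_count r)"
  proof -
    have "card Y = (\<Sum>e\<in>edges T. card (graph_isos R (R_part T e) \<times> graph_isos S (P_part T e)))"
      unfolding Y_def using finE finite_graph_isos[OF R(1) rooted_tree_R_part[OF T(1)]]
        finite_graph_isos[OF S(1) rooted_tree_P_part[OF T(1)]] by (simp add: card_SigmaI)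
    also have "\<dots> = (\<Sum>e\<in>edges T. if tree_class (R_part T e) = r \<and> tree_class (P_part T e) = s
        then aut_count s * aut_count r else 0)"
      using card_graph_isos[OF R(1) rooted_tree_R_part[OF T(1)]]
        card_graph_isos[OF S(1) rooted_tree_P_part[OF T(1)]] R(2) S(2)
      by (intro sum.cong) (auto simp: card_cartesian_product)
    also have "\<dots> = \<alpha> s t r * (aut_count s * aut_count r)"
      using finE \<alpha>_tree_class[OF T(1)] T(2) by (simp add: sum.If_cases Int_def)
    finally show ?thesis .
  qed
  have finX: "finite X"
    unfolding X_def using finV[OF R(1)] finite_graph_isos[OF gr T(1)] by (intro finite_SigmaI) auto
  have finY: "finite Y"
    unfolding Y_def using finE finite_graph_isos[OF R(1) rooted_tree_R_part[OF T(1)]]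
      finite_graph_isos[OF S(1) rooted_tree_P_part[OF T(1)]] by (intro finite_SigmaI) auto
  \<comment> \<open>An isomorphism is determined by its restrictions to \<open>R\<close> and \<open>S\<close>, and the image of the joining edge
    then determines the vertex at which \<open>S\<close> was joined.\<close>
  have "card X \<le> card Y"
  proof (rule card_inj_on_le[OF _ _ finY])
    let ?F = "\<lambda>(v, f). ({f (Inl v), f (Inr (root S))},
      restrict (f \<circ> Inl) (verts R), restrict (f \<circ> Inr) (verts S))"
    show "?F ` X \<subseteq> Y"
    proof (rule image_subsetI)
      fix p assume "p \<in> X"
      then obtain v f where p: "p = (v, f)" "v \<in> verts R" "giso f (graft R v S) T"
        using graph_isos_giso unfolding X_def by blast
      note pg = parts_of_graft[OF R(1) S(1) p(2) T(1) p(3)]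
      show "?F p \<in> Y"
        using p(1) pg(1) giso_restrict[OF pg(2) rooted_tree_root[OF R(1)]]
          giso_restrict[OF pg(3) rooted_tree_root[OF S(1)]] unfolding Y_def by simp
    qed
    show "inj_on ?F X"
    proof (rule inj_onI)
      fix p q assume "p \<in> X" "q \<in> X" and eq: "?F p = ?F q"
      then obtain v f w k where p: "p = (v, f)" "v \<in> verts R" "f \<in> graph_isos (graft R v S) T"
        and q: "q = (w, k)" "w \<in> verts R" "k \<in> graph_isos (graft R w S) T"
        unfolding X_def by blast
      have l: "f (Inl x) = k (Inl x)" if "x \<in> verts R" for x
        using eq p(1) q(1) that by (auto dest!: fun_cong[where x = x])
      have r: "f (Inr x) = k (Inr x)" if "x \<in> verts S" for x
        using eq p(1) q(1) that by (auto dest!: fun_cong[where x = x])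
      have fk: "f = k"
      proof (rule PiE_ext[of _ "verts (graft R v S)" "\<lambda>_. verts T"])
        show "f \<in> verts (graft R v S) \<rightarrow>\<^sub>E verts T" "k \<in> verts (graft R v S) \<rightarrow>\<^sub>E verts T"
          using p(3) q(3) by (auto simp: graph_isos_def)
      qed (use l r in auto)
      have "{f (Inl v), f (Inr (root S))} = {f (Inl w), f (Inr (root S))}"
        using eq p(1) q(1) fk by simp
      then have "f (Inl v) = f (Inl w)" by (auto simp: doubleton_eq_iff)
      moreover have "inj_on f (verts (graft R v S))"
        using p(3) by (simp add: graph_isos_def bij_betw_def)
      ultimately have "v = w" using p(2) q(2) by (auto dest: inj_onD)
      then show "p = q" using p(1) q(1) fk by simp
    qed
  qed
  \<comment> \<open>Conversely, isomorphisms onto the two parts of a cut glue, if \<open>S\<close> is joined to \<open>R\<close> at the vertex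
    corresponding to the upper end of the cut edge.\<close>
  moreover have "card Y \<le> card X"
  proof -
    have ex: "\<exists>v f. (v, f) \<in> X \<and> {f (Inl v), f (Inr (root S))} = e \<and>
        (\<forall>x\<in>verts R. f (Inl x) = k x) \<and> (\<forall>x\<in>verts S. f (Inr x) = l x)"
      if "(e, k, l) \<in> Y" for e k l
    proof -
      have e: "e \<in> edges T" and k': "k \<in> graph_isos R (R_part T e)"
        and l': "l \<in> graph_isos S (P_part T e)"
        using that unfolding Y_def by (auto simp only: mem_Sigma_iff)
      note k = graph_isos_giso[OF k'] and l = graph_isos_giso[OF l']
      obtain a where a: "a \<in> R_verts T e" "e = {a, root (P_part T e)}"
        "giso (case_sum id id) (graft (R_part T e) a (P_part T e)) T"
        by (rule cut_regraft[OF T(1) e])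
      have "a \<in> k ` verts R" using giso_image[OF k] a(1) by simp
      then obtain v where v: "v \<in> verts R" "k v = a" by (elim imageE) simp
      let ?f = "restrict (case_sum id id \<circ> map_sum k l) (verts (graft R v S))"
      have kl: "giso (map_sum k l) (graft R v S) (graft (R_part T e) a (P_part T e))"
        using giso_graft[OF k l v(1) rooted_tree_root[OF S(1)]] unfolding v(2) .
      have "?f \<in> graph_isos (graft R v S) T"
        by (rule giso_restrict[OF giso_comp[OF kl a(3)] rooted_tree_root[OF gr[OF v(1)]]])
      then have X: "(v, ?f) \<in> X" using v(1) by (simp add: X_def)
      have "l (root S) = root (P_part T e)" using l by (simp add: giso_def)
      then have "?f (Inl v) = a" "?f (Inr (root S)) = root (P_part T e)"
        using v rooted_tree_root[OF S(1)] by simp_all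
      then have "{?f (Inl v), ?f (Inr (root S))} = e" using a(2) by argo
      moreover have "\<forall>x\<in>verts R. ?f (Inl x) = k x" "\<forall>x\<in>verts S. ?f (Inr x) = l x" by simp_all
      ultimately show ?thesis using X by blast
    qed
    have "\<forall>y. \<exists>z. y \<in> Y \<longrightarrow> z \<in> X \<and> {snd z (Inl (fst z)), snd z (Inr (root S))} = fst y \<and>
        (\<forall>x\<in>verts R. snd z (Inl x) = fst (snd y) x) \<and> (\<forall>x\<in>verts S. snd z (Inr x) = snd (snd y) x)"
    proof
      fix y show "\<exists>z. y \<in> Y \<longrightarrow> z \<in> X \<and> {snd z (Inl (fst z)), snd z (Inr (root S))} = fst y \<and>
        (\<forall>x\<in>verts R. snd z (Inl x) = fst (snd y) x) \<and> (\<forall>x\<in>verts S. snd z (Inr x) = snd (snd y) x)"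
        using ex[of "fst y" "fst (snd y)" "snd (snd y)"]
        by (cases "y \<in> Y") (simp_all only: prod.collapse simp_thms, metis fst_conv snd_conv)
    qed
    then obtain H where H: "\<And>y. y \<in> Y \<Longrightarrow> H y \<in> X \<and>
        {snd (H y) (Inl (fst (H y))), snd (H y) (Inr (root S))} = fst y \<and>
        (\<forall>x\<in>verts R. snd (H y) (Inl x) = fst (snd y) x) \<and>
        (\<forall>x\<in>verts S. snd (H y) (Inr x) = snd (snd y) x)"
      unfolding choice_iff by blast
    show ?thesis
    proof (rule card_inj_on_le[OF _ _ finX])
      show "H ` Y \<subseteq> X" using H by blast
      show "inj_on H Y"
      proof (rule inj_onI)
        fix y z assume y: "y \<in> Y" and z: "z \<in> Y" and eq: "H y = H z"
        have 1: "fst y = fst z" using H[OF y] H[OF z] unfolding eq by metis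
        have "fst (snd y) = fst (snd z)"
        proof (rule PiE_ext[of _ "verts R" "\<lambda>_. R_verts T (fst y)"])
          show "fst (snd y) \<in> verts R \<rightarrow>\<^sub>E R_verts T (fst y)"
            using y by (auto simp: Y_def graph_isos_def)
          show "fst (snd z) \<in> verts R \<rightarrow>\<^sub>E R_verts T (fst y)"
            using z unfolding 1 by (auto simp: Y_def graph_isos_def)
          show "fst (snd y) x = fst (snd z) x" if "x \<in> verts R" for x
            using H[OF y] H[OF z] that unfolding eq by metis
        qed
        moreover have "snd (snd y) = snd (snd z)"
        proof (rule PiE_ext[of _ "verts S" "\<lambda>_. verts T - R_verts T (fst y)"])
          show "snd (snd y) \<in> verts S \<rightarrow>\<^sub>E verts T - R_verts T (fst y)"
            using y by (auto simp: Y_def graph_isos_def)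
          show "snd (snd z) \<in> verts S \<rightarrow>\<^sub>E verts T - R_verts T (fst y)"
            using z unfolding 1 by (auto simp: Y_def graph_isos_def)
          show "snd (snd y) x = snd (snd z) x" if "x \<in> verts S" for x
            using H[OF y] H[OF z] that unfolding eq by metis
        qed
        ultimately show "y = z" using 1 by (simp add: prod_eq_iff)
      qed
    qed
  qed
  ultimately show ?thesis using cX cY by simp
qed

lemma \<alpha>_nonzero_iff: "\<alpha> s t r \<noteq> 0 \<longleftrightarrow> \<beta> t s r \<noteq> 0"
  using \<alpha>_\<beta>_aut_count[of s t r] aut_count_pos[of s] aut_count_pos[of t] aut_count_pos[of r]
  by (metis mult_eq_0_iff not_gr_zero)

section \<open>Grafting at the root\<close>

text \<open>
  The choice of representatives is immaterial by \<open>root_graft_tree_class\<close> below.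
\<close>

definition root_graft :: "rtree \<Rightarrow> rtree \<Rightarrow> rtree" where
  "root_graft s r =
     (let S = (SOME S :: nat rgraph. rooted_tree S \<and> tree_class S = s);
          R = (SOME R :: nat rgraph. rooted_tree R \<and> tree_class R = r)
      in tree_class (graft R (root R) S))"

lemma root_graft_tree_class:
  assumes S: "rooted_tree S" and R: "rooted_tree R"
  shows "root_graft (tree_class S) (tree_class R) = tree_class (graft R (root R) S)"
proof -
  have some: "\<exists>X :: nat rgraph. rooted_tree X \<and> tree_class X = x" for x
    using rtree_cases[of x] by metis
  define S' :: "nat rgraph" where "S' = (SOME S'. rooted_tree S' \<and> tree_class S' = tree_class S)"
  define R' :: "nat rgraph" where "R' = (SOME R'. rooted_tree R' \<and> tree_class R' = tree_class R)"
  have S': "rooted_tree S'" "tree_class S' = tree_class S"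
    unfolding S'_def using someI_ex[OF some] by blast+
  have R': "rooted_tree R'" "tree_class R' = tree_class R"
    unfolding R'_def using someI_ex[OF some] by blast+
  obtain f where f: "giso f S' S" using tree_class_eq_iff[OF S'(1) S] S'(2) by blast
  obtain k where k: "giso k R' R" using tree_class_eq_iff[OF R'(1) R] R'(2) by blast
  have "k (root R') = root R" using k by (simp add: giso_def)
  then have "tree_class (graft R' (root R') S') = tree_class (graft R (root R) S)"
    using tree_class_graft_cong[OF R'(1) S'(1) rooted_tree_root[OF R'(1)] k f] by simp
  then show ?thesis unfolding root_graft_def S'_def R'_def Let_def .
qed

lemma \<beta>_root_graft_nonzero: "\<beta> (root_graft s r) s r \<noteq> 0"
proof -
  obtain S :: "nat rgraph" where S: "rooted_tree S" "s = tree_class S" by (rule rtree_cases)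
  obtain R :: "nat rgraph" where R: "rooted_tree R" "r = tree_class R" by (rule rtree_cases)
  have "root R \<in> {v \<in> verts R. tree_class (graft R v S) = root_graft s r}"
    using rooted_tree_root[OF R(1)] root_graft_tree_class[OF S(1) R(1)] S(2) R(2) by simp
  moreover have "finite {v \<in> verts R. tree_class (graft R v S) = root_graft s r}"
    using R(1) by (simp add: rooted_tree_def)
  ultimately show ?thesis
    using \<beta>_tree_class[OF R(1) S(1)] R(2) S(2) by (auto simp: card_eq_0_iff)
qed

lemma tsize_root_graft: "tsize (root_graft s r) = tsize s + tsize r"
  using \<beta>_size[OF \<beta>_root_graft_nonzero] .

lemma tsize_pos: "tsize t > 0"
proof -
  obtain g :: "nat rgraph" where g: "rooted_tree g" "t = tree_class g" by (rule rtree_cases)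
  then show ?thesis
    using rooted_tree_root[OF g(1)] by (auto simp: tsize_tree_class card_gt_0_iff rooted_tree_def)
qed

definition children_of_root :: "'a rgraph \<Rightarrow> 'a set" where
  "children_of_root g = {v \<in> verts g. {root g, v} \<in> edges g}"

lift_definition root_degree :: "rtree \<Rightarrow> nat" is "\<lambda>g. card (children_of_root g)"
proof -
  fix g h :: "nat rgraph"
  assume "tree_iso g h"
  then obtain f where f: "rooted_tree g" "rooted_tree h" "giso f g h" by (elim tree_isoE)
  show "card (children_of_root g) = card (children_of_root h)"
    unfolding children_of_root_def
  proof (rule card_transport)
    show "bij_betw f (verts g) (verts h)" using f(3) by (simp add: giso_def)
    show "{root g, v} \<in> edges g \<longleftrightarrow> {root h, f v} \<in> edges h" if "v \<in> verts g" for v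
      using f(3) that rooted_tree_root[OF f(1)] unfolding giso_def by auto
  qed
qed

lemma root_degree_tree_class:
  assumes G: "rooted_tree G"
  shows "root_degree (tree_class G) = card (children_of_root G)"
proof -
  obtain g :: "nat rgraph" and f where g: "rooted_tree g" "giso f g G" "tree_class G = abs_rtree g"
    using ex_nat_copy[OF G] .
  have "root_degree (tree_class G) = card (children_of_root g)"
    using g by (simp add: root_degree.abs_eq tree_iso_refl)
  also have "\<dots> = card (children_of_root G)"
    unfolding children_of_root_def
  proof (rule card_transport)
    show "bij_betw f (verts g) (verts G)" using g(2) by (simp add: giso_def)
    show "{root g, v} \<in> edges g \<longleftrightarrow> {root G, f v} \<in> edges G" if "v \<in> verts g" for v
      using g(2) that rooted_tree_root[OF g(1)] unfolding giso_def by auto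
  qed
  finally show ?thesis .
qed

lemma root_degree_less_tsize: "root_degree t < tsize t"
proof -
  obtain g :: "nat rgraph" where g: "rooted_tree g" "t = tree_class g" by (rule rtree_cases)
  have "children_of_root g \<subset> verts g"
    using rooted_tree_root[OF g(1)] rooted_tree_no_loop[OF g(1)]
    unfolding children_of_root_def by blast
  then show ?thesis
    using g by (simp add: root_degree_tree_class tsize_tree_class psubset_card_mono rooted_tree_def)
qed

lemma children_of_root_graft:
  "children_of_root (graft S v T) =
    Inl ` children_of_root S \<union> (if v = root S then {Inr (root T)} \<inter> Inr ` verts T else {})"
  unfolding children_of_root_def by (auto simp: graft_edges)

lemma root_degree_graft:
  assumes S: "rooted_tree S" and T: "rooted_tree T" and v: "v \<in> verts S"
  shows "root_degree (tree_class (graft S v T)) =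
    root_degree (tree_class S) + (if v = root S then 1 else 0)"
proof -
  have fin: "finite (children_of_root S)"
    using S unfolding children_of_root_def by (simp add: rooted_tree_def)
  have "card (Inl ` children_of_root S :: ('a + 'b) set) = card (children_of_root S)"
    by (simp add: card_image)
  moreover have "Inr (root T) \<notin> Inl ` children_of_root S" by blast
  ultimately have "card (children_of_root (graft S v T)) =
      card (children_of_root S) + (if v = root S then 1 else 0)"
    using fin rooted_tree_root[OF T] by (auto simp: children_of_root_graft)
  then show ?thesis
    by (simp add: root_degree_tree_class[OF S] root_degree_tree_class[OF rooted_tree_graft[OF S T v]])
qed

lemma root_degree_root_graft: "root_degree (root_graft s r) = Suc (root_degree r)"
proof -
  obtain S :: "nat rgraph" where S: "rooted_tree S" "s = tree_class S" by (rule rtree_cases)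
  obtain R :: "nat rgraph" where R: "rooted_tree R" "r = tree_class R" by (rule rtree_cases)
  show ?thesis
    using root_degree_graft[OF R(1) S(1) rooted_tree_root[OF R(1)]]
      root_graft_tree_class[OF S(1) R(1)] S(2) R(2) by simp
qed

lemma \<beta>_nonzero_cases:
  assumes "\<beta> t s r \<noteq> 0"
  shows "t = root_graft s r \<or> root_degree t = root_degree r"
proof -
  obtain S :: "nat rgraph" where S: "rooted_tree S" "s = tree_class S" by (rule rtree_cases)
  obtain R :: "nat rgraph" where R: "rooted_tree R" "r = tree_class R" by (rule rtree_cases)
  have "card {v \<in> verts R. tree_class (graft R v S) = t} \<noteq> 0"
    using assms \<beta>_tree_class[OF R(1) S(1)] S(2) R(2) by simp
  then obtain v where v: "v \<in> verts R" "tree_class (graft R v S) = t"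
    by (metis (mono_tags, lifting) card.empty empty_Collect_eq)
  show ?thesis
  proof (cases "v = root R")
    case True
    then show ?thesis using root_graft_tree_class[OF S(1) R(1)] S(2) R(2) v(2) by simp
  next
    case False
    then show ?thesis using root_degree_graft[OF R(1) S(1) v(1)] R(2) v(2) by simp
  qed
qed

lemma ex_root_graft:
  assumes "tsize t \<ge> 2"
  obtains s r where "t = root_graft s r"
proof -
  obtain g :: "nat rgraph" where g: "rooted_tree g" "t = tree_class g" by (rule rtree_cases)
  have "verts g \<noteq> {root g}"
    using assms g by (auto simp: tsize_tree_class)
  then obtain w where w: "w \<in> verts g" "w \<noteq> root g" using rooted_tree_root[OF g(1)] by blast
  obtain x where "(root g, x) \<in> adj_of (edges g)"
    using rooted_tree_connected[OF g(1) w(1)] w(2) by (auto elim: converse_rtranclE)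
  then have e: "{root g, x} \<in> edges g" by (simp add: adj_of_iff)
  let ?R = "R_part g {root g, x}" and ?P = "P_part g {root g, x}"
  obtain a where a: "a \<in> R_verts g {root g, x}" "{root g, x} = {a, root ?P}"
    "giso (case_sum id id) (graft ?R a ?P) g"
    by (rule cut_regraft[OF g(1) e])
  obtain b where b: "root ?P \<in> verts g - R_verts g {root g, x}"
    by (rule P_part_root_edge[OF g(1) e])
  have "root g \<in> R_verts g {root g, x}" using rooted_tree_root[OF g(1)] by (simp add: R_verts_def)
  then have "a = root g" using a(2) b by (metis DiffD2 doubleton_eq_iff)
  then have root: "a = root ?R" by (simp add: R_part_root[OF g(1)])
  note R = rooted_tree_R_part[OF g(1), of "{root g, x}"] and P = rooted_tree_P_part[OF g(1) e]
  have "t = tree_class (graft ?R (root ?R) ?P)"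
    using tree_class_eqI[OF rooted_tree_graft[OF R P rooted_tree_root[OF R]]] a(3) root g(2) by metis
  then show thesis using that root_graft_tree_class[OF P R] by metis
qed

text \<open>
  An edge of \<open>r\<close> cuts off the same subtree from \<open>root_graft u r\<close> as from \<open>r\<close>, because \<open>u\<close> hangs at
  the root and stays with it; the joining edge cuts off \<open>u\<close>; and an edge of \<open>u\<close> cuts off a tree
  smaller than \<open>u\<close>, which the assumption on the sizes excludes.
\<close>

lemma \<alpha>_root_graft_cases:
  assumes nz: "\<alpha> t (root_graft u r) s \<noteq> 0" and size: "tsize t = tsize u"
  shows "t = u \<and> s = r \<or> (\<exists>s'. \<alpha> t r s' \<noteq> 0 \<and> s = root_graft u s')"
proof -
  obtain U :: "nat rgraph" where U: "rooted_tree U" "u = tree_class U" by (rule rtree_cases)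
  obtain R :: "nat rgraph" where R: "rooted_tree R" "r = tree_class R" by (rule rtree_cases)
  let ?G = "graft R (root R) U"
  note rt = rooted_tree_root[OF R(1)]
  note G = rooted_tree_graft[OF R(1) U(1) rt]
  have "card {e \<in> edges ?G. tree_class (R_part ?G e) = s \<and> tree_class (P_part ?G e) = t} \<noteq> 0"
    (is "card ?E \<noteq> 0") using nz unfolding U(2) R(2) root_graft_tree_class[OF U(1) R(1)] \<alpha>_tree_class[OF G] .
  then have "?E \<noteq> {}" by (metis card.empty)
  then obtain e where e: "e \<in> edges ?G" "tree_class (R_part ?G e) = s" "tree_class (P_part ?G e) = t"
    by blast
  consider (left) e' where "e' \<in> edges R" "e = Inl ` e'" | (right) e' where "e' \<in> edges U" "e = Inr ` e'"
    | (joint) "e = {Inl (root R), Inr (root U)}"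
    using e(1) unfolding graft_edge_iff by blast
  then show ?thesis
  proof cases
    case joint
    have "tree_class (R_part ?G e) = tree_class R" "tree_class (P_part ?G e) = tree_class U"
      unfolding joint
      by (rule tree_class_eqI[OF R(1) giso_graft_R_part[OF R(1) U(1) rt], symmetric],
          rule tree_class_eqI[OF U(1) giso_graft_P_part[OF R(1) U(1) rt], symmetric])
    then show ?thesis using e U(2) R(2) by simp
  next
    case left
    let ?A = "R_part R e'" and ?B = "P_part R e'"
    obtain a where a: "a \<in> R_verts R e'" "e' = {a, root ?B}" "giso (case_sum id id) (graft ?A a ?B) R"
      by (rule cut_regraft[OF R(1) left(1)])
    note A = rooted_tree_R_part[OF R(1), of e'] and B = rooted_tree_P_part[OF R(1) left(1)]
    \<comment> \<open>Grafting \<open>U\<close> at the root and \<open>?B\<close> at \<open>a\<close> commute, so the tree is also a graft along \<open>e\<close>.\<close>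
    let ?AU = "graft ?A (root ?A) U"
    note AU = rooted_tree_graft[OF A U(1) rooted_tree_root[OF A]]
    have aV: "Inl a \<in> verts ?AU" using a(1) by simp
    let ?h = "case_sum (case_sum Inl Inr) Inl"
    have ed: "{x, y} \<in> edges (graft ?A a ?B) \<longleftrightarrow> {case_sum id id x, case_sum id id y} \<in> edges R"
      if "x \<in> verts (graft ?A a ?B)" "y \<in> verts (graft ?A a ?B)" for x y
      using a(3) that unfolding giso_def by blast
    have edAA: "{x, y} \<in> edges ?A \<longleftrightarrow> {x, y} \<in> edges R"
      if "x \<in> R_verts R e'" "y \<in> R_verts R e'" for x y
      using ed[of "Inl x" "Inl y"] that by (simp add: graft_edges)
    have edBB: "{x, y} \<in> edges ?B \<longleftrightarrow> {x, y} \<in> edges R"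
      if "x \<in> verts R - R_verts R e'" "y \<in> verts R - R_verts R e'" for x y
      using ed[of "Inr x" "Inr y"] that by (simp add: graft_edges)
    have edAB: "{x, y} \<in> edges R \<longleftrightarrow> x = a \<and> y = root ?B"
      if "x \<in> R_verts R e'" "y \<in> verts R - R_verts R e'" for x y
      using ed[of "Inl x" "Inr y"] that by (simp add: graft_edges)
    have edBA: "{y, x} \<in> edges R \<longleftrightarrow> x = a \<and> y = root ?B"
      if "x \<in> R_verts R e'" "y \<in> verts R - R_verts R e'" for x y
      using edAB[OF that] by (simp add: insert_commute)
    have rootB: "root R \<in> R_verts R e'" using rt by (simp add: R_verts_def)
    have h: "giso ?h (graft ?AU (Inl a) ?B) ?G"
      unfolding giso_def
    proof (intro conjI ballI)
      show "bij_betw ?h (verts (graft ?AU (Inl a) ?B)) (verts ?G)"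
        unfolding bij_betw_def
      proof
        show "inj_on ?h (verts (graft ?AU (Inl a) ?B))"
          by (auto simp: inj_on_def)
        show "?h ` verts (graft ?AU (Inl a) ?B) = verts ?G"
          using R_verts_subset[of R e'] by (auto simp: image_Un image_image)
      qed
      show "?h (root (graft ?AU (Inl a) ?B)) = root ?G" by (simp add: R_part_root[OF R(1)])
      show "{x, y} \<in> edges (graft ?AU (Inl a) ?B) \<longleftrightarrow> {?h x, ?h y} \<in> edges ?G"
        if x: "x \<in> verts (graft ?AU (Inl a) ?B)" and y: "y \<in> verts (graft ?AU (Inl a) ?B)" for x y
        using x y rootB
        by (cases x; cases y)
          (auto simp: graft_edges edAA edBB edAB edBA R_part_root[OF R(1)] split: sum.splits)
    qed
    have "e = {?h (Inl (Inl a)), ?h (Inr (root ?B))}" using left(2) a(2) by auto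
    then have gi: "giso (?h \<circ> Inl) ?AU (R_part ?G e)" "giso (?h \<circ> Inr) ?B (P_part ?G e)"
      using parts_of_graft(2,3)[OF AU B aV G h] by (simp_all only:)
    have "s = tree_class ?AU" "t = tree_class ?B"
      by (rule trans[OF e(2)[symmetric] tree_class_eqI[OF AU gi(1), symmetric]],
          rule trans[OF e(3)[symmetric] tree_class_eqI[OF B gi(2), symmetric]])
    moreover have "tree_class ?AU = root_graft u (tree_class ?A)"
      using root_graft_tree_class[OF U(1) A] U(2) by simp
    moreover have "\<alpha> (tree_class ?B) r (tree_class ?A) \<noteq> 0"
    proof -
      have "finite (edges R)"
      proof (rule finite_subset)
        show "edges R \<subseteq> Pow (verts R)" using edges_subset[OF R(1)] by blast
      qed (use R(1) in \<open>simp add: rooted_tree_def\<close>)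
      then show ?thesis
        using left(1) \<alpha>_tree_class[OF R(1)] R(2) by (auto simp: card_eq_0_iff)
    qed
    ultimately show ?thesis by blast
  next
    case right
    have sub: "verts (P_part ?G e) \<subseteq> Inr ` (verts U - {root U})"
    proof
      let ?r = "adj_of (edges ?G - {e})"
      fix x assume "x \<in> verts (P_part ?G e)"
      then have x: "x \<in> verts ?G" "x \<notin> R_verts ?G e" by simp_all
      have lr: "(Inl (root R), Inl y) \<in> ?r\<^sup>*" if "y \<in> verts R" for y
        using rooted_tree_connected[OF R(1) that]
      proof (rule rtrancl_mono_map)
        fix c d assume "(c, d) \<in> adj_of (edges R)"
        then have "(Inl c, Inl d) \<in> ?r"
          using right(2) by (auto simp: adj_of_iff graft_edges)
        then show "(Inl c, Inl d) \<in> ?r\<^sup>*" by simp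
      qed
      have "x \<noteq> Inl y" for y using lr[of y] x by (auto simp: R_verts_def)
      moreover have "(Inl (root R), Inr (root U)) \<in> ?r"
        using right(2) by (auto simp: adj_of_iff graft_edges)
      then have "x \<noteq> Inr (root U)" using x by (auto simp: R_verts_def)
      ultimately show "x \<in> Inr ` (verts U - {root U})" using x(1) by auto
    qed
    have fin: "finite (verts U)" using U(1) by (simp add: rooted_tree_def)
    have "card (verts (P_part ?G e)) \<le> card (Inr ` (verts U - {root U}) :: (nat + nat) set)"
      by (rule card_mono[OF _ sub]) (simp add: fin)
    also have "\<dots> = card (verts U - {root U})" by (simp add: card_image)
    also have "\<dots> < card (verts U)"
      using rooted_tree_root[OF U(1)] fin by (intro psubset_card_mono) auto
    finally have "tsize t < tsize u"
      using tsize_tree_class[OF rooted_tree_P_part[OF G e(1)]] tsize_tree_class[OF U(1)] e(3) U(2)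
      by simp
    then show ?thesis using size by simp
  qed
qed

definition one_vertex_tree :: rtree where
  "one_vertex_tree = tree_class (\<lparr>verts = {0}, edges = {}, root = 0\<rparr> :: nat rgraph)"

lemma tsize_eq_1_iff: "tsize t = 1 \<longleftrightarrow> t = one_vertex_tree"
proof
  have "tsize one_vertex_tree = 1"
    unfolding one_vertex_tree_def tsize_tree_class[OF rooted_tree_single] by simp
  then show "t = one_vertex_tree \<Longrightarrow> tsize t = 1" by simp
next
  assume size: "tsize t = 1"
  obtain g :: "nat rgraph" where g: "rooted_tree g" "t = tree_class g" by (rule rtree_cases)
  have "card (verts g) = 1" using size g by (simp add: tsize_tree_class)
  then have V: "verts g = {root g}"
    using rooted_tree_root[OF g(1)] by (metis card_1_singletonE singletonD)
  have "{root g, root g} \<notin> edges g" using rooted_tree_no_loop[OF g(1)] by blast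
  then have "giso (\<lambda>_. 0) g (\<lparr>verts = {0}, edges = {}, root = 0\<rparr> :: nat rgraph)"
    unfolding giso_def bij_betw_def by (subst (1 2 3 4) V) simp
  then show "t = one_vertex_tree"
    unfolding g(2) one_vertex_tree_def by (rule tree_class_eqI[OF g(1)])
qed

lemma tsize_one_vertex_tree [simp]: "tsize one_vertex_tree = 1"
  by (simp only: tsize_eq_1_iff)

primrec bouquet :: "rtree \<Rightarrow> nat \<Rightarrow> rtree" where
  "bouquet t 0 = one_vertex_tree"
| "bouquet t (Suc k) = root_graft t (bouquet t k)"

lemma root_degree_bouquet: "root_degree (bouquet t k) = k"
proof (induction k)
  case 0
  then show ?case using root_degree_less_tsize[of one_vertex_tree] by simp
qed (simp add: root_degree_root_graft)

text \<open>
  By induction on the number of copies, because an edge cutting off a subtree of the size of \<open>t\<close> is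
  either the one that joins the last copy or an edge of the remaining bouquet. This plays the role of
  cancellation by a variable in a polynomial ring.
\<close>

lemma \<alpha>_bouquet:
  assumes "\<alpha> s (bouquet t (Suc k)) r \<noteq> 0" "tsize s = tsize t"
  shows "s = t \<and> r = bouquet t k"
  using assms(1)
proof (induction k arbitrary: r)
  case 0
  have "\<alpha> s one_vertex_tree r' = 0" for r'
    using \<alpha>_size[of s one_vertex_tree r'] tsize_pos[of s] tsize_pos[of r'] by fastforce
  then show ?case
    using \<alpha>_root_graft_cases[of s t one_vertex_tree r] 0 assms(2) by simp
next
  case (Suc k)
  then consider "s = t \<and> r = bouquet t (Suc k)"
    | r' where "\<alpha> s (bouquet t (Suc k)) r' \<noteq> 0" "r = root_graft t r'"
    using \<alpha>_root_graft_cases[of s t "bouquet t (Suc k)" r] assms(2) by auto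
  then show ?case
  proof cases
    case 2
    then show ?thesis using Suc.IH[of r'] by simp
  qed simp
qed

text \<open>
  A tree \<open>t\<close> with more than one vertex is \<open>root_graft s r\<close>, and every other tree obtained by joining \<open>s\<close>
  to a vertex of \<open>r\<close> has smaller root degree than \<open>t\<close>. Hence the equation for \<open>s\<close> and \<open>r\<close>
  determines \<open>u t\<close> from the values of \<open>u\<close> at trees of smaller root degree.
\<close>

lemma \<alpha>_nondegenerate:
  fixes u :: "rtree \<Rightarrow> complex"
  assumes "n \<ge> 2"
    and eq: "\<And>s r. tsize s + tsize r = n \<Longrightarrow> (\<Sum>t | tsize t = n. u t * of_nat (\<alpha> s t r)) = 0"
    and "tsize t = n"
  shows "u t = 0"
  using \<open>tsize t = n\<close>
proof (induction "root_degree t" arbitrary: t rule: less_induct)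
  case less
  obtain s r where t: "t = root_graft s r" using ex_root_graft[of t] less.prems assms(1) by auto
  have fin: "finite {t. tsize t = n}" by (rule finite_subset[OF _ finite_tsize_le[of n]]) auto
  have other: "u t' * of_nat (\<alpha> s t' r) = 0" if t': "tsize t' = n" "t' \<noteq> t" for t'
  proof (cases "\<alpha> s t' r = 0")
    case False
    then have "root_degree t' < root_degree t"
      using \<beta>_nonzero_cases[of t' s r] t'(2) \<alpha>_nonzero_iff root_degree_root_graft[of s r] t by auto
    then show ?thesis using less.hyps t'(1) by simp
  qed simp
  have "0 = (\<Sum>t | tsize t = n. u t * of_nat (\<alpha> s t r))"
    using eq[of s r] tsize_root_graft[of s r] less.prems t by simp
  also have "\<dots> = u t * of_nat (\<alpha> s t r)"
  proof -
    have "(\<Sum>t | tsize t = n. u t * of_nat (\<alpha> s t r)) =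
        (\<Sum>t' | tsize t' = n. if t' = t then u t * of_nat (\<alpha> s t r) else 0)"
      by (rule sum.cong) (use other in \<open>auto split del: if_split split: if_splits\<close>)
    then show ?thesis using fin less.prems by simp
  qed
  finally have "u t * of_nat (\<alpha> s t r) = 0" by simp
  moreover have "\<alpha> s t r \<noteq> 0" unfolding t \<alpha>_nonzero_iff by (rule \<beta>_root_graft_nonzero)
  ultimately show "u t = 0" by simp
qed

section \<open>Coefficients of the bracket\<close>

abbreviation coeff :: "ie_alg \<Rightarrow> ie_basis \<Rightarrow> complex" where
  "coeff \<equiv> Poly_Mapping.lookup"

abbreviation bvec :: "ie_basis \<Rightarrow> ie_alg" where
  "bvec b \<equiv> Poly_Mapping.single b 1"

lemma bvec_simps: "D0 = bvec Bd" "Dplus t = bvec (Bplus t)" "Dminus t = bvec (Bminus t)"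
  by (simp_all add: D0_def Dplus_def Dminus_def)

lemma coeff_bvec: "coeff (bvec a) b = (if a = b then 1 else 0)"
  by (simp add: lookup_single when_def)

lemma coeff_lin_ext_superset:
  assumes "finite A" "Poly_Mapping.keys x \<subseteq> A"
  shows "coeff (lin_ext f x) c = (\<Sum>b\<in>A. coeff x b * coeff (f b) c)"
  unfolding lin_ext_def lookup_sum lookup_smult
  by (rule sum.mono_neutral_left[OF assms]) (auto simp: in_keys_iff)

lemmas coeff_lin_ext = coeff_lin_ext_superset[OF finite_keys order_refl]

lemma lin_ext_bvec: "lin_ext f (bvec b) = f b"
  by (rule poly_mapping_eqI) (simp add: coeff_lin_ext)

lemma smult_simps [simp]: "smult 0 x = 0" "smult 1 x = x" "smult a (smult b x) = smult (a * b) x"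
  "smult a 0 = 0"
  by (auto intro!: poly_mapping_eqI)

lemma linear_smult_iff:
  "Vector_Spaces.linear smult smult f \<longleftrightarrow>
    (\<forall>x y. f (x + y) = f x + f y) \<and> (\<forall>c x. f (smult c x) = smult c (f x))"
  using vector_space_smult by (simp add: Vector_Spaces.linear_iff)

lemma linear_lin_ext: "Vector_Spaces.linear smult smult (lin_ext f)"
  unfolding linear_smult_iff
proof (intro conjI allI poly_mapping_eqI)
  fix x y :: ie_alg and c
  let ?A = "Poly_Mapping.keys x \<union> Poly_Mapping.keys y"
  show "coeff (lin_ext f (x + y)) c = coeff (lin_ext f x + lin_ext f y) c"
    using keys_add[of x y]
    by (simp add: lookup_add coeff_lin_ext_superset[of ?A] sum.distrib algebra_simps)
next
  fix a and x :: ie_alg and c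
  have "Poly_Mapping.keys (smult a x) \<subseteq> Poly_Mapping.keys x" by (auto simp: in_keys_iff)
  then show "coeff (lin_ext f (smult a x)) c = coeff (smult a (lin_ext f x)) c"
    by (simp add: coeff_lin_ext_superset[of "Poly_Mapping.keys x"] sum_distrib_left algebra_simps)
qed

lemma linear_eq_lin_ext:
  assumes "Vector_Spaces.linear smult smult f"
  shows "f x = lin_ext (\<lambda>b. f (bvec b)) x"
proof -
  have add: "f (x + y) = f x + f y" and scale: "f (smult c x) = smult c (f x)" for x y c
    using assms by (auto simp: linear_smult_iff)
  have zero: "f 0 = 0" using scale[of 0 0] by simp
  have fsum: "f (sum g A) = (\<Sum>b\<in>A. f (g b))" if "finite A" for g :: "ie_basis \<Rightarrow> _" and A
    using that by (induction A rule: finite_induct) (simp_all add: add zero)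
  have "x = (\<Sum>b\<in>Poly_Mapping.keys x. smult (coeff x b) (bvec b))"
  proof (rule poly_mapping_eqI)
    fix c
    show "coeff x c = coeff (\<Sum>b\<in>Poly_Mapping.keys x. smult (coeff x b) (bvec b)) c"
      by (simp add: lookup_sum coeff_bvec if_distrib[of "(*) _"] in_keys_iff cong: if_cong)
  qed
  then have "f x = f (\<Sum>b\<in>Poly_Mapping.keys x. smult (coeff x b) (bvec b))" by simp
  also have "\<dots> = lin_ext (\<lambda>b. f (bvec b)) x"
    by (simp add: fsum lin_ext_def scale)
  finally show ?thesis .
qed

lemma coeff_bracket_superset:
  assumes "finite A" "Poly_Mapping.keys x \<subseteq> A" "finite B" "Poly_Mapping.keys y \<subseteq> B"
  shows "coeff (bracket x y) c =
    (\<Sum>a\<in>A. \<Sum>b\<in>B. coeff x a * coeff y b * coeff (basis_bracket a b) c)"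
  unfolding bracket_def coeff_lin_ext_superset[OF assms(1,2)] coeff_lin_ext_superset[OF assms(3,4)]
  by (simp add: sum_distrib_left mult.assoc)

lemmas coeff_bracket = coeff_bracket_superset[OF finite_keys order_refl finite_keys order_refl]

lemma bracket_bvec: "bracket (bvec a) (bvec b) = basis_bracket a b"
  by (simp add: bracket_def lin_ext_bvec)

lemma linear_bracket: "Vector_Spaces.linear smult smult (bracket x)"
  unfolding linear_smult_iff
proof (intro conjI allI poly_mapping_eqI)
  fix y z :: ie_alg and c
  let ?B = "Poly_Mapping.keys y \<union> Poly_Mapping.keys z"
  show "coeff (bracket x (y + z)) c = coeff (bracket x y + bracket x z) c"
    using keys_add[of y z]
    by (simp add: lookup_add coeff_bracket_superset[of "Poly_Mapping.keys x" _ ?B] sum.distrib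
        algebra_simps)
next
  fix k and y :: ie_alg and c
  have "Poly_Mapping.keys (smult k y) \<subseteq> Poly_Mapping.keys y" by (auto simp: in_keys_iff)
  then show "coeff (bracket x (smult k y)) c = coeff (smult k (bracket x y)) c"
    by (simp add: coeff_bracket_superset[of "Poly_Mapping.keys x" _ "Poly_Mapping.keys y"]
        sum_distrib_left algebra_simps)
qed

lemma bracket_smult_left: "bracket (smult k x) y = smult k (bracket x y)"
  using linear_lin_ext[of "\<lambda>a. lin_ext (basis_bracket a) y"]
  unfolding bracket_def linear_smult_iff by simp

lemma ex_keys_bracket:
  assumes "coeff (bracket x y) c \<noteq> 0"
  obtains a b where "coeff x a \<noteq> 0" "coeff y b \<noteq> 0" "coeff (basis_bracket a b) c \<noteq> 0"
proof -
  obtain a b where "coeff x a * coeff y b * coeff (basis_bracket a b) c \<noteq> 0"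
    using assms unfolding coeff_bracket by (meson sum.neutral)
  then show thesis using that by auto
qed

lemma finite_\<beta>_difference:
  "finite {r. (of_nat (\<beta> r s t) - of_nat (\<beta> r t s) :: complex) \<noteq> 0}"
  by (rule finite_subset[OF _ finite_UnI[OF finite_\<beta>(2)[of s t] finite_\<beta>(2)[of t s]]]) auto

lemma finite_\<alpha>_difference:
  "finite {r. (of_nat (\<alpha> t r s) - of_nat (\<alpha> s r t) :: complex) \<noteq> 0}"
  by (rule finite_subset[OF _ finite_UnI[OF finite_\<alpha>(2)[of t s] finite_\<alpha>(2)[of s t]]]) auto

lemma coeff_Sum_any_bvec:
  assumes "finite {r. k r \<noteq> 0}" "inj B"
  shows "coeff (Sum_any (\<lambda>r. smult (k r) (bvec (B r)))) (B r) = k r"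
    and "c \<notin> range B \<Longrightarrow> coeff (Sum_any (\<lambda>r. smult (k r) (bvec (B r)))) c = 0"
proof -
  have nz: "{r. smult (k r) (bvec (B r)) \<noteq> 0} \<subseteq> {r. k r \<noteq> 0}" by auto
  have expand: "coeff (Sum_any (\<lambda>r. smult (k r) (bvec (B r)))) c =
      (\<Sum>r | k r \<noteq> 0. k r * coeff (bvec (B r)) c)" for c
    unfolding Sum_any.expand_superset[OF assms(1) nz] lookup_sum lookup_smult ..
  have "(\<Sum>r' | k r' \<noteq> 0. k r' * coeff (bvec (B r')) (B r)) =
      (\<Sum>r' | k r' \<noteq> 0. if r' = r then k r' else 0)"
    using assms(2) by (intro sum.cong) (auto simp: coeff_bvec dest: injD)
  also have "\<dots> = k r" using assms(1) by simp
  finally show "coeff (Sum_any (\<lambda>r. smult (k r) (bvec (B r)))) (B r) = k r" unfolding expand .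
  show "coeff (Sum_any (\<lambda>r. smult (k r) (bvec (B r)))) c = 0" if "c \<notin> range B"
    unfolding expand using that by (intro sum.neutral) (auto simp: coeff_bvec)
qed

lemma inj_Bplus: "inj Bplus" and inj_Bminus: "inj Bminus"
  by (auto intro: injI)

lemma coeff_plus_plus [simp]:
  "coeff (basis_bracket (Bplus s) (Bplus t)) (Bplus r) = of_nat (\<beta> r s t) - of_nat (\<beta> r t s)"
  "coeff (basis_bracket (Bplus s) (Bplus t)) (Bminus r) = 0"
  "coeff (basis_bracket (Bplus s) (Bplus t)) Bd = 0"
  using coeff_Sum_any_bvec[OF finite_\<beta>_difference[of s t] inj_Bplus]
  by (auto simp: bvec_simps)

lemma coeff_minus_minus [simp]:
  "coeff (basis_bracket (Bminus s) (Bminus t)) (Bminus r) = of_nat (\<alpha> t r s) - of_nat (\<alpha> s r t)"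
  "coeff (basis_bracket (Bminus s) (Bminus t)) (Bplus r) = 0"
  "coeff (basis_bracket (Bminus s) (Bminus t)) Bd = 0"
  using coeff_Sum_any_bvec[OF finite_\<alpha>_difference[of t s] inj_Bminus]
  by (auto simp: bvec_simps)

lemma \<alpha>_same [simp]: "\<alpha> t t r = 0" and \<beta>_same [simp]: "\<beta> t t r = 0"
  using \<alpha>_size[of t t r] \<beta>_size[of t t r] tsize_pos[of r] by auto

lemma coeff_bracket_mp [simp]:
  "coeff (bracket_mp s t) (Bplus r) = of_nat (\<alpha> s t r)"
  "coeff (bracket_mp s t) (Bminus r) = of_nat (\<beta> s t r)"
  "coeff (bracket_mp s t) Bd = (if s = t then 1 else 0)"
proof -
  have fa: "finite {r. (of_nat (\<alpha> s t r) :: complex) \<noteq> 0}" using finite_\<alpha>(1)[of s t] by simp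
  have fb: "finite {r. (of_nat (\<beta> s t r) :: complex) \<noteq> 0}" using finite_\<beta>(1)[of s t] by simp
  note a = coeff_Sum_any_bvec[OF fa inj_Bplus] and b = coeff_Sum_any_bvec[OF fb inj_Bminus]
  show "coeff (bracket_mp s t) (Bplus r) = of_nat (\<alpha> s t r)"
    using a(1)[of r] b(2)[of "Bplus r"]
    by (auto simp: bracket_mp_def bvec_simps coeff_bvec lookup_add)
  show "coeff (bracket_mp s t) (Bminus r) = of_nat (\<beta> s t r)"
    using b(1)[of r] a(2)[of "Bminus r"]
    by (auto simp: bracket_mp_def bvec_simps coeff_bvec lookup_add)
  have "Bd \<notin> range Bplus" "Bd \<notin> range Bminus" by blast+
  then show "coeff (bracket_mp s t) Bd = (if s = t then 1 else 0)"
    using b(2)[of Bd] a(2)[of Bd]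
    by (auto simp: bracket_mp_def bvec_simps coeff_bvec lookup_add)
qed

declare basis_bracket.simps(1,2) [simp del]

section \<open>Grading and monomial maps\<close>

fun deg :: "ie_basis \<Rightarrow> int" where
  "deg Bd = 0"
| "deg (Bplus t) = int (tsize t)"
| "deg (Bminus t) = - int (tsize t)"

text \<open>
  The bracket is graded because \<open>\<alpha>\<close> and \<open>\<beta>\<close> vanish unless the sizes of the parts add up.
\<close>

lemma deg_basis_bracket:
  assumes "coeff (basis_bracket a b) c \<noteq> 0"
  shows "deg c = deg a + deg b"
proof -
  have \<alpha>: "int (tsize t) = int (tsize s) + int (tsize r)" if "0 < \<alpha> s t r" for s t r
    using \<alpha>_size[of s t r] that by simp
  have \<beta>: "int (tsize t) = int (tsize s) + int (tsize r)" if "0 < \<beta> t s r" for s t r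
    using \<beta>_size[of t s r] that by simp
  have \<alpha>': "int (tsize r) = int (tsize s) + int (tsize t)" if "\<alpha> t r s \<noteq> \<alpha> s r t" for s t r
    using \<alpha>[of t r s] \<alpha>[of s r t] that by linarith
  have \<beta>': "int (tsize r) = int (tsize s) + int (tsize t)" if "\<beta> r s t \<noteq> \<beta> r t s" for s t r
    using \<beta>[of r s t] \<beta>[of r t s] that by linarith
  show ?thesis
  proof (cases a)
    case a: Bd
    show ?thesis
      using assms a by (cases b) (auto simp: bvec_simps coeff_bvec split: if_splits)
  next
    case a: (Bplus s)
    show ?thesis
    proof (cases b)
      case b: (Bplus t)
      show ?thesis using assms a b \<beta>'[of _ s t] by (cases c) auto
    next
      case b: (Bminus t)
      show ?thesis
        using assms a b \<alpha>[of t s] \<beta>[of t s] by (cases c) (auto split: if_splits)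
    qed (use assms a in \<open>auto simp: bvec_simps coeff_bvec split: if_splits\<close>)
  next
    case a: (Bminus s)
    show ?thesis
    proof (cases b)
      case b: (Bminus t)
      show ?thesis using assms a b \<alpha>'[of t _ s] by (cases c) auto
    next
      case b: (Bplus t)
      show ?thesis
        using assms a b \<alpha>[of s t] \<beta>[of s t] by (cases c) (auto split: if_splits)
    qed (use assms a in \<open>auto simp: bvec_simps coeff_bvec split: if_splits\<close>)
  qed
qed

lemma coeff_D0_bracket: "coeff (bracket D0 x) c = of_int (deg c) * coeff x c"
proof -
  have b: "coeff (basis_bracket Bd b) c = (if b = c then of_int (deg c) else 0)" for b
    by (cases b) (auto simp: bvec_simps coeff_bvec)
  let ?B = "insert c (Poly_Mapping.keys x)"
  have "coeff (bracket D0 x) c =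
      (\<Sum>a\<in>{Bd}. \<Sum>b\<in>?B. coeff (bvec Bd) a * coeff x b * coeff (basis_bracket a b) c)"
    unfolding bvec_simps by (rule coeff_bracket_superset) auto
  also have "\<dots> = (\<Sum>b\<in>?B. if b = c then of_int (deg c) * coeff x c else 0)"
    by (simp only: sum.insert sum.empty finite.emptyI empty_iff not_False_eq_True add_0_right)
      (rule sum.cong, auto simp: b coeff_bvec)
  also have "\<dots> = of_int (deg c) * coeff x c" by simp
  finally show ?thesis .
qed

text \<open>
  Both \<open>\<tau> \<zeta>\<close> and \<open>\<tau>\<^sub>0\<close> permute the basis by an involution up to nonzero scalars. For such a map,
  being an automorphism is a condition on the structure constants, one triple of basis vectors at a
  time.
\<close>

definition monomial_map :: "(ie_basis \<Rightarrow> complex) \<Rightarrow> (ie_basis \<Rightarrow> ie_basis) \<Rightarrow> ie_alg \<Rightarrow> ie_alg" where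
  "monomial_map w p = lin_ext (\<lambda>b. smult (w b) (bvec (p b)))"

lemma coeff_monomial_map:
  assumes "\<And>b. p (p b) = b"
  shows "coeff (monomial_map w p x) c = w (p c) * coeff x (p c)"
proof -
  have "coeff (bvec (p b)) c = (if b = p c then 1 else 0)" for b
    using assms by (auto simp: coeff_bvec)
  then have "coeff (monomial_map w p x) c =
      (\<Sum>b\<in>Poly_Mapping.keys x. if b = p c then w (p c) * coeff x (p c) else 0)"
    unfolding monomial_map_def coeff_lin_ext lookup_smult by (intro sum.cong) auto
  then show ?thesis by (simp add: in_keys_iff)
qed

lemma monomial_map_automorphism:
  assumes inv: "\<And>b. p (p b) = b" and nz: "\<And>b. w b \<noteq> 0"
    and compat: "\<And>a b c. w c * coeff (basis_bracket a b) c =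
      w a * w b * coeff (basis_bracket (p a) (p b)) (p c)"
  shows "ie_automorphism (monomial_map w p)"
  unfolding ie_automorphism_def
proof (intro conjI allI)
  let ?f = "monomial_map w p"
  note c = coeff_monomial_map[of p, OF inv]
  show "Vector_Spaces.linear smult smult ?f"
    unfolding monomial_map_def by (rule linear_lin_ext)
  have "?f (monomial_map (\<lambda>b. inverse (w (p b))) p x) = x"
    "monomial_map (\<lambda>b. inverse (w (p b))) p (?f x) = x" for x
    by (rule poly_mapping_eqI; simp add: c inv nz)+
  then show "bij ?f" by (intro o_bij[of "monomial_map (\<lambda>b. inverse (w (p b))) p"] ext) simp_all
  fix x y
  have inj: "inj_on p A" for A using inv by (metis inj_onI)
  have keys: "Poly_Mapping.keys (?f x) \<subseteq> p ` Poly_Mapping.keys x" for x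
  proof
    fix d assume "d \<in> Poly_Mapping.keys (?f x)"
    then have "p d \<in> Poly_Mapping.keys x" by (simp add: in_keys_iff c)
    then show "d \<in> p ` Poly_Mapping.keys x" using inv by (metis imageI)
  qed
  show "?f (bracket x y) = bracket (?f x) (?f y)"
  proof (rule poly_mapping_eqI)
    fix d
    have "coeff (bracket (?f x) (?f y)) d = (\<Sum>a\<in>Poly_Mapping.keys x. \<Sum>b\<in>Poly_Mapping.keys y.
        w a * coeff x a * (w b * coeff y b) * coeff (basis_bracket (p a) (p b)) d)"
      by (simp add: coeff_bracket_superset[OF _ keys _ keys] sum.reindex[OF inj] c inv)
    also have "\<dots> = (\<Sum>a\<in>Poly_Mapping.keys x. \<Sum>b\<in>Poly_Mapping.keys y.
        w (p d) * (coeff x a * coeff y b * coeff (basis_bracket a b) (p d)))"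
      using compat[of "p d"] by (intro sum.cong refl) (simp add: inv algebra_simps)
    also have "\<dots> = coeff (?f (bracket x y)) d"
      by (simp add: c coeff_bracket sum_distrib_left)
    finally show "coeff (?f (bracket x y)) d = coeff (bracket (?f x) (?f y)) d" ..
  qed
qed

lemma \<tau>_monomial: "\<tau> \<zeta> = monomial_map (\<lambda>b. \<zeta> powi deg b) id"
  unfolding \<tau>_def monomial_map_def
  by (intro arg_cong[of _ _ lin_ext] ext) (auto simp: bvec_simps split: ie_basis.splits)

lemma coeff_\<tau>: "coeff (\<tau> \<zeta> x) c = \<zeta> powi deg c * coeff x c"
  by (simp add: \<tau>_monomial coeff_monomial_map)

lemma \<tau>_automorphism:
  assumes "\<zeta> \<noteq> 0"
  shows "ie_automorphism (\<tau> \<zeta>)"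
  unfolding \<tau>_monomial
proof (rule monomial_map_automorphism)
  fix a b c
  show "\<zeta> powi deg c * coeff (basis_bracket a b) c =
      \<zeta> powi deg a * \<zeta> powi deg b * coeff (basis_bracket (id a) (id b)) (id c)"
    using deg_basis_bracket[of a b c] assms
    by (cases "coeff (basis_bracket a b) c = 0") (simp_all add: power_int_add)
qed (use assms in auto)

fun flip :: "ie_basis \<Rightarrow> ie_basis" where
  "flip Bd = Bd"
| "flip (Bplus t) = Bminus t"
| "flip (Bminus t) = Bplus t"

fun flip_weight :: "ie_basis \<Rightarrow> complex" where
  "flip_weight Bd = - 1"
| "flip_weight (Bplus t) = - of_nat (aut_count t)"
| "flip_weight (Bminus t) = - inverse (of_nat (aut_count t))"

lemma flip_flip [simp]: "flip (flip b) = b"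
  by (cases b) auto

lemma deg_flip [simp]: "deg (flip b) = - deg b"
  by (cases b) auto

lemma aut_count_nonzero [simp]: "aut_count t \<noteq> 0"
  using aut_count_pos[of t] by simp

lemma flip_weight_nonzero [simp]: "flip_weight b \<noteq> 0"
  by (cases b) auto

lemma flip_weight_flip [simp]: "flip_weight b * flip_weight (flip b) = 1"
  by (cases b) auto

lemma \<tau>\<^sub>0_monomial: "\<tau>\<^sub>0 = monomial_map flip_weight flip"
proof (intro ext poly_mapping_eqI)
  fix x c
  have \<sigma>: "\<sigma> = monomial_map (\<lambda>b. - flip_weight b) flip"
    unfolding \<sigma>_def monomial_map_def
    by (intro arg_cong[of _ _ lin_ext] ext) (auto simp: bvec_simps split: ie_basis.splits)
  show "coeff (\<tau>\<^sub>0 x) c = coeff (monomial_map flip_weight flip x) c"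
    by (simp add: \<tau>\<^sub>0_def \<sigma> coeff_monomial_map[of flip, OF flip_flip])
qed

lemma coeff_\<tau>\<^sub>0: "coeff (\<tau>\<^sub>0 x) c = flip_weight (flip c) * coeff x (flip c)"
  by (simp add: \<tau>\<^sub>0_monomial coeff_monomial_map[of flip, OF flip_flip])

lemma \<alpha>_eq_\<beta>_quotient:
  "(of_nat (\<alpha> s t r) :: complex) =
    of_nat (\<beta> t s r) * of_nat (aut_count t) / (of_nat (aut_count s) * of_nat (aut_count r))"
proof -
  have "(of_nat (\<alpha> s t r) :: complex) * (of_nat (aut_count s) * of_nat (aut_count r)) =
      of_nat (\<beta> t s r) * of_nat (aut_count t)"
    using \<alpha>_\<beta>_aut_count[of s t r] by (metis of_nat_mult)
  then show ?thesis by (simp add: field_simps)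
qed

text \<open>
  Each structure constant \<open>\<alpha>\<close> is rewritten as \<open>\<beta>\<close> times a quotient of automorphism counts, and the
  weights of \<open>flip\<close> are made to cancel these quotients. The sign of the weights turns the
  anti-involution \<open>\<sigma>\<close> into an automorphism.
\<close>

lemma \<tau>\<^sub>0_automorphism: "ie_automorphism \<tau>\<^sub>0"
  unfolding \<tau>\<^sub>0_monomial
proof (rule monomial_map_automorphism)
  fix a b c
  show "flip_weight c * coeff (basis_bracket a b) c =
      flip_weight a * flip_weight b * coeff (basis_bracket (flip a) (flip b)) (flip c)"
    by (cases a; cases b; cases c)
      (auto simp: bvec_simps coeff_bvec \<alpha>_eq_\<beta>_quotient field_simps)
qed auto

section \<open>Elementary properties of automorphisms\<close>

lemma automorphism_linear: "ie_automorphism f \<Longrightarrow> Vector_Spaces.linear smult smult f"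
  and automorphism_bij: "ie_automorphism f \<Longrightarrow> bij f"
  and automorphism_bracket: "ie_automorphism f \<Longrightarrow> f (bracket x y) = bracket (f x) (f y)"
  by (simp_all add: ie_automorphism_def)

lemma automorphism_add: "ie_automorphism f \<Longrightarrow> f (x + y) = f x + f y"
  and automorphism_smult: "ie_automorphism f \<Longrightarrow> f (smult c x) = smult c (f x)"
  by (simp_all add: ie_automorphism_def linear_smult_iff)

lemma automorphism_zero: "ie_automorphism f \<Longrightarrow> f 0 = 0"
  using automorphism_smult[of f 0 0] by simp

lemma automorphism_nonzero: "ie_automorphism f \<Longrightarrow> x \<noteq> 0 \<Longrightarrow> f x \<noteq> 0"
  using automorphism_zero automorphism_bij by (metis bij_pointE)

lemma automorphism_comp:
  assumes "ie_automorphism f" "ie_automorphism g"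
  shows "ie_automorphism (f \<circ> g)"
  using assms bij_comp[of g f] unfolding ie_automorphism_def linear_smult_iff by simp

lemma automorphism_inv:
  assumes f: "ie_automorphism f"
  shows "ie_automorphism (inv_into UNIV f)"
proof -
  have l: "inv_into UNIV f (f x) = x" and r: "f (inv_into UNIV f x) = x" for x
    using automorphism_bij[OF f] by (simp_all add: bij_is_inj bij_is_surj surj_f_inv_f)
  have "inv_into UNIV f (x + y) = inv_into UNIV f x + inv_into UNIV f y" for x y
    using l[of "inv_into UNIV f x + inv_into UNIV f y"] automorphism_add[OF f] by (simp add: r)
  moreover have "inv_into UNIV f (smult c x) = smult c (inv_into UNIV f x)" for c x
    using l[of "smult c (inv_into UNIV f x)"] automorphism_smult[OF f] by (simp add: r)
  moreover have "inv_into UNIV f (bracket x y) = bracket (inv_into UNIV f x) (inv_into UNIV f y)" for x y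
    using l[of "bracket (inv_into UNIV f x) (inv_into UNIV f y)"] automorphism_bracket[OF f] by (simp add: r)
  ultimately show ?thesis
    using bij_imp_bij_inv[OF automorphism_bij[OF f]]
    unfolding ie_automorphism_def linear_smult_iff by simp
qed

lemma \<tau>_comp: "\<tau> a \<circ> \<tau> b = \<tau> (a * b)"
  by (intro ext poly_mapping_eqI) (simp add: coeff_\<tau> power_int_mult_distrib)

lemma \<tau>_1: "\<tau> 1 = id"
  by (intro ext poly_mapping_eqI) (simp add: coeff_\<tau>)

lemma \<tau>\<^sub>0_involution: "\<tau>\<^sub>0 \<circ> \<tau>\<^sub>0 = id"
proof (intro ext poly_mapping_eqI)
  fix x c
  show "coeff ((\<tau>\<^sub>0 \<circ> \<tau>\<^sub>0) x) c = coeff (id x) c"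
    using flip_weight_flip[of c] by (simp add: coeff_\<tau>\<^sub>0 mult.commute[of "flip_weight (flip c)"]
        mult.assoc[symmetric] del: flip_weight_flip)
qed

lemma \<tau>\<^sub>0_\<tau>\<^sub>0: "\<tau>\<^sub>0 (\<tau>\<^sub>0 x) = x"
  using \<tau>\<^sub>0_involution by (metis comp_apply id_apply)

lemma \<tau>\<^sub>0_\<tau>_\<tau>\<^sub>0: "\<tau>\<^sub>0 \<circ> \<tau> \<zeta> \<circ> \<tau>\<^sub>0 = \<tau> (inverse \<zeta>)"
proof (intro ext poly_mapping_eqI)
  fix x c
  have "coeff ((\<tau>\<^sub>0 \<circ> \<tau> \<zeta> \<circ> \<tau>\<^sub>0) x) c =
      (flip_weight c * flip_weight (flip c)) * (\<zeta> powi (- deg c) * coeff x c)"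
    by (simp add: coeff_\<tau>\<^sub>0 coeff_\<tau> del: flip_weight_flip)
  also have "\<dots> = coeff (\<tau> (inverse \<zeta>) x) c"
    by (simp add: coeff_\<tau> power_int_minus power_int_inverse)
  finally show "coeff ((\<tau>\<^sub>0 \<circ> \<tau> \<zeta> \<circ> \<tau>\<^sub>0) x) c = coeff (\<tau> (inverse \<zeta>) x) c" .
qed

lemma \<tau>\<^sub>0_D0: "\<tau>\<^sub>0 D0 = smult (- 1) D0"
proof (rule poly_mapping_eqI)
  fix c show "coeff (\<tau>\<^sub>0 D0) c = coeff (smult (- 1) D0) c"
    by (cases c) (simp_all add: coeff_\<tau>\<^sub>0 bvec_simps coeff_bvec)
qed

lemma \<tau>\<^sub>0_Dplus: "\<tau>\<^sub>0 (Dplus t) = smult (- of_nat (aut_count t)) (Dminus t)"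
proof (rule poly_mapping_eqI)
  fix c show "coeff (\<tau>\<^sub>0 (Dplus t)) c = coeff (smult (- of_nat (aut_count t)) (Dminus t)) c"
    by (cases c) (auto simp: coeff_\<tau>\<^sub>0 bvec_simps coeff_bvec)
qed

section \<open>The image of the grading element\<close>

lemma double_sum_single:
  assumes "finite A" "finite B" "a \<in> A" "b \<in> B"
    and "\<And>x y. x \<in> A \<Longrightarrow> y \<in> B \<Longrightarrow> (x, y) \<noteq> (a, b) \<Longrightarrow> h x y = 0"
  shows "(\<Sum>x\<in>A. \<Sum>y\<in>B. h x y) = (h a b :: complex)"
proof -
  have "(\<Sum>x\<in>A. \<Sum>y\<in>B. h x y) = (\<Sum>p\<in>A \<times> B. h (fst p) (snd p))"
    by (simp add: sum.cartesian_product case_prod_beta)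
  also have "\<dots> = (\<Sum>p\<in>A \<times> B. if p = (a, b) then h a b else 0)"
  proof (rule sum.cong)
    fix p assume "p \<in> A \<times> B"
    then show "h (fst p) (snd p) = (if p = (a, b) then h a b else 0)"
      using assms(5)[of "fst p" "snd p"] by (cases "p = (a, b)") (auto simp: mem_Times_iff)
  qed simp
  also have "\<dots> = h a b" using assms(1-4) by simp
  finally show ?thesis .
qed

text \<open>
  Order the basis vectors by degree and, among trees of the same size, by root degree. Then the
  bouquet with \<open>m\<close> copies of \<open>t\<close> occurs in \<open>z\<close>, and no vector occurring in \<open>z\<close> lies above it.
\<close>

definition bouquet_leads :: "rtree \<Rightarrow> nat \<Rightarrow> ie_alg \<Rightarrow> bool" where
  "bouquet_leads t m z \<longleftrightarrow>
     (\<forall>b. coeff z b \<noteq> 0 \<longrightarrow> deg b \<le> int (tsize (bouquet t m))) \<and>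
     (\<forall>s. coeff z (Bplus s) \<noteq> 0 \<longrightarrow> tsize s = tsize (bouquet t m) \<longrightarrow> root_degree s \<le> m) \<and>
     coeff z (Bplus (bouquet t m)) \<noteq> 0"

text \<open>
  Only terms of maximal size in \<open>x\<close> and in \<open>z\<close> contribute in the new maximal size. Joining a tree of \<open>z\<close> to
  a tree of \<open>x\<close> yields a root degree of at most \<open>tsize t\<close>, hence at most \<open>m\<close>. So a bouquet with \<open>m + 1\<close>
  copies arises only by joining a tree of \<open>x\<close> to a tree of \<open>z\<close>, and by \<open>\<alpha>_bouquet\<close> only from \<open>t\<close> and
  the bouquet with \<open>m\<close> copies: nothing can cancel.
\<close>

lemma bouquet_leads_bracket:
  assumes x: "\<And>s. coeff x (Bplus s) \<noteq> 0 \<Longrightarrow> tsize s \<le> tsize t" "coeff x (Bplus t) \<noteq> 0"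
    and m: "tsize t \<le> m" and z: "bouquet_leads t m z"
  shows "bouquet_leads t (Suc m) (bracket x z)"
proof -
  have degx: "deg a \<le> int (tsize t)" if "coeff x a \<noteq> 0" for a
    using x(1) that by (cases a) auto
  have degz: "deg b \<le> int (tsize (bouquet t m))" if "coeff z b \<noteq> 0" for b
    using z that by (simp add: bouquet_leads_def)
  have size: "tsize (bouquet t (Suc m)) = tsize t + tsize (bouquet t m)"
    by (simp add: tsize_root_graft)
  have top: "\<exists>p q. a = Bplus p \<and> b = Bplus q \<and> tsize p = tsize t \<and> tsize q = tsize (bouquet t m)"
    if ab: "coeff x a \<noteq> 0" "coeff z b \<noteq> 0" "coeff (basis_bracket a b) (Bplus s) \<noteq> 0"
      and s: "tsize s = tsize (bouquet t (Suc m))" for a b s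
  proof -
    have "deg a = int (tsize t)" "deg b = int (tsize (bouquet t m))"
      using degx[OF ab(1)] degz[OF ab(2)] deg_basis_bracket[OF ab(3)] s size by simp_all
    then show ?thesis
      using tsize_pos[of t] tsize_pos[of "bouquet t m"] by (cases a; cases b) auto
  qed
  have small: "root_degree r \<le> m" if "\<beta> r q p \<noteq> 0" "tsize p = tsize t" for r p q
    using \<beta>_nonzero_cases[OF that(1)] root_degree_root_graft[of q p] root_degree_less_tsize[of p]
      that(2) m by auto
  have 1: "deg c \<le> int (tsize (bouquet t (Suc m)))" if c: "coeff (bracket x z) c \<noteq> 0" for c
  proof -
    obtain a b where "coeff x a \<noteq> 0" "coeff z b \<noteq> 0" "coeff (basis_bracket a b) c \<noteq> 0"
      using ex_keys_bracket[OF c] .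
    then show ?thesis using degx[of a] degz[of b] deg_basis_bracket[of a b c] size by simp
  qed
  have 2: "root_degree r \<le> Suc m"
    if c: "coeff (bracket x z) (Bplus r) \<noteq> 0" and r: "tsize r = tsize (bouquet t (Suc m))" for r
  proof -
    obtain a b where ab: "coeff x a \<noteq> 0" "coeff z b \<noteq> 0" "coeff (basis_bracket a b) (Bplus r) \<noteq> 0"
      using ex_keys_bracket[OF c] .
    obtain p q where pq: "a = Bplus p" "b = Bplus q" "tsize p = tsize t" "tsize q = tsize (bouquet t m)"
      using top[OF ab r] by blast
    have q: "root_degree q \<le> m" using z pq ab(2) by (simp add: bouquet_leads_def)
    have "\<beta> r p q \<noteq> 0 \<or> \<beta> r q p \<noteq> 0" using ab(3) pq(1,2) by auto
    then show ?thesis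
      using \<beta>_nonzero_cases[of r p q] root_degree_root_graft[of p q] q small[of r q p] pq(3) by auto
  qed
  have 3: "coeff (bracket x z) (Bplus (bouquet t (Suc m))) \<noteq> 0"
  proof -
    let ?r = "bouquet t (Suc m)"
    let ?h = "\<lambda>a b. coeff x a * coeff z b * coeff (basis_bracket a b) (Bplus ?r)"
    have nosmall: "\<beta> ?r q p = 0" if "tsize p = tsize t" for p q
      using small[of ?r q p] that root_degree_bouquet[of t "Suc m"] by fastforce
    have "coeff (bracket x z) (Bplus ?r) = ?h (Bplus t) (Bplus (bouquet t m))"
      unfolding coeff_bracket
    proof (rule double_sum_single)
      show "Bplus t \<in> Poly_Mapping.keys x" using x(2) by (simp add: in_keys_iff)
      show "Bplus (bouquet t m) \<in> Poly_Mapping.keys z" using z by (simp add: in_keys_iff bouquet_leads_def)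
      fix a b assume ab: "(a, b) \<noteq> (Bplus t, Bplus (bouquet t m))"
      show "?h a b = 0"
      proof (rule ccontr)
        assume nz: "?h a b \<noteq> 0"
        then obtain p q where pq: "a = Bplus p" "b = Bplus q" "tsize p = tsize t"
          using top[of a b ?r] by auto
        then have "\<beta> ?r p q \<noteq> 0" using nz nosmall[of p q] by auto
        then have "\<alpha> p ?r q \<noteq> 0" by (simp only: \<alpha>_nonzero_iff not_False_eq_True)
        then show False using \<alpha>_bouquet[of p t m q] pq ab by simp
      qed
    qed simp_all
    moreover have "\<beta> ?r t (bouquet t m) \<noteq> 0" using \<beta>_root_graft_nonzero by simp
    ultimately show ?thesis
      using x(2) z nosmall[of t "bouquet t m"] by (simp add: bouquet_leads_def)
  qed
  show ?thesis using 1 2 3 by (simp add: bouquet_leads_def)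
qed

text \<open>
  Let \<open>u\<close> be the preimage of a bouquet under \<open>f\<close>. The iterates of \<open>bracket (f D0)\<close> on the bouquet are the
  images of those of \<open>bracket D0\<close> on \<open>u\<close>, which only rescale the coefficients of \<open>u\<close>. Hence only the
  finitely many basis vectors in \<open>?K\<close> occur in them, whereas \<open>bouquet_leads_bracket\<close> produces arbitrarily
  large bouquets.
\<close>

lemma automorphism_D0_no_positive:
  assumes f: "ie_automorphism f"
  shows "coeff (f D0) (Bplus t) = 0"
proof (rule ccontr)
  assume t: "coeff (f D0) (Bplus t) \<noteq> 0"
  let ?x = "f D0"
  define A where "A = {t. coeff ?x (Bplus t) \<noteq> 0}"
  have "finite (Bplus -` Poly_Mapping.keys ?x)"
    by (rule finite_vimageI[OF finite_keys inj_Bplus])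
  moreover have "A = Bplus -` Poly_Mapping.keys ?x" by (auto simp: A_def in_keys_iff)
  ultimately have A: "finite (tsize ` A)" "tsize ` A \<noteq> {}" using t by (auto simp: A_def)
  obtain t0 where t0: "t0 \<in> A" "tsize t0 = Max (tsize ` A)" using Max_in[OF A] by auto
  have max: "tsize s \<le> tsize t0" if "coeff ?x (Bplus s) \<noteq> 0" for s
    using that A(1) t0(2) by (simp add: A_def)
  \<comment> \<open>The number of copies to start from is the least one that \<open>bouquet_leads_bracket\<close> admits.\<close>
  let ?m = "tsize t0" and ?y = "Dplus (bouquet t0 (tsize t0))"
  have leads: "bouquet_leads t0 (?m + k) ((bracket ?x ^^ k) ?y)" for k
  proof (induction k)
    case 0
    show ?case by (auto simp: bouquet_leads_def bvec_simps coeff_bvec root_degree_bouquet split: if_splits)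
  next
    case (Suc k)
    then show ?case
      using bouquet_leads_bracket[OF max _ _ Suc] t0(1) by (simp add: A_def)
  qed
  define u where "u = inv_into UNIV f ?y"
  have fu: "f u = ?y" using automorphism_bij[OF f] by (simp add: u_def bij_is_surj surj_f_inv_f)
  have pow: "(bracket ?x ^^ k) ?y = f ((bracket D0 ^^ k) u)" for k
    by (induction k) (simp_all add: fu automorphism_bracket[OF f])
  have keysu: "Poly_Mapping.keys ((bracket D0 ^^ k) u) \<subseteq> Poly_Mapping.keys u" for k
    by (induction k) (auto simp: in_keys_iff coeff_D0_bracket)
  let ?K = "\<Union>b\<in>Poly_Mapping.keys u. Poly_Mapping.keys (f (bvec b))"
  have in_K: "c \<in> ?K" if c: "coeff (f w) c \<noteq> 0" and w: "Poly_Mapping.keys w \<subseteq> Poly_Mapping.keys u" for w c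
  proof -
    have "coeff (f w) c = (\<Sum>b\<in>Poly_Mapping.keys w. coeff w b * coeff (f (bvec b)) c)"
      unfolding linear_eq_lin_ext[OF automorphism_linear[OF f], of w] coeff_lin_ext ..
    then obtain b where "b \<in> Poly_Mapping.keys w" "coeff (f (bvec b)) c \<noteq> 0"
      using c by (metis (no_types, lifting) mult_zero_right sum.neutral)
    then show ?thesis using w by (auto simp: in_keys_iff)
  qed
  have "Bplus (bouquet t0 (?m + k)) \<in> ?K" for k
    using leads[of k] in_K[OF _ keysu[of k]] by (simp add: bouquet_leads_def pow)
  then have "range (\<lambda>k. Bplus (bouquet t0 (?m + k))) \<subseteq> ?K" by blast
  then have "finite (range (\<lambda>k. Bplus (bouquet t0 (?m + k))))" by (rule finite_subset) simp
  moreover have "inj (\<lambda>k. Bplus (bouquet t0 (?m + k)))"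
    by (rule injI) (metis ie_basis.inject(1) root_degree_bouquet add_left_cancel)
  ultimately show False using finite_imageD by blast
qed

text \<open>
  The coefficients at the vectors \<open>Dminus t\<close> become those at \<open>Dplus t\<close>, up to a factor, after composing
  with \<open>\<tau>\<^sub>0\<close>.
\<close>

lemma automorphism_D0_scalar:
  assumes f: "ie_automorphism f"
  shows "f D0 = smult (coeff (f D0) Bd) D0"
proof (rule poly_mapping_eqI)
  fix c
  have "coeff (f D0) (Bminus t) = 0" for t
    using automorphism_D0_no_positive[OF automorphism_comp[OF \<tau>\<^sub>0_automorphism f], of t]
    by (simp add: coeff_\<tau>\<^sub>0)
  then show "coeff (f D0) c = coeff (smult (coeff (f D0) Bd) D0) c"
    using automorphism_D0_no_positive[OF f] by (cases c) (simp_all add: bvec_simps coeff_bvec)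
qed

lemma bvec_nonzero: "bvec b \<noteq> 0"
  by (metis coeff_bvec lookup_zero zero_neq_one)

lemma D0_bracket_bvec: "bracket D0 (bvec b) = smult (of_int (deg b)) (bvec b)"
  by (rule poly_mapping_eqI) (auto simp: coeff_D0_bracket coeff_bvec)

lemma automorphism_D0_eigenvalue:
  assumes f: "ie_automorphism f" and c: "f D0 = smult c D0"
    and b': "coeff (f (bvec b)) b' \<noteq> 0"
  shows "c * of_int (deg b') = of_int (deg b)"
proof -
  have "smult c (bracket D0 (f (bvec b))) = f (bracket D0 (bvec b))"
    by (simp add: automorphism_bracket[OF f] c bracket_smult_left)
  also have "\<dots> = smult (of_int (deg b)) (f (bvec b))"
    by (simp add: D0_bracket_bvec automorphism_smult[OF f])
  finally have "coeff (smult c (bracket D0 (f (bvec b)))) b' =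
      coeff (smult (of_int (deg b)) (f (bvec b))) b'" by simp
  then show ?thesis using b' by (simp add: coeff_D0_bracket)
qed

text \<open>
  The eigenvalue 1 of \<open>bracket D0\<close> must be an eigenvalue of \<open>bracket (f D0)\<close>, and those are the integer
  multiples of \<open>c\<close>.
\<close>

lemma automorphism_D0_integrality:
  assumes f: "ie_automorphism f" and c: "f D0 = smult c D0"
  obtains n :: int where "c * of_int n = 1"
proof -
  let ?b = "Bplus one_vertex_tree"
  have "f (bvec ?b) \<noteq> 0" by (rule automorphism_nonzero[OF f bvec_nonzero])
  then obtain b' where "coeff (f (bvec ?b)) b' \<noteq> 0" by (metis lookup_zero poly_mapping_eqI)
  then have "c * of_int (deg b') = 1" using automorphism_D0_eigenvalue[OF f c] by fastforce
  then show thesis using that by blast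
qed

text \<open>
  By \<open>automorphism_D0_integrality\<close> for \<open>f\<close> and its inverse, both \<open>c\<close> and \<open>1 / c\<close> are integers.
\<close>

lemma automorphism_D0:
  assumes f: "ie_automorphism f"
  shows "f D0 = D0 \<or> f D0 = smult (- 1) D0"
proof -
  define c where "c = coeff (f D0) Bd"
  have c: "f D0 = smult c D0" unfolding c_def by (rule automorphism_D0_scalar[OF f])
  obtain n :: int where n: "c * of_int n = 1" using automorphism_D0_integrality[OF f c] .
  then have c0: "c \<noteq> 0" by auto
  have "smult (inverse c) (inv_into UNIV f (smult c D0)) = smult (inverse c) D0"
    using automorphism_bij[OF f] c by (metis bij_is_inj inv_f_f)
  then have "inv_into UNIV f D0 = smult (inverse c) D0"
    using c0 automorphism_smult[OF automorphism_inv[OF f]] by simp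
  then obtain k :: int where k: "inverse c * of_int k = 1"
    using automorphism_D0_integrality[OF automorphism_inv[OF f]] by blast
  then have ck: "c = of_int k" using c0 by (simp add: field_simps)
  then have "(of_int (k * n) :: complex) = of_int 1" using n by simp
  then have "k * n = 1" by (simp only: of_int_eq_iff)
  then have "k = 1 \<or> k = - 1" by (auto simp: zmult_eq_1_iff)
  then show ?thesis using c ck by auto
qed

section \<open>Automorphisms fixing the grading element\<close>

lemma automorphism_fixed_span:
  assumes f: "ie_automorphism f" and "\<And>b. coeff x b \<noteq> 0 \<Longrightarrow> f (bvec b) = bvec b"
  shows "f x = x"
proof -
  have "f x = lin_ext (\<lambda>b. f (bvec b)) x"
    by (rule linear_eq_lin_ext[OF automorphism_linear[OF f]])
  also have "\<dots> = lin_ext bvec x"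
    unfolding lin_ext_def by (rule sum.cong) (use assms(2) in \<open>auto simp: in_keys_iff\<close>)
  also have "\<dots> = x"
    using linear_eq_lin_ext[of id x] by (simp add: linear_smult_iff)
  finally show ?thesis .
qed

lemma automorphism_graded:
  assumes "ie_automorphism f" "f D0 = D0" "coeff (f (bvec b)) b' \<noteq> 0"
  shows "deg b' = deg b"
proof -
  have "(of_int (deg b') :: complex) = of_int (deg b)"
    using automorphism_D0_eigenvalue[OF assms(1), of 1 b b'] assms(2,3) by simp
  then show ?thesis by (simp only: of_int_eq_iff)
qed

text \<open>
  For \<open>tsize s < n\<close> the bracket of \<open>Dminus s\<close> with \<open>Dplus t\<close> is a combination of smaller vectors
  \<open>Dplus r\<close>, all of them fixed. Therefore \<open>f (Dplus t)\<close> and \<open>Dplus t\<close> have the same bracket with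
  \<open>Dminus s\<close>, and \<open>\<alpha>_nondegenerate\<close> applies to their difference.
\<close>

lemma automorphism_fixes_next_degree:
  assumes f: "ie_automorphism f" and D0: "f D0 = D0" and n: "n \<ge> 2"
    and IH: "\<And>s. tsize s < n \<Longrightarrow> f (Dplus s) = Dplus s \<and> f (Dminus s) = Dminus s"
    and t: "tsize t = n"
  shows "f (Dplus t) = Dplus t"
proof -
  define u where "u s = coeff (f (Dplus t)) (Bplus s) - coeff (Dplus t) (Bplus s)" for s
  let ?T = "{s. tsize s = n}"
  have fin: "finite ?T" by (rule finite_subset[OF _ finite_tsize_le[of n]]) auto
  have homogeneous: "b \<in> Bplus ` ?T" if "deg b = int n" for b
    using that n by (cases b) auto
  have cb: "coeff (bracket (Dminus s) v) (Bplus r) = (\<Sum>t'\<in>?T. coeff v (Bplus t') * of_nat (\<alpha> s t' r))"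
    if v: "\<And>b. coeff v b \<noteq> 0 \<Longrightarrow> deg b = int n" for v s r
  proof -
    have "Poly_Mapping.keys v \<subseteq> Bplus ` ?T" using v homogeneous by (auto simp: in_keys_iff)
    then have "coeff (bracket (Dminus s) v) (Bplus r) = (\<Sum>a\<in>{Bminus s}. \<Sum>b\<in>Bplus ` ?T.
        coeff (Dminus s) a * coeff v b * coeff (basis_bracket a b) (Bplus r))"
      using fin by (intro coeff_bracket_superset) (auto simp: bvec_simps)
    also have "\<dots> = (\<Sum>t'\<in>?T. coeff v (Bplus t') * of_nat (\<alpha> s t' r))"
      using inj_Bplus by (simp add: sum.reindex inj_on_subset bvec_simps coeff_bvec)
    finally show ?thesis .
  qed
  have degf: "deg b = int n" if "coeff (f (Dplus t)) b \<noteq> 0" for b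
    using automorphism_graded[OF f D0, of "Bplus t" b] that t by (simp add: bvec_simps)
  have degt: "deg b = int n" if "coeff (Dplus t) b \<noteq> 0" for b
    using that t by (cases b) (auto simp: bvec_simps coeff_bvec split: if_splits)
  have "u s = 0" if s: "tsize s = n" for s
  proof (rule \<alpha>_nondegenerate[OF n _ s])
    fix s r assume sr: "tsize s + tsize r = n"
    then have less: "tsize s < n" "tsize r < n" using tsize_pos[of s] tsize_pos[of r] by simp_all
    have "f (bracket (Dminus s) (Dplus t)) = bracket (Dminus s) (Dplus t)"
    proof (rule automorphism_fixed_span[OF f])
      fix b assume "coeff (bracket (Dminus s) (Dplus t)) b \<noteq> 0"
      then have "deg b = int (tsize r)"
        using deg_basis_bracket[of "Bminus s" "Bplus t" b] sr t by (simp add: bvec_simps bracket_bvec)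
      then obtain r' where "b = Bplus r'" "tsize r' < n"
        using less(2) tsize_pos[of r] by (cases b) auto
      then show "f (bvec b) = bvec b" using IH[of r'] by (simp add: bvec_simps)
    qed
    then have "bracket (Dminus s) (f (Dplus t)) = bracket (Dminus s) (Dplus t)"
      using automorphism_bracket[OF f] IH[OF less(1)] by simp
    then have "(\<Sum>t'\<in>?T. coeff (f (Dplus t)) (Bplus t') * of_nat (\<alpha> s t' r)) =
        (\<Sum>t'\<in>?T. coeff (Dplus t) (Bplus t') * of_nat (\<alpha> s t' r))"
      using cb[where v = "f (Dplus t)" and s = s and r = r, OF degf]
        cb[where v = "Dplus t" and s = s and r = r, OF degt] by simp
    then show "(\<Sum>t'\<in>?T. u t' * of_nat (\<alpha> s t' r)) = 0"
      by (simp add: u_def left_diff_distrib sum_subtractf)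
  qed
  then have eq: "coeff (f (Dplus t)) (Bplus s) = coeff (Dplus t) (Bplus s)" if "tsize s = n" for s
    using that by (simp add: u_def)
  show ?thesis
  proof (rule poly_mapping_eqI)
    fix b
    show "coeff (f (Dplus t)) b = coeff (Dplus t) b"
    proof (cases "deg b = int n")
      case True
      then show ?thesis using homogeneous[of b] eq by auto
    next
      case False
      then show ?thesis using degf[of b] degt[of b] by metis
    qed
  qed
qed

text \<open>
  The induction on the size must treat \<open>Dplus t\<close> and \<open>Dminus t\<close> together, because the step for one sign
  uses fixed vectors of the other. Conjugation by \<open>\<tau>\<^sub>0\<close> exchanges the signs, so the same step serves for
  both.
\<close>

lemma automorphism_fixing_generators:
  assumes f: "ie_automorphism f" and D0: "f D0 = D0"
    and gen: "f (Dplus one_vertex_tree) = Dplus one_vertex_tree"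
      "f (Dminus one_vertex_tree) = Dminus one_vertex_tree"
  shows "f = id"
proof -
  let ?g = "\<tau>\<^sub>0 \<circ> f \<circ> \<tau>\<^sub>0"
  have g: "ie_automorphism ?g"
    by (intro automorphism_comp \<tau>\<^sub>0_automorphism f)
  have swap: "?g (Dplus t) = Dplus t \<longleftrightarrow> f (Dminus t) = Dminus t" for t
  proof -
    let ?c = "- of_nat (aut_count t) :: complex"
    have "?g (Dplus t) = Dplus t \<longleftrightarrow> f (\<tau>\<^sub>0 (Dplus t)) = \<tau>\<^sub>0 (Dplus t)"
      by (metis comp_apply \<tau>\<^sub>0_\<tau>\<^sub>0)
    also have "\<dots> \<longleftrightarrow> smult ?c (f (Dminus t)) = smult ?c (Dminus t)"
      by (simp add: \<tau>\<^sub>0_Dplus automorphism_smult[OF f])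
    also have "\<dots> \<longleftrightarrow> f (Dminus t) = Dminus t"
    proof
      assume "smult ?c (f (Dminus t)) = smult ?c (Dminus t)"
      then have "smult (inverse ?c) (smult ?c (f (Dminus t))) = smult (inverse ?c) (smult ?c (Dminus t))"
        by simp
      then show "f (Dminus t) = Dminus t" by simp
    qed simp
    finally show ?thesis .
  qed
  have swap': "?g (Dminus t) = Dminus t \<longleftrightarrow> f (Dplus t) = Dplus t" for t
  proof -
    let ?c = "- of_nat (aut_count t) :: complex"
    have m: "Dminus t = smult (inverse ?c) (\<tau>\<^sub>0 (Dplus t))" by (simp add: \<tau>\<^sub>0_Dplus)
    have lin: "?g (smult k x) = smult k (?g x)" for k x by (rule automorphism_smult[OF g])
    have "?g (Dminus t) = smult (inverse ?c) (\<tau>\<^sub>0 (f (Dplus t)))"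
      unfolding m lin by (simp add: \<tau>\<^sub>0_\<tau>\<^sub>0)
    then have "?g (Dminus t) = Dminus t \<longleftrightarrow>
        smult (inverse ?c) (\<tau>\<^sub>0 (f (Dplus t))) = smult (inverse ?c) (\<tau>\<^sub>0 (Dplus t))"
      using m by simp
    also have "\<dots> \<longleftrightarrow> f (Dplus t) = Dplus t"
    proof
      assume "smult (inverse ?c) (\<tau>\<^sub>0 (f (Dplus t))) = smult (inverse ?c) (\<tau>\<^sub>0 (Dplus t))"
      then have "smult ?c (smult (inverse ?c) (\<tau>\<^sub>0 (f (Dplus t)))) =
          smult ?c (smult (inverse ?c) (\<tau>\<^sub>0 (Dplus t)))" by simp
      then have "\<tau>\<^sub>0 (f (Dplus t)) = \<tau>\<^sub>0 (Dplus t)" by simp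
      then show "f (Dplus t) = Dplus t" by (metis \<tau>\<^sub>0_\<tau>\<^sub>0)
    qed simp
    finally show ?thesis .
  qed
  have gD0: "?g D0 = D0"
    using automorphism_smult[OF f, of "- 1" D0] automorphism_smult[OF \<tau>\<^sub>0_automorphism, of "- 1" D0] D0
    by (simp add: \<tau>\<^sub>0_D0)
  have fixed: "f (Dplus t) = Dplus t \<and> f (Dminus t) = Dminus t" for t
  proof (induction "tsize t" arbitrary: t rule: less_induct)
    case less
    show ?case
    proof (cases "tsize t = 1")
      case True
      then show ?thesis using gen by (simp only: tsize_eq_1_iff)
    next
      case False
      then have n: "tsize t \<ge> 2" using tsize_pos[of t] by linarith
      have "f (Dplus t) = Dplus t"
        by (rule automorphism_fixes_next_degree[OF f D0 n _ refl]) (rule less.hyps)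
      moreover have "?g (Dplus t) = Dplus t"
      proof (rule automorphism_fixes_next_degree[OF g gD0 n _ refl])
        fix s assume "tsize s < tsize t"
        then show "?g (Dplus s) = Dplus s \<and> ?g (Dminus s) = Dminus s"
          unfolding swap swap' using less.hyps by blast
      qed
      ultimately show ?thesis unfolding swap by blast
    qed
  qed
  show ?thesis
  proof
    fix x
    have "f (bvec b) = bvec b" for b
      using D0 fixed by (cases b) (simp_all add: bvec_simps)
    then show "f x = id x" using automorphism_fixed_span[OF f] by simp
  qed
qed

text \<open>
  A graded map scales the vectors of the only tree of size 1, say by \<open>a\<close> and \<open>a'\<close>. Since their bracket
  \<open>D0\<close> is fixed, \<open>a' a = 1\<close>, which is how \<open>\<tau> a\<close> scales them.
\<close>

lemma automorphism_fixing_D0: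
  assumes f: "ie_automorphism f" and D0: "f D0 = D0"
  obtains \<zeta> where "\<zeta> \<noteq> 0" "f = \<tau> \<zeta>"
proof -
  let ?t = one_vertex_tree
  define a where "a = coeff (f (Dplus ?t)) (Bplus ?t)"
  define a' where "a' = coeff (f (Dminus ?t)) (Bminus ?t)"
  have fp: "f (Dplus ?t) = smult a (Dplus ?t)"
  proof (rule poly_mapping_eqI)
    fix b
    show "coeff (f (Dplus ?t)) b = coeff (smult a (Dplus ?t)) b"
    proof (cases "b = Bplus ?t")
      case False
      then have "deg b \<noteq> deg (Bplus ?t)"
        using tsize_eq_1_iff by (cases b) auto
      then have "coeff (f (bvec (Bplus ?t))) b = 0" using automorphism_graded[OF f D0] by blast
      then show ?thesis using False by (simp add: bvec_simps coeff_bvec)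
    qed (simp add: a_def bvec_simps coeff_bvec)
  qed
  have fm: "f (Dminus ?t) = smult a' (Dminus ?t)"
  proof (rule poly_mapping_eqI)
    fix b
    show "coeff (f (Dminus ?t)) b = coeff (smult a' (Dminus ?t)) b"
    proof (cases "b = Bminus ?t")
      case False
      then have "deg b \<noteq> deg (Bminus ?t)"
        using tsize_eq_1_iff by (cases b) auto
      then have "coeff (f (bvec (Bminus ?t))) b = 0" using automorphism_graded[OF f D0] by blast
      then show ?thesis using False by (simp add: bvec_simps coeff_bvec)
    qed (simp add: a'_def bvec_simps coeff_bvec)
  qed
  have br: "bracket (Dminus ?t) (Dplus ?t) = D0"
    by (simp add: bvec_simps bracket_bvec) (simp add: bracket_mp_def bvec_simps)
  have "bracket (smult a' (Dminus ?t)) (smult a (Dplus ?t)) = smult a' (smult a D0)"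
    using linear_bracket[of "Dminus ?t"] br by (simp only: bracket_smult_left linear_smult_iff)
  then have "smult (a' * a) D0 = D0"
    using automorphism_bracket[OF f, of "Dminus ?t" "Dplus ?t"] by (simp add: br fp fm D0)
  then have "coeff (smult (a' * a) D0) Bd = coeff D0 Bd" by simp
  then have aa: "a' * a = 1" by (simp add: bvec_simps coeff_bvec)
  then have a0: "a \<noteq> 0" by auto
  let ?g = "\<tau> (inverse a) \<circ> f"
  have g: "ie_automorphism ?g"
    using a0 by (intro automorphism_comp \<tau>_automorphism f) simp
  have \<tau>_bvec: "\<tau> z (bvec b) = smult (z powi deg b) (bvec b)" for z b
    by (rule poly_mapping_eqI) (auto simp: coeff_\<tau> coeff_bvec)
  have \<tau>_smult: "\<tau> z (smult k x) = smult k (\<tau> z x)" for z k x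
    by (rule poly_mapping_eqI) (simp add: coeff_\<tau>)
  have "?g = id"
  proof (rule automorphism_fixing_generators[OF g])
    show "?g D0 = D0" by (simp add: D0) (simp add: bvec_simps \<tau>_bvec)
    show "?g (Dplus ?t) = Dplus ?t"
      using a0 by (simp add: fp \<tau>_smult) (simp add: bvec_simps \<tau>_bvec)
    show "?g (Dminus ?t) = Dminus ?t"
      using aa a0 by (simp add: fm \<tau>_smult) (simp add: bvec_simps \<tau>_bvec power_int_minus)
  qed
  then have "\<tau> a \<circ> (\<tau> (inverse a) \<circ> f) = \<tau> a" by simp
  then have "f = \<tau> a" using a0 by (simp add: \<tau>_comp \<tau>_1 comp_assoc[symmetric])
  then show thesis using that a0 by blast
qed

text \<open>
  If \<open>f\<close> changes the sign of \<open>D0\<close>, then \<open>\<tau>\<^sub>0 \<circ> f\<close> fixes it and equals some \<open>\<tau> \<zeta>\<close>; moving \<open>\<tau>\<^sub>0\<close> past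
  \<open>\<tau> \<zeta>\<close> inverts \<open>\<zeta>\<close>.
\<close>

lemma automorphism_cases:
  assumes f: "ie_automorphism f"
  obtains \<zeta> h where "\<zeta> \<noteq> 0" "h \<in> A_zero" "f = \<tau> \<zeta> \<circ> h"
proof -
  consider "f D0 = D0" | "f D0 = smult (- 1) D0" using automorphism_D0[OF f] by blast
  then show thesis
  proof cases
    case 1
    then obtain \<zeta> where "\<zeta> \<noteq> 0" "f = \<tau> \<zeta>" by (rule automorphism_fixing_D0[OF f])
    then show thesis using that[of \<zeta> id] by (simp add: A_zero_def)
  next
    case 2
    have "(\<tau>\<^sub>0 \<circ> f) D0 = D0"
      using 2 automorphism_smult[OF \<tau>\<^sub>0_automorphism, of "- 1" D0] by (simp add: \<tau>\<^sub>0_D0)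
    then obtain \<zeta> where z: "\<zeta> \<noteq> 0" "\<tau>\<^sub>0 \<circ> f = \<tau> \<zeta>"
      by (rule automorphism_fixing_D0[OF automorphism_comp[OF \<tau>\<^sub>0_automorphism f]])
    have "f = \<tau>\<^sub>0 \<circ> (\<tau>\<^sub>0 \<circ> f)" by (simp add: fun_eq_iff \<tau>\<^sub>0_\<tau>\<^sub>0)
    also have "\<dots> = \<tau>\<^sub>0 \<circ> \<tau> \<zeta> \<circ> \<tau>\<^sub>0 \<circ> \<tau>\<^sub>0" unfolding z(2) by (simp add: fun_eq_iff \<tau>\<^sub>0_\<tau>\<^sub>0)
    also have "\<dots> = \<tau> (inverse \<zeta>) \<circ> \<tau>\<^sub>0" unfolding \<tau>\<^sub>0_\<tau>_\<tau>\<^sub>0 ..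
    finally show thesis using that[of "inverse \<zeta>" \<tau>\<^sub>0] z(1) by (simp add: A_zero_def)
  qed
qed

section \<open>The semidirect product\<close>

lemma Aut_ie_simps [simp]:
  "carrier Aut_ie = {f. ie_automorphism f}" "f \<otimes>\<^bsub>Aut_ie\<^esub> g = f \<circ> g" "\<one>\<^bsub>Aut_ie\<^esub> = id"
  by (simp_all add: Aut_ie_def)

lemma automorphism_id: "ie_automorphism id"
  by (simp add: ie_automorphism_def linear_smult_iff)

lemma group_Aut_ie: "Group.group Aut_ie"
proof (rule groupI)
  fix f assume "f \<in> carrier Aut_ie"
  then have f: "ie_automorphism f" by simp
  have "inv_into UNIV f \<circ> f = id" using automorphism_bij[OF f] by (simp add: bij_is_inj)
  then show "\<exists>g\<in>carrier Aut_ie. g \<otimes>\<^bsub>Aut_ie\<^esub> f = \<one>\<^bsub>Aut_ie\<^esub>"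
    using automorphism_inv[OF f] by auto
qed (auto simp: automorphism_comp automorphism_id comp_assoc)

interpretation Aut: Group.group Aut_ie
  by (rule group_Aut_ie)

lemma subgroup_A_Cstar: "subgroup A_Cstar Aut_ie"
proof (rule Aut.subgroupI)
  show "A_Cstar \<subseteq> carrier Aut_ie" using \<tau>_automorphism by (auto simp: A_Cstar_def)
  show "A_Cstar \<noteq> {}" by (auto simp: A_Cstar_def intro: exI[of _ 1])
  show "inv\<^bsub>Aut_ie\<^esub> f \<in> A_Cstar" if f: "f \<in> A_Cstar" for f
  proof -
    obtain \<zeta> where z: "\<zeta> \<noteq> 0" "f = \<tau> \<zeta>" using f by (auto simp: A_Cstar_def)
    have "inv\<^bsub>Aut_ie\<^esub> f = \<tau> (inverse \<zeta>)"
      using z by (intro Aut.inv_equality) (simp_all add: \<tau>_comp \<tau>_1 \<tau>_automorphism)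
    then show ?thesis using z by (auto simp: A_Cstar_def)
  qed
  show "f \<otimes>\<^bsub>Aut_ie\<^esub> g \<in> A_Cstar" if "f \<in> A_Cstar" "g \<in> A_Cstar" for f g
    using that by (fastforce simp: A_Cstar_def \<tau>_comp)
qed

lemma subgroup_A_zero: "subgroup A_zero Aut_ie"
proof (rule Aut.subgroupI)
  show "A_zero \<subseteq> carrier Aut_ie"
    using \<tau>\<^sub>0_automorphism automorphism_id by (auto simp: A_zero_def)
  have "inv\<^bsub>Aut_ie\<^esub> \<tau>\<^sub>0 = \<tau>\<^sub>0"
    by (rule Aut.inv_equality) (simp_all add: \<tau>\<^sub>0_involution \<tau>\<^sub>0_automorphism)
  moreover have "inv\<^bsub>Aut_ie\<^esub> id = id" using Aut.inv_one by simp
  ultimately show "inv\<^bsub>Aut_ie\<^esub> f \<in> A_zero" if "f \<in> A_zero" for f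
    using that by (auto simp: A_zero_def)
  show "f \<otimes>\<^bsub>Aut_ie\<^esub> g \<in> A_zero" if "f \<in> A_zero" "g \<in> A_zero" for f g
    using that by (auto simp: A_zero_def \<tau>\<^sub>0_involution)
qed (auto simp: A_zero_def)

text \<open>
  Writing \<open>f = \<tau> \<eta> \<circ> h\<close>, conjugation by \<open>h\<close> preserves or inverts the parameter, and conjugation by
  \<open>\<tau> \<eta>\<close> does nothing since these maps commute.
\<close>

lemma normal_A_Cstar: "A_Cstar \<lhd> Aut_ie"
  unfolding Aut.normal_inv_iff
proof (intro conjI ballI)
  fix f g assume "f \<in> carrier Aut_ie" and "g \<in> A_Cstar"
  then obtain \<zeta> where f: "ie_automorphism f" and z: "\<zeta> \<noteq> 0" "g = \<tau> \<zeta>" by (auto simp: A_Cstar_def)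
  obtain \<eta> h where h: "\<eta> \<noteq> 0" "h \<in> A_zero" "f = \<tau> \<eta> \<circ> h" by (rule automorphism_cases[OF f])
  have finv: "inv\<^bsub>Aut_ie\<^esub> f = h \<circ> \<tau> (inverse \<eta>)"
  proof (rule Aut.inv_equality)
    have "ie_automorphism h" using h(2) subgroup.subset[OF subgroup_A_zero] by auto
    then show "h \<circ> \<tau> (inverse \<eta>) \<in> carrier Aut_ie"
      using h(1) by (simp add: automorphism_comp \<tau>_automorphism)
    have hh: "h \<circ> h = id" using h(2) \<tau>\<^sub>0_involution by (auto simp: A_zero_def)
    have "h \<circ> \<tau> (inverse \<eta>) \<circ> f = h \<circ> (\<tau> (inverse \<eta>) \<circ> \<tau> \<eta>) \<circ> h"
      unfolding h(3) by (simp only: comp_assoc)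
    also have "\<dots> = id" using h(1) hh by (simp add: \<tau>_comp \<tau>_1)
    finally show "(h \<circ> \<tau> (inverse \<eta>)) \<otimes>\<^bsub>Aut_ie\<^esub> f = \<one>\<^bsub>Aut_ie\<^esub>"
      by (simp only: Aut_ie_simps)
  qed (simp add: f)
  have "f \<circ> g \<circ> (h \<circ> \<tau> (inverse \<eta>)) = \<tau> \<eta> \<circ> (h \<circ> \<tau> \<zeta> \<circ> h) \<circ> \<tau> (inverse \<eta>)"
    unfolding h(3) z(2) by (simp only: comp_assoc)
  moreover obtain \<xi> where "\<xi> \<noteq> 0" "h \<circ> \<tau> \<zeta> \<circ> h = \<tau> \<xi>"
  proof -
    consider "h = id" | "h = \<tau>\<^sub>0" using h(2) by (auto simp: A_zero_def)
    then show thesis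
      using that[of \<zeta>] that[of "inverse \<zeta>"] z(1) \<tau>\<^sub>0_\<tau>_\<tau>\<^sub>0[of \<zeta>] by cases simp_all
  qed
  ultimately have "f \<circ> g \<circ> (h \<circ> \<tau> (inverse \<eta>)) = \<tau> (\<eta> * \<xi> * inverse \<eta>)" "\<eta> * \<xi> * inverse \<eta> \<noteq> 0"
    using h(1) by (simp_all add: \<tau>_comp)
  then show "f \<otimes>\<^bsub>Aut_ie\<^esub> g \<otimes>\<^bsub>Aut_ie\<^esub> inv\<^bsub>Aut_ie\<^esub> f \<in> A_Cstar"
    unfolding finv Aut_ie_simps A_Cstar_def by blast
qed (rule subgroup_A_Cstar)

lemma A_Cstar_A_zero_product: "A_Cstar <#>\<^bsub>Aut_ie\<^esub> A_zero = carrier Aut_ie"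
proof
  show "A_Cstar <#>\<^bsub>Aut_ie\<^esub> A_zero \<subseteq> carrier Aut_ie"
    by (rule Aut.set_mult_closed[OF subgroup.subset[OF subgroup_A_Cstar]
          subgroup.subset[OF subgroup_A_zero]])
  show "carrier Aut_ie \<subseteq> A_Cstar <#>\<^bsub>Aut_ie\<^esub> A_zero"
  proof
    fix f assume "f \<in> carrier Aut_ie"
    then have "ie_automorphism f" by simp
    then obtain \<zeta> h where h: "\<zeta> \<noteq> 0" "h \<in> A_zero" "f = \<tau> \<zeta> \<circ> h" by (rule automorphism_cases)
    then have "\<tau> \<zeta> \<in> A_Cstar" by (auto simp: A_Cstar_def)
    then show "f \<in> A_Cstar <#>\<^bsub>Aut_ie\<^esub> A_zero"
      using h(2,3) unfolding set_mult_def by auto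
  qed
qed

lemma A_Cstar_Int_A_zero: "A_Cstar \<inter> A_zero = {id}"
proof -
  have "\<tau> \<zeta> \<noteq> \<tau>\<^sub>0" for \<zeta>
  proof
    assume "\<tau> \<zeta> = \<tau>\<^sub>0"
    then have "coeff (\<tau> \<zeta> D0) Bd = coeff (\<tau>\<^sub>0 D0) Bd" by simp
    then show False by (simp add: coeff_\<tau> coeff_\<tau>\<^sub>0 bvec_simps coeff_bvec)
  qed
  then have "\<tau>\<^sub>0 \<notin> A_Cstar" by (simp add: A_Cstar_def) metis
  moreover have "\<tau> 1 \<in> A_Cstar"
    unfolding A_Cstar_def by (rule CollectI, rule exI[of _ 1]) simp
  ultimately show ?thesis by (simp add: A_zero_def \<tau>_1)
qed

theorem theorem6p9:
  shows "internal_semidirect_product Aut_ie A_Cstar A_zero \<and>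
    (\<forall>\<zeta>. \<zeta> \<noteq> 0 \<longrightarrow> \<tau>\<^sub>0 \<circ> \<tau> \<zeta> \<circ> \<tau>\<^sub>0 = \<tau> (inverse \<zeta>))"
  unfolding internal_semidirect_product_def
  using normal_A_Cstar subgroup_A_zero A_Cstar_A_zero_product A_Cstar_Int_A_zero \<tau>\<^sub>0_\<tau>_\<tau>\<^sub>0
  by simp

end
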